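(* Let $0<\beta<1$, $H\in(1/2,1)$ and $T>0$. For any $h\in\mathcal{H}_H$ and $F,G\in\mathcal{F}C_{b,H}^\infty$, $$\mathbb{E}\big[G\,\partial_{1,h}F\big]=\mathbb{E}\big[F\,\partial_{1,h}^*G\big],$$ where $$\partial_{1,h}^*G=-\partial_{1,h}G+G\left(\int_0^\cdot\dot h(t)\,\mathrm{d}\widetilde W(t)\right)\big(T\mathcal{Y}_\beta^{1/(2H)}\big)$$ and $\mathbb{E}$ is the expectation with respect to $\mathbb{P}_H\otimes\mathbb{P}_{Y_\beta}$.
   Context: $\mathbb{R}^+=[0,\infty)$. $\mathbb{W}$ is the space of continuous $w:\mathbb{R}^+\to\mathbb{R}$ with $w(0)=0$, with the topology of locally uniform convergence. $\mathbb{P}_H$ is the unique probability measure on $\mathbb{W}$ under which the canonical process $W^H(t)(w)=w(t)$ is a fractional Brownian motion with Hurst index $H$, i.e. centered Gaussian with covariance $R_H(t,s)=\frac12(t^{2H}+s^{2H}-|t-s|^{2H})$. $\mathbb{P}_{Y_\beta}$ is the probability measure on $\mathbb{R}^+$ with density $M_\beta$ determined by $\int_0^\infty e^{-s\tau}M_\beta(\tau)\,d\tau=E_\beta(-s)$, $s\ge0$, with $E_\beta(z)=\sum_{n\ge0}z^n/\Gamma(\beta n+1)$. $\mathcal{Y}_\beta(\tau)=\tau$ on $\mathbb{R}^+$, and $\tau_H:=\tau^{1/(2H)}$. Kernel: for $H\in(1/2,1)$, $$K_H(t,r)=c_H\,r^{1/2-H}\int_r^tu^{H-1/2}(u-r)^{H-3/2}\,\mathrm{d}u\;\mathbf{1}_{(0,t]}(r),\qquad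 c_H=\Big(\frac{H(2H-1)\,\Gamma(3/2-H)}{ \Gamma(2-2H)\,\Gamma(H-1/2)}\Big)^{1/2},$$ so that $R_H(t,s)=\int_0^{t\wedge s}K_H(t,r)K_H(s,r)\,\mathrm{d}r$. The operator $(\mathcal{K}_Hf)(t)=\int_0^tK_H(t,s)f(s)\,\mathrm{d}s$ is injective on $L^2(\lambda)=L^2(\mathbb{R}^+,\text{Lebesgue})$; $\mathcal{H}_H=\mathcal{K}_H(L^2(\lambda))$, and $\dot h:=\mathcal{K}_H^{-1}h$ for $h\in\mathcal{H}_H$, with $(h,g)_{\mathcal{H}_H}=\int_0^\infty\dot h\dot g\,\mathrm{d}\lambda$. Let $\delta_H:\mathcal{H}_H\to L^2(\mathbb{P}_H)$ be the linear isometry extending $R_H(t,\cdot)\mapsto W^H(t)$, $t\ge0$. Then $\widetilde W(t)=\delta_H(\mathcal{K}_H(\mathbf{1}_{[0,t]}))$ (continuous version) is a standard Brownian motion under $\mathbb{P}_H$, with $W^H(t)=\int_0^tK_H(t,s)\,\mathrm{d}\widetilde W(s)$. $\mathcal{F}C_{b,H}^\infty$ (depending on $T$) is the class of functions $F(w,\tau)=f(w(t_1\tau_H),\dots,w(t_n\tau_H))$ on $\mathbb{W}\times\mathbb{R}^+$ with $n\in\mathbb{N}$, $0<t_1<\dots<t_n\le T$ and $f\in C_b^\infty(\mathbb{R}^n)$, the set of $C^\infty$ real-valued functions bounded together with all their partial derivatives. For such $F$ and $h\in\mathcal{H}_H$, $(\partial_{1,h}F)(w,\tau)=\lim_{\varepsilon\to0}\varepsilon^{-1}\big(F(w+\varepsilon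 h,\tau)-F(w,\tau)\big)=\sum_{i=1}^n\partial_if(w(t_1\tau_H),\dots,w(t_n\tau_H))\,h(t_i\tau_H)$. $\big(\int_0^\cdot\dot h\,\mathrm{d}\widetilde W\big)(T\mathcal{Y}_\beta^{1/(2H)})$ is the random variable $(w,\tau)\mapsto\big(\int_0^{T\tau_H}\dot h(t)\,\mathrm{d}\widetilde W(t)\big)(w)$ (continuous version of the Wiener integral process). *)

theory Defs
  imports "HOL-Probability.Probability"
begin

text \<open>
  Functions on \<open>[0,\<infinity>)\<close> are rendered as functions \<open>real \<Rightarrow> real\<close>. Where such functions are
  themselves points of a space (continuous paths, elements of the Cameron-Martin space), the
  representative is the one that vanishes on the negative half-line, so that these spaces are closed
  under pointwise linear combinations.
\<close>

section \<open>Lebesgue measure on the half-line and square-integrable functions\<close>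

abbreviation half_line :: "real measure" where
  "half_line \<equiv> restrict_space lborel {0..}"

definition L2_fun :: "'a measure \<Rightarrow> ('a \<Rightarrow> real) set" where
  "L2_fun M = {f. f \<in> borel_measurable M \<and> integrable M (\<lambda>x. (f x)\<^sup>2)}"


section \<open>The path space and the law of fractional Brownian motion\<close>

definition path_space :: "(real \<Rightarrow> real) set" where
  "path_space = {w. continuous_on {0..} w \<and> w 0 = 0 \<and> (\<forall>t<0. w t = 0)}"

text \<open>Open sets for locally uniform convergence, i.e. uniform convergence on each \<open>[0,N]\<close>.\<close>

definition path_open :: "(real \<Rightarrow> real) set \<Rightarrow> bool" where
  "path_open U \<longleftrightarrow> U \<subseteq> path_space \<and>
     (\<forall>w\<in>U. \<exists>N>0. \<exists>e>0. \<forall>v\<in>path_space. (\<forall>t\<in>{0..N}. \<bar>v t - w t\<bar> < e) \<longrightarrow> v \<in> U)"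

definition path_borel :: "(real \<Rightarrow> real) measure" where
  "path_borel = sigma path_space {U. path_open U}"

text \<open>Standard deviation \<open>0\<close> is allowed and gives a point mass.\<close>

definition gaussian_law :: "real \<Rightarrow> real \<Rightarrow> real measure" where
  "gaussian_law m \<sigma> =
     (if \<sigma> = 0 then return borel m else density lborel (\<lambda>x. ennreal (normal_density m \<sigma> x)))"

definition gaussian_process :: "'a measure \<Rightarrow> 'i set \<Rightarrow> ('i \<Rightarrow> 'a \<Rightarrow> real) \<Rightarrow> bool" where
  "gaussian_process M I X \<longleftrightarrow>
     (\<forall>i\<in>I. X i \<in> borel_measurable M) \<and>
     (\<forall>S c. finite S \<and> S \<subseteq> I \<longrightarrow>
        (\<exists>m \<sigma>. 0 \<le> \<sigma> \<and> distr M borel (\<lambda>\<omega>. \<Sum>i\<in>S. c i * X i \<omega>) = gaussian_law m \<sigma>))"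

definition fbm_cov :: "real \<Rightarrow> real \<Rightarrow> real \<Rightarrow> real" where
  "fbm_cov H t s = (t powr (2 * H) + s powr (2 * H) - \<bar>t - s\<bar> powr (2 * H)) / 2"

definition fbm_law :: "real \<Rightarrow> (real \<Rightarrow> real) measure \<Rightarrow> bool" where
  "fbm_law H P \<longleftrightarrow> prob_space P \<and> space P = path_space \<and> sets P = sets path_borel \<and>
     gaussian_process P {0..} (\<lambda>t w. w t) \<and>
     (\<forall>t\<ge>0. (\<integral>w. w t \<partial>P) = 0) \<and>
     (\<forall>t\<ge>0. \<forall>s\<ge>0. (\<integral>w. w t * w s \<partial>P) = fbm_cov H t s)"


section \<open>The random time\<close>

definition mittag_leffler :: "real \<Rightarrow> real \<Rightarrow> real" where
  "mittag_leffler \<beta> z = (\<Sum>n. z ^ n / Gamma (\<beta> * real n + 1))"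

text \<open>\<open>M\<close> is (a version of) the density \<open>M\<^sub>\<beta>\<close>, characterised by its Laplace transform.\<close>

definition M_density :: "real \<Rightarrow> (real \<Rightarrow> real) \<Rightarrow> bool" where
  "M_density \<beta> M \<longleftrightarrow> M \<in> borel_measurable half_line \<and> (\<forall>\<tau>\<ge>0. 0 \<le> M \<tau>) \<and>
     (\<forall>s\<ge>0. has_bochner_integral half_line (\<lambda>\<tau>. exp (- s * \<tau>) * M \<tau>) (mittag_leffler \<beta> (- s)))"

definition time_law :: "(real \<Rightarrow> real) \<Rightarrow> real measure" where
  "time_law M = density half_line (\<lambda>\<tau>. ennreal (M \<tau>))"

definition time_H :: "real \<Rightarrow> real \<Rightarrow> real" where
  "time_H H \<tau> = \<tau> powr (1 / (2 * H))"


section \<open>The kernel, its integral operator and the Cameron-Martin space\<close>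

definition kernel_const :: "real \<Rightarrow> real" where
  "kernel_const H =
     sqrt (H * (2 * H - 1) * Gamma (3 / 2 - H) / (Gamma (2 - 2 * H) * Gamma (H - 1 / 2)))"

definition kernel :: "real \<Rightarrow> real \<Rightarrow> real \<Rightarrow> real" where
  "kernel H t r = kernel_const H * r powr (1 / 2 - H) *
     (LINT u:{r..t}|lborel. u powr (H - 1 / 2) * (u - r) powr (H - 3 / 2)) * indicator {0<..t} r"

definition kernel_op :: "real \<Rightarrow> (real \<Rightarrow> real) \<Rightarrow> real \<Rightarrow> real" where
  "kernel_op H f t = (LINT s:{0..t}|lborel. kernel H t s * f s)"

definition CM_space :: "real \<Rightarrow> (real \<Rightarrow> real) set" where
  "CM_space H = kernel_op H ` L2_fun half_line"

text \<open>
  Since \<open>kernel_op H\<close> is injective on classes modulo null sets, \<open>CM_dot H h\<close> is a representative of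
  the class whose image is \<open>h\<close>.
\<close>

definition CM_dot :: "real \<Rightarrow> (real \<Rightarrow> real) \<Rightarrow> real \<Rightarrow> real" where
  "CM_dot H h = inv_into (L2_fun half_line) (kernel_op H) h"

definition CM_inner :: "real \<Rightarrow> (real \<Rightarrow> real) \<Rightarrow> (real \<Rightarrow> real) \<Rightarrow> real" where
  "CM_inner H h g = (\<integral>s. CM_dot H h s * CM_dot H g s \<partial>half_line)"

text \<open>
  \<open>\<delta>\<close> picks representatives of the classes in \<open>L\<^sup>2(P)\<close>; hence linearity and the values on the
  functions \<open>R\<^sub>H(t,\<cdot>)\<close> (cut off on the negative half-line) are required almost surely.
\<close>

definition CM_isometry ::
    "real \<Rightarrow> (real \<Rightarrow> real) measure \<Rightarrow> ((real \<Rightarrow> real) \<Rightarrow> (real \<Rightarrow> real) \<Rightarrow> real) \<Rightarrow> bool" where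
  "CM_isometry H P \<delta> \<longleftrightarrow>
     (\<forall>h\<in>CM_space H. \<delta> h \<in> L2_fun P) \<and>
     (\<forall>h\<in>CM_space H. \<forall>g\<in>CM_space H. \<forall>a b.
        AE w in P. \<delta> (\<lambda>t. a * h t + b * g t) w = a * \<delta> h w + b * \<delta> g w) \<and>
     (\<forall>h\<in>CM_space H. (\<integral>w. (\<delta> h w)\<^sup>2 \<partial>P) = CM_inner H h h) \<and>
     (\<forall>t\<ge>0. AE w in P. \<delta> (\<lambda>s. fbm_cov H t s * indicator {0..} s) w = w t)"


section \<open>Continuous versions and Wiener integrals\<close>

definition continuous_paths :: "'a measure \<Rightarrow> (real \<Rightarrow> 'a \<Rightarrow> real) \<Rightarrow> bool" where
  "continuous_paths M X \<longleftrightarrow>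
     (\<forall>t\<ge>0. X t \<in> borel_measurable M) \<and> (\<forall>\<omega>\<in>space M. continuous_on {0..} (\<lambda>t. X t \<omega>))"

definition continuous_version ::
    "'a measure \<Rightarrow> (real \<Rightarrow> 'a \<Rightarrow> real) \<Rightarrow> (real \<Rightarrow> 'a \<Rightarrow> real) \<Rightarrow> bool" where
  "continuous_version M X Y \<longleftrightarrow> continuous_paths M Y \<and> (\<forall>t\<ge>0. AE \<omega> in M. Y t \<omega> = X t \<omega>)"

definition step_fun :: "nat \<Rightarrow> (nat \<Rightarrow> real) \<Rightarrow> (nat \<Rightarrow> real) \<Rightarrow> real \<Rightarrow> real" where
  "step_fun n s c r = (\<Sum>i<n. c i * indicator {s i<..s (Suc i)} r)"

definition step_integral ::
    "(real \<Rightarrow> 'a \<Rightarrow> real) \<Rightarrow> nat \<Rightarrow> (nat \<Rightarrow> real) \<Rightarrow> (nat \<Rightarrow> real) \<Rightarrow> 'a \<Rightarrow> real" where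
  "step_integral B n s c \<omega> = (\<Sum>i<n. c i * (B (s (Suc i)) \<omega> - B (s i) \<omega>))"

text \<open>
  \<open>X\<close> is a version of the Wiener integral of \<open>f\<close> over \<open>[0,\<infinity>)\<close> against \<open>B\<close>: the limit in \<open>L\<^sup>2(M)\<close> of
  the integrals of step functions that approximate \<open>f\<close> in \<open>L\<^sup>2\<close> of the half-line.
\<close>

definition wiener_integral ::
    "'a measure \<Rightarrow> (real \<Rightarrow> 'a \<Rightarrow> real) \<Rightarrow> (real \<Rightarrow> real) \<Rightarrow> ('a \<Rightarrow> real) \<Rightarrow> bool" where
  "wiener_integral M B f X \<longleftrightarrow> X \<in> borel_measurable M \<and>
     (\<exists>n s c. (\<forall>k. 0 \<le> s k 0 \<and> mono (s k)) \<and>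
        (\<lambda>k. \<integral>\<^sup>+r. ennreal ((f r - step_fun (n k) (s k) (c k) r)\<^sup>2) \<partial>half_line) \<longlonglongrightarrow> 0 \<and>
        (\<lambda>k. \<integral>\<^sup>+\<omega>. ennreal ((X \<omega> - step_integral B (n k) (s k) (c k) \<omega>)\<^sup>2) \<partial>M) \<longlonglongrightarrow> 0)"

text \<open>\<open>Z\<close> is a continuous version of the process \<open>t \<mapsto> \<integral>\<^sub>0\<^sup>t f dB\<close>.\<close>

definition wiener_integral_process ::
    "'a measure \<Rightarrow> (real \<Rightarrow> 'a \<Rightarrow> real) \<Rightarrow> (real \<Rightarrow> real) \<Rightarrow> (real \<Rightarrow> 'a \<Rightarrow> real) \<Rightarrow> bool" where
  "wiener_integral_process M B f Z \<longleftrightarrow> continuous_paths M Z \<and>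
     (\<forall>t\<ge>0. wiener_integral M B (\<lambda>r. f r * indicator {0..t} r) (Z t))"


section \<open>Smooth cylinder functions and the partial derivative\<close>

definition partial_deriv :: "nat \<Rightarrow> ((nat \<Rightarrow> real) \<Rightarrow> real) \<Rightarrow> (nat \<Rightarrow> real) \<Rightarrow> real" where
  "partial_deriv i f x = deriv (\<lambda>s. f (x(i := s))) (x i)"

text \<open>
  A function on \<open>\<real>\<^sup>n\<close> is rendered as a function of sequences that depends only on the coordinates
  \<open>0, \<dots>, n - 1\<close>; on such functions, continuity for the product topology on \<open>nat \<Rightarrow> real\<close> is continuity
  on \<open>\<real>\<^sup>n\<close>. The list \<open>is\<close> runs through all iterated partial derivatives, the empty list giving \<open>f\<close>.
\<close>

definition Cb_smooth :: "nat \<Rightarrow> ((nat \<Rightarrow> real) \<Rightarrow> real) set" where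
  "Cb_smooth n = {f.
     (\<forall>x y. (\<forall>i<n. x i = y i) \<longrightarrow> f x = f y) \<and>
     (\<forall>is. set is \<subseteq> {..<n} \<longrightarrow>
        continuous_on UNIV (foldr partial_deriv is f) \<and>
        bounded (range (foldr partial_deriv is f)) \<and>
        (\<forall>i<n. \<forall>x. (\<lambda>s. foldr partial_deriv is f (x(i := s))) differentiable at (x i)))}"

text \<open>The time points \<open>t\<^sub>1 < \<dots> < t\<^sub>n\<close> are indexed by \<open>0, \<dots>, n - 1\<close>.\<close>

definition cylinder_funs :: "real \<Rightarrow> real \<Rightarrow> ((real \<Rightarrow> real) \<times> real \<Rightarrow> real) set" where
  "cylinder_funs H T = {F. \<exists>n t f. 0 < n \<and> f \<in> Cb_smooth n \<and>
     (\<forall>i<n. 0 < t i \<and> t i \<le> T) \<and> strict_mono_on {..<n} t \<and>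
     F = (\<lambda>(w, \<tau>). f (\<lambda>i. w (t i * time_H H \<tau>)))}"

definition D1 ::
    "(real \<Rightarrow> real) \<Rightarrow> ((real \<Rightarrow> real) \<times> real \<Rightarrow> real) \<Rightarrow> (real \<Rightarrow> real) \<times> real \<Rightarrow> real" where
  "D1 h F = (\<lambda>(w, \<tau>). Lim (at 0) (\<lambda>\<epsilon>. (F (\<lambda>t. w t + \<epsilon> * h t, \<tau>) - F (w, \<tau>)) / \<epsilon>))"

text \<open>Here \<open>Z\<close> stands for the Wiener integral process of \<open>CM_dot H h\<close>.\<close>

definition D1_adj ::
    "real \<Rightarrow> real \<Rightarrow> (real \<Rightarrow> (real \<Rightarrow> real) \<Rightarrow> real) \<Rightarrow> (real \<Rightarrow> real) \<Rightarrow>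
     ((real \<Rightarrow> real) \<times> real \<Rightarrow> real) \<Rightarrow> (real \<Rightarrow> real) \<times> real \<Rightarrow> real" where
  "D1_adj H T Z h G = (\<lambda>(w, \<tau>). - D1 h G (w, \<tau>) + G (w, \<tau>) * Z (T * time_H H \<tau>) w)"

end

theory Submission
  imports Defs
begin

text \<open>
  For a fixed value of the random time \<open>\<tau>\<close>, the functions \<open>F\<close> and
  \<open>G\<close> are smooth cylinder functions of a fractional Brownian path that only look at
  times up to \<open>S = T \<tau>\<^sub>H\<close>. The product rule turns the claim into
  \<open>E[D\<^sub>h(F G)] = E[F G Z(S)]\<close>, which is Gaussian integration by parts:
  \<open>Z(S)\<close> lies in the Gaussian Hilbert space spanned by the coordinates
  \<open>w(u)\<close>, and its covariance with \<open>w(u)\<close> is \<open>h(u)\<close> for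
  every \<open>u \<le> S\<close>. Fubini over \<open>\<tau>\<close> finishes the argument, because
  \<open>h(t \<tau>\<^sub>H)\<close> grows like \<open>\<tau>\<^sup>1\<^sup>/\<^sup>2\<close> and
  \<open>\<tau>\<close> has a finite mean.

  The covariance and the membership in the span come from the operator \<open>kernel_op H\<close>.
  The Beta integral shows that the kernels \<open>K\<^sub>t = kernel H t\<close> satisfy
  \<open>\<integral> K\<^sub>t K\<^sub>s = R\<^sub>H(t, s)\<close> (\<open>kernel_inner\<close>),
  so \<open>R\<^sub>H(t, \<cdot>)\<close> is the image of \<open>K\<^sub>t\<close>. Abel inversion
  shows that the operator is injective (\<open>kernel_op_injective\<close>). Injectivity has two
  consequences. First, \<open>f \<mapsto> \<delta> (kernel_op H f)\<close> is an isometry of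
  \<open>L\<^sup>2\<close> of the half-line, linear up to null sets, which sends
  \<open>K\<^sub>t\<close> to \<open>w(t)\<close> and \<open>1\<^bsub>[0,t]\<^esub>\<close> to
  \<open>B(t)\<close>; hence \<open>Z(S)\<close> is the image of
  \<open>1\<^bsub>[0,S]\<^esub>\<close> times \<open>CM_dot H h\<close>
  (\<open>wiener_integral_eq_wiener\<close>), and its covariance with \<open>w(u)\<close> is
  \<open>\<integral> CM_dot H h K\<^sub>u = h(u)\<close>. Second, a function orthogonal to all
  \<open>K\<^sub>t\<close> vanishes, so by the projection theorem the \<open>K\<^sub>t\<close>
  span a dense subspace (\<open>kernel_span_dense\<close>), and images under the isometry are
  \<open>L\<^sup>2\<close> limits of linear combinations of coordinates.

  Integration by parts starts from one-dimensional Gaussian laws only. If every linear combination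
  of \<open>X\<close> and \<open>Y\<close> is a centred Gaussian variable, then \<open>E cos(X +
  \<epsilon> Y + \<theta>) = cos \<theta> exp(- E(X + \<epsilon> Y)\<^sup>2 / 2)\<close>, and the
  derivative at \<open>\<epsilon> = 0\<close> is \<open>E[Y sin(X + \<theta>)] = E[X Y] E[cos(X +
  \<theta>)]\<close>. This is the integration by parts formula for trigonometric functions, and it
  survives \<open>L\<^sup>2\<close> limits in \<open>Y\<close> (\<open>wiener_sin\<close>). The
  passage to a general test function \<open>\<Phi>\<close> avoids its derivatives: averaged over
  the segment from \<open>x\<close> to \<open>x + \<epsilon> a\<close>, where \<open>a\<close> is
  the vector of covariances, the formula reads \<open>E[Y \<integral>\<^sub>0\<^sup>1 \<Phi>(X +
  \<epsilon> s a) ds] = E[(\<Phi>(X + \<epsilon> a) - \<Phi>(X)) / \<epsilon>]\<close>. Here only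
  values of \<open>\<Phi>\<close> occur, so the identity extends to bounded pointwise limits of
  trigonometric polynomials, and by Stone-Weierstrass every bounded continuous
  \<open>\<Phi>\<close> is such a limit (\<open>trig_approx\<close>). Letting
  \<open>\<epsilon>\<close> tend to \<open>0\<close> gives the formula for \<open>\<Phi>\<close>
  (\<open>integration_by_parts_directional\<close>).
\<close>

section \<open>Square-integrable functions\<close>

lemma L2_funD:
  assumes "f \<in> L2_fun M"
  shows "f \<in> borel_measurable M" "integrable M (\<lambda>x. (f x)\<^sup>2)"
  using assms by (auto simp: L2_fun_def)

lemma L2_mult_integrable:
  assumes "f \<in> L2_fun M" "g \<in> L2_fun M"
  shows "integrable M (\<lambda>x. f x * g x)"
proof (rule Bochner_Integration.integrable_bound)
  show "integrable M (\<lambda>x. (f x)\<^sup>2 + (g x)\<^sup>2)"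
    using assms by (auto simp: L2_fun_def)
  show "(\<lambda>x. f x * g x) \<in> borel_measurable M"
    using assms by (auto simp: L2_fun_def)
  have "\<bar>a * b\<bar> \<le> a\<^sup>2 + b\<^sup>2" for a b :: real
    using sum_squares_bound[of "\<bar>a\<bar>" "\<bar>b\<bar>"] mult_nonneg_nonneg[of "\<bar>a\<bar>" "\<bar>b\<bar>"]
    unfolding abs_mult power2_abs by linarith
  then show "AE x in M. norm (f x * g x) \<le> norm ((f x)\<^sup>2 + (g x)\<^sup>2)"
    by (auto intro!: AE_I2)
qed

lemma L2_lincomb:
  assumes "f \<in> L2_fun M" "g \<in> L2_fun M"
  shows "(\<lambda>x. a * f x + b * g x) \<in> L2_fun M"
proof -
  have "integrable M (\<lambda>x. a\<^sup>2 * (f x)\<^sup>2 + b\<^sup>2 * (g x)\<^sup>2 + 2 * a * b * (f x * g x))"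
    using assms L2_mult_integrable[OF assms] by (auto simp: L2_fun_def)
  also have "(\<lambda>x. a\<^sup>2 * (f x)\<^sup>2 + b\<^sup>2 * (g x)\<^sup>2 + 2 * a * b * (f x * g x))
     = (\<lambda>x. (a * f x + b * g x)\<^sup>2)"
    by (auto simp: power2_eq_square algebra_simps)
  finally show ?thesis
    using assms by (auto simp: L2_fun_def)
qed

lemma L2_zero: "(\<lambda>x. 0) \<in> L2_fun M"
  by (simp add: L2_fun_def)

lemma L2_diff:
  assumes "f \<in> L2_fun M" "g \<in> L2_fun M"
  shows "(\<lambda>x. f x - g x) \<in> L2_fun M"
  using L2_lincomb[OF assms, of 1 "-1"] by simp

lemma L2_sum:
  assumes "\<And>i. i \<in> I \<Longrightarrow> f i \<in> L2_fun M"
  shows "(\<lambda>x. \<Sum>i\<in>I. c i * f i x) \<in> L2_fun M"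
proof (cases "finite I")
  case True
  then show ?thesis using assms
  proof (induction I rule: finite_induct)
    case (insert i I)
    then show ?case using L2_lincomb[of "f i" M "\<lambda>x. \<Sum>i\<in>I. c i * f i x" "c i" 1]
      by simp
  qed (simp add: L2_zero)
qed (simp add: L2_zero)

lemma L2_indicator:
  assumes "f \<in> L2_fun M" "A \<inter> space M \<in> sets M"
  shows "(\<lambda>x. f x * indicator A x) \<in> L2_fun M"
proof -
  have m: "(indicator A :: _ \<Rightarrow> real) \<in> borel_measurable M"
    using assms(2) by (simp add: borel_measurable_indicator_iff)
  have mf: "f \<in> borel_measurable M" and i: "integrable M (\<lambda>x. (f x)\<^sup>2)"
    using assms by (auto simp: L2_fun_def)
  have "integrable M (\<lambda>x. (f x * indicator A x)\<^sup>2)"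
  proof (rule Bochner_Integration.integrable_bound[OF i])
    show "(\<lambda>x. (f x * indicator A x)\<^sup>2) \<in> borel_measurable M"
      using m mf by simp
  qed (auto simp: indicator_def)
  then show ?thesis using assms m by (auto simp: L2_fun_def)
qed

lemma (in finite_measure) L2_integrable:
  assumes "f \<in> L2_fun M"
  shows "integrable M f"
  using L2_mult_integrable[OF assms, of "\<lambda>x. 1"] by (simp add: L2_fun_def)

lemma L2_Cauchy_Schwarz:
  assumes f: "f \<in> L2_fun M" and g: "g \<in> L2_fun M"
  shows "(\<integral>x. f x * g x \<partial>M)\<^sup>2 \<le> (\<integral>x. (f x)\<^sup>2 \<partial>M) * (\<integral>x. (g x)\<^sup>2 \<partial>M)"
proof -
  have *: "(\<integral>\<^sup>+x. ennreal \<bar>h x\<bar> ^ 2 \<partial>M) = ennreal (\<integral>x. (h x)\<^sup>2 \<partial>M)" if "h \<in> L2_fun M" for h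
  proof -
    have "(\<integral>\<^sup>+x. ennreal \<bar>h x\<bar> ^ 2 \<partial>M) = (\<integral>\<^sup>+x. ennreal ((h x)\<^sup>2) \<partial>M)"
      by (simp add: ennreal_power)
    also have "\<dots> = ennreal (\<integral>x. (h x)\<^sup>2 \<partial>M)"
      using that by (intro nn_integral_eq_integral) (auto simp: L2_fun_def)
    finally show ?thesis .
  qed
  have m[measurable]: "f \<in> borel_measurable M" "g \<in> borel_measurable M"
    using f g by (auto simp: L2_fun_def)
  have "(\<integral>\<^sup>+x. ennreal \<bar>f x\<bar> * ennreal \<bar>g x\<bar> \<partial>M) = (\<integral>\<^sup>+x. ennreal \<bar>f x * g x\<bar> \<partial>M)"
    by (simp add: abs_mult ennreal_mult)
  also have "\<dots> = ennreal (\<integral>x. \<bar>f x * g x\<bar> \<partial>M)"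
    using L2_mult_integrable[OF f g] by (intro nn_integral_eq_integral) auto
  finally have "ennreal ((\<integral>x. \<bar>f x * g x\<bar> \<partial>M)\<^sup>2)
     \<le> ennreal ((\<integral>x. (f x)\<^sup>2 \<partial>M) * (\<integral>x. (g x)\<^sup>2 \<partial>M))"
    using Cauchy_Schwarz_nn_integral[of "\<lambda>x. ennreal \<bar>f x\<bar>" M "\<lambda>x. ennreal \<bar>g x\<bar>"]
    unfolding *[OF f] *[OF g] by (simp add: ennreal_power ennreal_mult)
  then have "(\<integral>x. \<bar>f x * g x\<bar> \<partial>M)\<^sup>2 \<le> (\<integral>x. (f x)\<^sup>2 \<partial>M) * (\<integral>x. (g x)\<^sup>2 \<partial>M)"
    by (subst (asm) ennreal_le_iff) auto
  moreover have "(\<integral>x. f x * g x \<partial>M)\<^sup>2 \<le> (\<integral>x. \<bar>f x * g x\<bar> \<partial>M)\<^sup>2"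
    using integral_abs_bound[of M "\<lambda>x. f x * g x"] by (simp add: abs_le_square_iff[symmetric])
  ultimately show ?thesis by linarith
qed

lemma L2_norm_add:
  assumes f: "f \<in> L2_fun M" and g: "g \<in> L2_fun M"
  shows "(\<integral>x. (a * f x + b * g x)\<^sup>2 \<partial>M) =
    a\<^sup>2 * (\<integral>x. (f x)\<^sup>2 \<partial>M) + 2 * a * b * (\<integral>x. f x * g x \<partial>M) + b\<^sup>2 * (\<integral>x. (g x)\<^sup>2 \<partial>M)"
proof -
  have "(\<integral>x. (a * f x + b * g x)\<^sup>2 \<partial>M) =
    (\<integral>x. a\<^sup>2 * (f x)\<^sup>2 + 2 * a * b * (f x * g x) + b\<^sup>2 * (g x)\<^sup>2 \<partial>M)"
    by (intro Bochner_Integration.integral_cong) (auto simp: power2_eq_square algebra_simps)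
  also have "\<dots> = a\<^sup>2 * (\<integral>x. (f x)\<^sup>2 \<partial>M) + 2 * a * b * (\<integral>x. f x * g x \<partial>M) + b\<^sup>2 * (\<integral>x. (g x)\<^sup>2 \<partial>M)"
    using L2_mult_integrable[OF f g] L2_funD[OF f] L2_funD[OF g]
    by simp
  finally show ?thesis .
qed

lemma L2_norm_diff:
  assumes f: "f \<in> L2_fun M" and g: "g \<in> L2_fun M"
  shows "(\<integral>x. (f x - g x)\<^sup>2 \<partial>M) =
    (\<integral>x. (f x)\<^sup>2 \<partial>M) - 2 * (\<integral>x. f x * g x \<partial>M) + (\<integral>x. (g x)\<^sup>2 \<partial>M)"
  using L2_norm_add[OF f g, of 1 "-1"] by simp

text \<open>
  By Cauchy-Schwarz, pairing with a fixed function is continuous for convergence in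
  \<open>L\<^sup>2\<close>.
\<close>

lemma L2_limit_mult:
  assumes f: "f \<in> L2_fun M" and g: "g \<in> L2_fun M" and v: "\<And>n. v n \<in> L2_fun M"
    and lim: "(\<lambda>n. \<integral>x. (f x - v n x)\<^sup>2 \<partial>M) \<longlonglongrightarrow> 0"
  shows "(\<lambda>n. \<integral>x. v n x * g x \<partial>M) \<longlonglongrightarrow> (\<integral>x. f x * g x \<partial>M)"
proof -
  have "(\<lambda>n. (\<integral>x. (f x - v n x) * g x \<partial>M)\<^sup>2) \<longlonglongrightarrow> 0"
  proof (rule tendsto_sandwich[of "\<lambda>_. 0"])
    show "\<forall>\<^sub>F n in sequentially. (\<integral>x. (f x - v n x) * g x \<partial>M)\<^sup>2
       \<le> (\<integral>x. (f x - v n x)\<^sup>2 \<partial>M) * (\<integral>x. (g x)\<^sup>2 \<partial>M)"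
      using L2_Cauchy_Schwarz[OF L2_diff[OF f v] g] by simp
    show "(\<lambda>n. (\<integral>x. (f x - v n x)\<^sup>2 \<partial>M) * (\<integral>x. (g x)\<^sup>2 \<partial>M)) \<longlonglongrightarrow> 0"
      using tendsto_mult_left_zero[OF lim] by simp
  qed auto
  then have "(\<lambda>n. \<bar>\<integral>x. (f x - v n x) * g x \<partial>M\<bar>) \<longlonglongrightarrow> 0"
    using tendsto_real_sqrt[of _ 0] by fastforce
  then have "(\<lambda>n. \<integral>x. (f x - v n x) * g x \<partial>M) \<longlonglongrightarrow> 0"
    by (simp add: tendsto_rabs_zero_iff)
  moreover have "(\<integral>x. (f x - v n x) * g x \<partial>M) = (\<integral>x. f x * g x \<partial>M) - (\<integral>x. v n x * g x \<partial>M)" for n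
    using L2_mult_integrable[OF f g] L2_mult_integrable[OF v g] by (simp add: algebra_simps)
  ultimately have "(\<lambda>n. (\<integral>x. f x * g x \<partial>M) - (\<integral>x. v n x * g x \<partial>M)) \<longlonglongrightarrow> 0"
    by simp
  from tendsto_diff[OF tendsto_const[of "\<integral>x. f x * g x \<partial>M"] this] show ?thesis
    by simp
qed

text \<open>
  Along a subsequence whose successive differences have square norms at most
  \<open>8\<^sup>-\<^sup>k\<close>, the weighted series \<open>\<Sum> 4\<^sup>k
  d\<^sub>k\<^sup>2\<close> has a finite integral. Hence it is finite almost everywhere, which
  bounds \<open>\<bar>d\<^sub>k\<bar>\<close> by a multiple of \<open>2\<^sup>-\<^sup>k\<close>
  and makes the subsequence converge almost everywhere. Fatou's lemma then turns the Cauchy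
  property into convergence to the pointwise limit.
\<close>

lemma L2_complete:
  assumes v: "\<And>n. v n \<in> L2_fun M"
    and cauchy: "\<And>e. e > 0 \<Longrightarrow> \<exists>N. \<forall>m\<ge>N. \<forall>n\<ge>N. (\<integral>x. (v m x - v n x)\<^sup>2 \<partial>M) < (e::real)"
  shows "\<exists>f\<in>L2_fun M. (\<lambda>n. \<integral>x. (f x - v n x)\<^sup>2 \<partial>M) \<longlonglongrightarrow> 0"
proof -
  have vm[measurable]: "v n \<in> borel_measurable M" for n using v by (auto simp: L2_fun_def)
  have nn: "(\<integral>\<^sup>+x. ennreal ((v m x - v n x)\<^sup>2) \<partial>M) = ennreal (\<integral>x. (v m x - v n x)\<^sup>2 \<partial>M)" for m n
    using L2_funD(2)[OF L2_diff[OF v v]] by (intro nn_integral_eq_integral) auto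
  have "\<exists>N. \<forall>m\<ge>N. \<forall>n\<ge>N. (\<integral>x. (v m x - v n x)\<^sup>2 \<partial>M) < (1/8)^k" for k
    by (rule cauchy) simp
  then obtain N where N: "\<And>k m n. m \<ge> N k \<Longrightarrow> n \<ge> N k \<Longrightarrow> (\<integral>x. (v m x - v n x)\<^sup>2 \<partial>M) < (1/8)^k"
    by metis
  \<comment> \<open>The sum dominates \<open>N k\<close> and is monotone in \<open>k\<close>; the summand
    \<open>k\<close> makes \<open>j\<close> unbounded.\<close>
  define j where "j k = (\<Sum>i\<le>k. N i) + k" for k
  have jN: "j k \<ge> N k" for k unfolding j_def by (simp add: trans_le_add1 member_le_sum)
  have jS: "j (Suc k) \<ge> N k" for k
  proof -
    have "N k \<le> (\<Sum>i\<le>Suc k. N i)" by (rule member_le_sum) auto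
    then show ?thesis unfolding j_def by linarith
  qed
  have jk: "j k \<ge> k" for k by (simp add: j_def)
  define d where "d k x = v (j (Suc k)) x - v (j k) x" for k x
  have d: "(\<integral>\<^sup>+x. ennreal ((d k x)\<^sup>2) \<partial>M) \<le> ennreal ((1/8)^k)" for k
    unfolding d_def nn using N[OF jS[of k] jN[of k]] by (intro ennreal_leI) simp
  have [measurable]: "d k \<in> borel_measurable M" for k unfolding d_def by measurable
  have "(\<integral>\<^sup>+x. (\<Sum>k. ennreal (4^k * (d k x)\<^sup>2)) \<partial>M) = (\<Sum>k. \<integral>\<^sup>+x. ennreal (4^k * (d k x)\<^sup>2) \<partial>M)"
    by (rule nn_integral_suminf) measurable
  also have "\<dots> \<le> (\<Sum>k. ennreal ((1/2)^k))"
  proof (intro suminf_le allI)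
    fix k
    have "(\<integral>\<^sup>+x. ennreal (4^k * (d k x)\<^sup>2) \<partial>M) = ennreal (4^k) * (\<integral>\<^sup>+x. ennreal ((d k x)\<^sup>2) \<partial>M)"
      by (subst nn_integral_cmult[symmetric]) (auto simp: ennreal_mult)
    also have "\<dots> \<le> ennreal (4^k) * ennreal ((1/8)^k)"
      by (intro mult_left_mono d) auto
    also have "\<dots> = ennreal ((1/2)^k)"
      by (simp add: ennreal_mult[symmetric] power_mult_distrib[symmetric])
    finally show "(\<integral>\<^sup>+x. ennreal (4^k * (d k x)\<^sup>2) \<partial>M) \<le> ennreal ((1/2)^k)" .
  qed auto
  also have "\<dots> < \<infinity>"
    by (subst suminf_ennreal2) (auto simp: summable_geometric)
  finally have "AE x in M. (\<Sum>k. ennreal (4^k * (d k x)\<^sup>2)) \<noteq> \<infinity>"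
    by (intro nn_integral_PInf_AE) auto
  then have ae: "AE x in M. convergent (\<lambda>k. v (j k) x)"
  proof eventually_elim
    case (elim x)
    have s: "summable (\<lambda>k. 4^k * (d k x)\<^sup>2)"
      by (rule summable_suminf_not_top) (use elim in auto)
    have "(\<lambda>k. 4^k * (d k x)\<^sup>2) \<longlonglongrightarrow> 0" using summable_LIMSEQ_zero[OF s] .
    then have "Bseq (\<lambda>k. 4^k * (d k x)\<^sup>2)" by (intro convergent_imp_Bseq) (auto simp: convergent_def)
    then obtain K where K: "K > 0" "\<And>k. \<bar>4^k * (d k x)\<^sup>2\<bar> \<le> K" unfolding Bseq_def by auto
    have "\<bar>d k x\<bar> \<le> sqrt K * (1/2)^k" for k
    proof -
      have "(2^k * \<bar>d k x\<bar>)\<^sup>2 \<le> K" using K(2)[of k]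
        by (simp add: power_mult_distrib power_mult[symmetric] mult.commute[of k] abs_mult)
           (simp add: power_mult)
      then have "2^k * \<bar>d k x\<bar> \<le> sqrt K" by (rule real_le_rsqrt)
      then show ?thesis by (simp add: field_simps)
    qed
    then have "summable (\<lambda>k. d k x)"
      by (intro summable_comparison_test[of "\<lambda>k. d k x" "\<lambda>k. sqrt K * (1/2)^k"])
         (auto intro!: summable_mult summable_geometric)
    then have "convergent (\<lambda>n. \<Sum>k<n. d k x)" by (simp add: summable_iff_convergent)
    moreover have "(\<Sum>k<n. d k x) = v (j n) x - v (j 0) x" for n
      unfolding d_def by (rule sum_lessThan_telescope)
    ultimately have "convergent (\<lambda>n. v (j n) x - v (j 0) x)" by simp
    then have "convergent (\<lambda>n. (v (j n) x - v (j 0) x) + v (j 0) x)"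
      by (intro convergent_add convergent_const)
    then show "convergent (\<lambda>k. v (j k) x)" by simp
  qed
  define f where "f x = (if convergent (\<lambda>k. v (j k) x) then lim (\<lambda>k. v (j k) x) else 0)" for x
  have fm[measurable]: "f \<in> borel_measurable M"
    unfolding f_def Cauchy_convergent_iff[symmetric] by measurable
  have flim: "AE x in M. (\<lambda>k. v (j k) x) \<longlonglongrightarrow> f x"
    using ae by eventually_elim (simp add: f_def convergent_LIMSEQ_iff)
  have fatou: "(\<integral>\<^sup>+x. ennreal ((f x - v n x)\<^sup>2) \<partial>M) \<le> ennreal e"
    if n: "\<And>m. m \<ge> n0 \<Longrightarrow> (\<integral>x. (v m x - v n x)\<^sup>2 \<partial>M) \<le> e" for n n0 e
  proof -
    have "(\<integral>\<^sup>+x. ennreal ((f x - v n x)\<^sup>2) \<partial>M) = (\<integral>\<^sup>+x. liminf (\<lambda>k. ennreal ((v (j k) x - v n x)\<^sup>2)) \<partial>M)"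
    proof (rule nn_integral_cong_AE)
      show "AE x in M. ennreal ((f x - v n x)\<^sup>2) = liminf (\<lambda>k. ennreal ((v (j k) x - v n x)\<^sup>2))"
        using flim
      proof eventually_elim
        case (elim x)
        then have "(\<lambda>k. ennreal ((v (j k) x - v n x)\<^sup>2)) \<longlonglongrightarrow> ennreal ((f x - v n x)\<^sup>2)"
          by (intro tendsto_intros)
        then show ?case using lim_imp_Liminf[OF sequentially_bot] by metis
      qed
    qed
    also have "\<dots> \<le> liminf (\<lambda>k. \<integral>\<^sup>+x. ennreal ((v (j k) x - v n x)\<^sup>2) \<partial>M)"
      by (rule nn_integral_liminf) measurable
    also have "\<dots> \<le> liminf (\<lambda>k. ennreal e)"
    proof (rule Liminf_mono)
      show "\<forall>\<^sub>F k in sequentially. (\<integral>\<^sup>+x. ennreal ((v (j k) x - v n x)\<^sup>2) \<partial>M) \<le> ennreal e"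
        using eventually_ge_at_top[of n0]
        by eventually_elim (metis nn ennreal_leI n jk order_trans)
    qed
    finally show ?thesis by (simp add: Liminf_const)
  qed
  have f2: "f \<in> L2_fun M"
  proof -
    obtain N1 where "\<forall>m\<ge>N1. \<forall>n\<ge>N1. (\<integral>x. (v m x - v n x)\<^sup>2 \<partial>M) < 1" using cauchy[of 1] by auto
    then have "(\<integral>\<^sup>+x. ennreal ((f x - v N1 x)\<^sup>2) \<partial>M) \<le> ennreal 1"
      by (intro fatou[of N1]) (simp add: less_imp_le)
    then have "(\<integral>\<^sup>+x. ennreal ((f x - v N1 x)\<^sup>2) \<partial>M) < \<infinity>" by (rule le_less_trans) simp
    then have "(\<lambda>x. f x - v N1 x) \<in> L2_fun M"
      by (auto simp: L2_fun_def intro!: integrableI_bounded)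
    from L2_lincomb[OF this v[of N1], of 1 1] show ?thesis by simp
  qed
  have "(\<lambda>n. \<integral>x. (f x - v n x)\<^sup>2 \<partial>M) \<longlonglongrightarrow> 0"
  proof (rule LIMSEQ_I)
    fix r :: real assume r: "r > 0"
    obtain N1 where N1: "\<And>m n. m \<ge> N1 \<Longrightarrow> n \<ge> N1 \<Longrightarrow> (\<integral>x. (v m x - v n x)\<^sup>2 \<partial>M) < r/2" using cauchy[of "r/2"] r by auto
    have "norm ((\<integral>x. (f x - v n x)\<^sup>2 \<partial>M) - 0) < r" if "n \<ge> N1" for n
    proof -
      have "(\<integral>\<^sup>+x. ennreal ((f x - v n x)\<^sup>2) \<partial>M) \<le> ennreal (r/2)"
        by (rule fatou[of N1]) (use N1 that in \<open>auto intro: less_imp_le\<close>)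
      moreover have "(\<integral>\<^sup>+x. ennreal ((f x - v n x)\<^sup>2) \<partial>M) = ennreal (\<integral>x. (f x - v n x)\<^sup>2 \<partial>M)"
        using L2_funD(2)[OF L2_diff[OF f2 v]] by (intro nn_integral_eq_integral) auto
      ultimately have "(\<integral>x. (f x - v n x)\<^sup>2 \<partial>M) \<le> r/2"
        using r by (simp add: ennreal_le_iff)
      then show ?thesis using r by (simp add: abs_of_nonneg)
    qed
    then show "\<exists>no. \<forall>n\<ge>no. norm ((\<integral>x. (f x - v n x)\<^sup>2 \<partial>M) - 0) < r" by blast
  qed
  with f2 show ?thesis by blast
qed

text \<open>
  This is the projection theorem. The parallelogram law makes a minimizing sequence in
  \<open>V\<close> Cauchy, its limit \<open>g\<close> leaves a residual \<open>f - g\<close>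
  orthogonal to \<open>V\<close>, and the hypothesis forces this residual to vanish.
\<close>

lemma L2_dense_if_orthogonal_trivial:
  assumes V: "V \<subseteq> L2_fun M" "(\<lambda>x. 0) \<in> V"
    and lin: "\<And>f g a b. f \<in> V \<Longrightarrow> g \<in> V \<Longrightarrow> (\<lambda>x. a * f x + b * g x) \<in> V"
    and triv: "\<And>g. g \<in> L2_fun M \<Longrightarrow> (\<And>k. k \<in> V \<Longrightarrow> (\<integral>x. g x * k x \<partial>M) = 0) \<Longrightarrow> AE x in M. g x = 0"
    and f: "f \<in> L2_fun M"
  shows "\<exists>v. (\<forall>n. v n \<in> V) \<and> (\<lambda>n. \<integral>x. (f x - v n x)\<^sup>2 \<partial>M) \<longlonglongrightarrow> 0"
proof -
  define q where "q v = (\<integral>x. (f x - v x)\<^sup>2 \<partial>M)" for v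
  define d where "d = Inf (q ` V)"
  have VL: "v \<in> L2_fun M" if "v \<in> V" for v using V that by auto
  have q0: "q v \<ge> 0" for v unfolding q_def by simp
  have bdd: "bdd_below (q ` V)" using q0 by (intro bdd_belowI[of _ 0]) auto
  have dle: "d \<le> q v" if "v \<in> V" for v unfolding d_def using bdd that by (intro cInf_lower) auto
  have "\<exists>v\<in>V. q v < d + 1 / real (Suc n)" for n
    using cInf_lessD[of "q ` V" "d + 1 / real (Suc n)"] V(2) by (auto simp: d_def)
  then obtain v where v: "\<And>n. v n \<in> V" "\<And>n. q (v n) < d + 1 / real (Suc n)" by metis
  have vL: "v n \<in> L2_fun M" for n using v VL by auto
  have par: "(\<integral>x. (v m x - v n x)\<^sup>2 \<partial>M) \<le> 2 * q (v m) + 2 * q (v n) - 4 * d" for m n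
  proof -
    have mid: "(\<lambda>x. 1/2 * v m x + 1/2 * v n x) \<in> V" by (intro lin v)
    note a = L2_diff[OF f vL[of m]] and b = L2_diff[OF f vL[of n]]
    have "(\<integral>x. (v m x - v n x)\<^sup>2 \<partial>M) = (\<integral>x. ((f x - v n x) - (f x - v m x))\<^sup>2 \<partial>M)"
      by (simp add: algebra_simps)
    also have "\<dots> = q (v n) - 2 * (\<integral>x. (f x - v n x) * (f x - v m x) \<partial>M) + q (v m)"
      using L2_norm_diff[OF b a] by (simp add: q_def)
    finally have 1: "(\<integral>x. (v m x - v n x)\<^sup>2 \<partial>M) = q (v n) - 2 * (\<integral>x. (f x - v n x) * (f x - v m x) \<partial>M) + q (v m)" .
    have "q (\<lambda>x. 1/2 * v m x + 1/2 * v n x) = (\<integral>x. (1/2 * (f x - v n x) + 1/2 * (f x - v m x))\<^sup>2 \<partial>M)"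
      unfolding q_def by (intro Bochner_Integration.integral_cong arg_cong[where f="\<lambda>x. x\<^sup>2"]) (auto simp: field_simps)
    also have "\<dots> = 1/4 * q (v n) + 1/2 * (\<integral>x. (f x - v n x) * (f x - v m x) \<partial>M) + 1/4 * q (v m)"
      using L2_norm_add[OF b a, of "1/2" "1/2"] by (simp add: q_def power2_eq_square)
    finally show ?thesis using 1 dle[OF mid] by linarith
  qed
  have "\<exists>g\<in>L2_fun M. (\<lambda>n. \<integral>x. (g x - v n x)\<^sup>2 \<partial>M) \<longlonglongrightarrow> 0"
  proof (rule L2_complete[OF vL])
    fix e :: real assume "e > 0"
    then obtain N where N: "1 / real (Suc N) < e / 4" using nat_approx_posE[of "e/4"] by auto
    have "(\<integral>x. (v m x - v n x)\<^sup>2 \<partial>M) < e" if "m \<ge> N" "n \<ge> N" for m n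
    proof -
      have "1 / real (Suc m) \<le> 1 / real (Suc N)" "1 / real (Suc n) \<le> 1 / real (Suc N)"
        using that by (auto intro!: divide_left_mono)
      then show ?thesis using par[of m n] v(2)[of m] v(2)[of n] N by linarith
    qed
    then show "\<exists>N. \<forall>m\<ge>N. \<forall>n\<ge>N. (\<integral>x. (v m x - v n x)\<^sup>2 \<partial>M) < e" by blast
  qed
  then obtain g where g: "g \<in> L2_fun M" and glim: "(\<lambda>n. \<integral>x. (g x - v n x)\<^sup>2 \<partial>M) \<longlonglongrightarrow> 0" by blast
  have orth: "(\<integral>x. (f x - g x) * k x \<partial>M) = 0" if k: "k \<in> V" for k
  proof -
    have kL: "k \<in> L2_fun M" using k VL by auto
    define c where "c n = (\<integral>x. (f x - v n x) * k x \<partial>M)" for n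
    have c: "0 \<le> 1 / real (Suc n) - 2 * s * c n + s\<^sup>2 * (\<integral>x. (k x)\<^sup>2 \<partial>M)" for n s
    proof -
      have "(\<lambda>x. 1 * v n x + s * k x) \<in> V" by (intro lin v k)
      from dle[OF this] have "d \<le> (\<integral>x. (1 * (f x - v n x) + (-s) * k x)\<^sup>2 \<partial>M)"
        by (simp add: q_def algebra_simps)
      also have "\<dots> = q (v n) - 2 * s * c n + s\<^sup>2 * (\<integral>x. (k x)\<^sup>2 \<partial>M)"
        unfolding L2_norm_add[OF L2_diff[OF f vL] kL] by (simp add: q_def c_def)
      finally show ?thesis using v(2)[of n] by linarith
    qed
    have "c \<longlonglongrightarrow> (\<integral>x. (f x - g x) * k x \<partial>M)"
    proof -
      have "(\<lambda>n. \<integral>x. v n x * k x \<partial>M) \<longlonglongrightarrow> (\<integral>x. g x * k x \<partial>M)"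
        by (rule L2_limit_mult[OF g kL vL glim])
      then have "(\<lambda>n. (\<integral>x. f x * k x \<partial>M) - (\<integral>x. v n x * k x \<partial>M)) \<longlonglongrightarrow> (\<integral>x. f x * k x \<partial>M) - (\<integral>x. g x * k x \<partial>M)"
        by (intro tendsto_intros)
      moreover have "c = (\<lambda>n. (\<integral>x. f x * k x \<partial>M) - (\<integral>x. v n x * k x \<partial>M))"
        using L2_mult_integrable[OF f kL] L2_mult_integrable[OF vL kL]
        by (simp add: c_def[abs_def] left_diff_distrib)
      moreover have "(\<integral>x. (f x - g x) * k x \<partial>M) = (\<integral>x. f x * k x \<partial>M) - (\<integral>x. g x * k x \<partial>M)"
        using L2_mult_integrable[OF f kL] L2_mult_integrable[OF g kL] by (simp add: left_diff_distrib)
      ultimately show ?thesis by simp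
    qed
    define C where "C = (\<integral>x. (f x - g x) * k x \<partial>M)"
    define K where "K = (\<integral>x. (k x)\<^sup>2 \<partial>M)"
    have lim: "0 \<le> 0 - 2 * s * C + s\<^sup>2 * K" for s
    proof (rule tendsto_lowerbound[of "\<lambda>n. 1 / real (Suc n) - 2 * s * c n + s\<^sup>2 * K" _ sequentially])
      have "(\<lambda>n. 1 / real (Suc n)) \<longlonglongrightarrow> 0"
        using LIMSEQ_inverse_real_of_nat by (simp add: inverse_eq_divide)
      with \<open>c \<longlonglongrightarrow> _\<close> show "(\<lambda>n. 1 / real (Suc n) - 2 * s * c n + s\<^sup>2 * K) \<longlonglongrightarrow> 0 - 2 * s * C + s\<^sup>2 * K"
        unfolding C_def[symmetric] by (intro tendsto_intros)
      show "\<forall>\<^sub>F n in sequentially. 0 \<le> 1 / real (Suc n) - 2 * s * c n + s\<^sup>2 * K"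
        using c by (auto simp: K_def)
    qed auto
    have K0: "K \<ge> 0" by (simp add: K_def)
    \<comment> \<open>The quadratic in \<open>s\<close> is nonnegative; \<open>s = C / (K + 1)\<close> makes it
      negative unless \<open>C = 0\<close>, and the shift by \<open>1\<close> also covers \<open>K =
      0\<close>.\<close>
    have "0 \<le> - 2 * (C/(K+1)) * C + (C/(K+1))\<^sup>2 * K" using lim[of "C/(K+1)"] by simp
    also have "\<dots> = - (C\<^sup>2 * (K + 2) / (K+1)\<^sup>2)"
      using K0 by (simp add: power2_eq_square divide_simps) (simp add: algebra_simps)
    finally have "C\<^sup>2 * (K + 2) / (K+1)\<^sup>2 \<le> 0" by simp
    then have "C = 0" using K0 by (simp add: divide_le_0_iff mult_le_0_iff zero_le_power2)
    then show ?thesis by (simp add: C_def)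
  qed
  have ae: "AE x in M. f x - g x = 0" by (rule triv[OF L2_diff[OF f g] orth])
  have "(\<integral>x. (f x - v n x)\<^sup>2 \<partial>M) = (\<integral>x. (g x - v n x)\<^sup>2 \<partial>M)" for n
  proof (rule integral_cong_AE)
    show "AE x in M. (f x - v n x)\<^sup>2 = (g x - v n x)\<^sup>2" using ae by eventually_elim simp
  qed (use L2_funD(1)[OF f] L2_funD(1)[OF g] L2_funD(1)[OF vL] in auto)
  with glim v show ?thesis by (intro exI[of _ v]) simp
qed

section \<open>Power integrals and Fubini on the line\<close>

lemma nn_integral_Beta:
  assumes "a > 0" "b > (0::real)"
  shows "(\<integral>\<^sup>+x. ennreal (x powr (a - 1) * (1 - x) powr (b - 1)) * indicator {0..1} x \<partial>lborel) = ennreal (Beta a b)"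
  by (rule nn_integral_has_integral_lebesgue'[OF _ has_integral_Beta_real[OF assms]]) simp

text \<open>
  The exponent may be negative, so the integrand may blow up at \<open>r\<close>. The fundamental
  theorem of calculus still applies because the antiderivative is continuous up to that end.
\<close>

lemma nn_integral_powr_right:
  assumes "a > -1" "r \<le> p" "p \<le> (q::real)"
  shows "(\<integral>\<^sup>+x. ennreal ((x - r) powr a) * indicator {p..q} x \<partial>lborel)
    = ennreal (((q - r) powr (a + 1) - (p - r) powr (a + 1)) / (a + 1))"
proof (rule nn_integral_has_integral_lebesgue')
  have "((\<lambda>x. (x - r) powr a) has_integral
     ((q - r) powr (a + 1) / (a + 1) - (p - r) powr (a + 1) / (a + 1))) {p..q}"
  proof (rule fundamental_theorem_of_calculus_interior)
    show "continuous_on {p..q} (\<lambda>x. (x - r) powr (a + 1) / (a + 1))"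
      using assms by (intro continuous_intros continuous_on_powr') auto
    fix x assume "x \<in> {p<..<q}"
    then have "((\<lambda>x. (x - r) powr (a + 1) / (a + 1)) has_real_derivative (x - r) powr a) (at x)"
      using assms by (auto intro!: derivative_eq_intros)
    then show "((\<lambda>x. (x - r) powr (a + 1) / (a + 1)) has_vector_derivative (x - r) powr a) (at x)"
      by (simp add: has_real_derivative_iff_has_vector_derivative)
  qed (use assms in auto)
  then show "((\<lambda>x. (x - r) powr a) has_integral (((q - r) powr (a + 1) - (p - r) powr (a + 1)) / (a + 1))) {p..q}"
    by (simp add: diff_divide_distrib)
qed simp

lemma nn_integral_powr_left:
  assumes "a > -1" "p \<le> q" "q \<le> (s::real)"
  shows "(\<integral>\<^sup>+x. ennreal ((s - x) powr a) * indicator {p..q} x \<partial>lborel)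
    = ennreal (((s - p) powr (a + 1) - (s - q) powr (a + 1)) / (a + 1))"
proof (rule nn_integral_has_integral_lebesgue')
  have "((\<lambda>x. (s - x) powr a) has_integral
     (- ((s - q) powr (a + 1) / (a + 1)) - (- ((s - p) powr (a + 1) / (a + 1))))) {p..q}"
  proof (rule fundamental_theorem_of_calculus_interior)
    show "continuous_on {p..q} (\<lambda>x. - ((s - x) powr (a + 1) / (a + 1)))"
      using assms by (intro continuous_intros continuous_on_powr') auto
    fix x assume "x \<in> {p<..<q}"
    then have "((\<lambda>x. - ((s - x) powr (a + 1) / (a + 1))) has_real_derivative (s - x) powr a) (at x)"
      using assms by (auto intro!: derivative_eq_intros)
    then show "((\<lambda>x. - ((s - x) powr (a + 1) / (a + 1))) has_vector_derivative (s - x) powr a) (at x)"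
      by (simp add: has_real_derivative_iff_has_vector_derivative)
  qed (use assms in auto)
  then show "((\<lambda>x. (s - x) powr a) has_integral (((s - p) powr (a + 1) - (s - q) powr (a + 1)) / (a + 1))) {p..q}"
    by (simp add: diff_divide_distrib)
qed simp

lemma AE_lborel_neq: "AE x in lborel. x \<noteq> (c::real)"
  using AE_lborel_singleton[of c] by simp

text \<open>
  On \<open>[0, n]\<close> the positive and the negative part of \<open>\<phi>\<close> are
  densities of finite measures that agree on all half-lines \<open>(t, \<infinity>)\<close>. So
  the measures coincide, and the densities agree almost everywhere.
\<close>

lemma zero_if_integrals_zero:
  fixes \<phi> :: "real \<Rightarrow> real"
  assumes int: "\<And>t. 0 \<le> t \<Longrightarrow> integrable lborel (\<lambda>x. indicator {0..t} x * \<phi> x)"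
    and zero: "\<And>t. 0 \<le> t \<Longrightarrow> (\<integral>x. indicator {0..t} x * \<phi> x \<partial>lborel) = 0"
  shows "AE x in lborel. 0 \<le> x \<longrightarrow> \<phi> x = 0"
proof -
  have *: "AE x in lborel. x \<in> {0..real n} \<longrightarrow> \<phi> x = 0" for n :: nat
  proof -
    define \<psi> where "\<psi> x = indicator {0..real n} x * \<phi> x" for x
    have i: "integrable lborel \<psi>" using int[of "real n"] by (simp add: \<psi>_def[abs_def])
    have [measurable]: "\<psi> \<in> borel_measurable borel" using borel_measurable_integrable[OF i] by simp
    have ip: "integrable lborel (\<lambda>x. max 0 (\<psi> x))" "integrable lborel (\<lambda>x. max 0 (- \<psi> x))"
      using i by auto
    have tail: "(\<integral>x. indicator {t<..} x * \<psi> x \<partial>lborel) = 0" for t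
    proof -
      \<comment> \<open>Clipping \<open>t\<close> to \<open>[0, n]\<close> makes the interval from \<open>t\<close> to
        \<open>n\<close> a difference of two intervals starting at \<open>0\<close>.\<close>
      define t' where "t' = min (max t 0) (real n)"
      have "(\<integral>x. indicator {t<..} x * \<psi> x \<partial>lborel) =
        (\<integral>x. (indicator {0..real n} x * \<phi> x) - (indicator {0..t'} x * \<phi> x) \<partial>lborel)
        \<or> (\<integral>x. indicator {t<..} x * \<psi> x \<partial>lborel) = (\<integral>x. indicator {0..real n} x * \<phi> x \<partial>lborel)"
      proof (cases "0 \<le> t")
        case True
        then show ?thesis
          by (intro disjI1 Bochner_Integration.integral_cong) (auto simp: \<psi>_def t'_def indicator_def)
      next
        case False
        then show ?thesis
          by (intro disjI2 Bochner_Integration.integral_cong) (auto simp: \<psi>_def indicator_def)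
      qed
      moreover have "0 \<le> t'" by (simp add: t'_def)
      ultimately show ?thesis using int[of "real n"] int[of t'] zero[of "real n"] zero[of t'] by auto
    qed
    have fin: "(\<integral>\<^sup>+x. ennreal (max 0 (\<psi> x)) \<partial>lborel) < \<infinity>" "(\<integral>\<^sup>+x. ennreal (max 0 (-\<psi> x)) \<partial>lborel) < \<infinity>"
      using ip nn_integral_eq_integral[of lborel "\<lambda>x. max 0 (\<psi> x)"] nn_integral_eq_integral[of lborel "\<lambda>x. max 0 (-\<psi> x)"]
      by auto
    have "density lborel (\<lambda>x. ennreal (max 0 (\<psi> x))) = density lborel (\<lambda>x. ennreal (max 0 (- \<psi> x)))"
    proof (rule measure_eqI_lessThan)
      fix t :: real
      have e: "emeasure (density lborel (\<lambda>x. ennreal (max 0 (f x)))) {t<..}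
          = ennreal (\<integral>x. indicator {t<..} x * max 0 (f x) \<partial>lborel)"
        if [measurable]: "f \<in> borel_measurable borel" and f: "integrable lborel f" for f
      proof -
        have "integrable lborel (\<lambda>x. indicator {t<..} x *\<^sub>R max 0 (f x))"
          by (intro integrable_mult_indicator) (use f in auto)
        then have "(\<integral>\<^sup>+x. ennreal (indicator {t<..} x *\<^sub>R max 0 (f x)) \<partial>lborel) = ennreal (\<integral>x. indicator {t<..} x *\<^sub>R max 0 (f x) \<partial>lborel)"
          by (rule nn_integral_eq_integral) auto
        moreover have "(\<integral>\<^sup>+x. ennreal (indicator {t<..} x *\<^sub>R max 0 (f x)) \<partial>lborel)
           = (\<integral>\<^sup>+x. ennreal (max 0 (f x)) * indicator {t<..} x \<partial>lborel)"
          by (intro nn_integral_cong) (auto simp: indicator_def)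
        ultimately show ?thesis by (simp add: emeasure_density)
      qed
      have i1: "integrable lborel (\<lambda>x. indicator {t<..} x * max 0 (\<psi> x))"
        "integrable lborel (\<lambda>x. indicator {t<..} x * max 0 (- \<psi> x))"
        using integrable_mult_indicator[of "{t<..}" lborel, OF _ ip(1)] integrable_mult_indicator[of "{t<..}" lborel, OF _ ip(2)]
        by auto
      have "(\<integral>x. indicator {t<..} x * max 0 (\<psi> x) \<partial>lborel) - (\<integral>x. indicator {t<..} x * max 0 (- \<psi> x) \<partial>lborel)
         = (\<integral>x. indicator {t<..} x * \<psi> x \<partial>lborel)"
        by (subst Bochner_Integration.integral_diff[OF i1, symmetric])
           (intro Bochner_Integration.integral_cong, auto simp: indicator_def)
      then have eq: "(\<integral>x. indicator {t<..} x * max 0 (\<psi> x) \<partial>lborel) = (\<integral>x. indicator {t<..} x * max 0 (- \<psi> x) \<partial>lborel)"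
        using tail[of t] by simp
      have i': "integrable lborel (\<lambda>x. - \<psi> x)" using i by simp
      show "emeasure (density lborel (\<lambda>x. ennreal (max 0 (\<psi> x)))) {t<..} = emeasure (density lborel (\<lambda>x. ennreal (max 0 (- \<psi> x)))) {t<..}"
        using e[OF _ i] e[OF _ i'] eq by simp
      show "emeasure (density lborel (\<lambda>x. ennreal (max 0 (\<psi> x)))) {t<..} < \<infinity>"
        using e[OF _ i] by simp
    qed auto
    then have "AE x in lborel. ennreal (max 0 (\<psi> x)) = ennreal (max 0 (- \<psi> x))"
      by (subst (asm) finite_density_unique) (use fin in auto)
    then show ?thesis
    proof eventually_elim
      case (elim x)
      then have "max 0 (\<psi> x) = max 0 (- \<psi> x)" by (rule ennreal_inj[THEN iffD1, rotated 2]) auto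
      then have "\<psi> x = 0" by (auto simp: max_def split: if_splits)
      then show ?case by (auto simp: \<psi>_def)
    qed
  qed
  have "AE x in lborel. \<forall>n::nat. x \<in> {0..real n} \<longrightarrow> \<phi> x = 0"
    unfolding AE_all_countable using * by blast
  then show ?thesis
  proof eventually_elim
    case (elim x)
    obtain n :: nat where "x \<le> real n" using real_arch_simple by blast
    with elim show ?case by auto
  qed
qed

text \<open>
  For a nonnegative kernel \<open>k\<close>, the integrability of \<open>N f\<close>, where
  \<open>N\<close> is the mass of \<open>k\<close> in its first variable, is all that Fubini's
  theorem requires. Both steps of the Abel inversion below have this shape.
\<close>

lemma Fubini_kernel:
  fixes k :: "real \<Rightarrow> real \<Rightarrow> real" and f N :: "real \<Rightarrow> real"
  assumes [measurable]: "case_prod k \<in> borel_measurable (borel \<Otimes>\<^sub>M borel)" "f \<in> borel_measurable borel" "N \<in> borel_measurable borel"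
    and nonneg: "\<And>u r. 0 \<le> k u r" "\<And>r. 0 \<le> N r"
    and N: "\<And>r. (\<integral>\<^sup>+u. ennreal (k u r) \<partial>lborel) = ennreal (N r)"
    and int: "integrable lborel (\<lambda>r. N r * f r)"
  shows "integrable lborel (\<lambda>u. \<integral>r. k u r * f r \<partial>lborel)"
    and "(\<integral>u. (\<integral>r. k u r * f r \<partial>lborel) \<partial>lborel) = (\<integral>r. N r * f r \<partial>lborel)"
proof -
  have m: "(\<lambda>(r,u). k u r * f r) \<in> borel_measurable (lborel \<Otimes>\<^sub>M lborel)" by measurable
  have pair: "integrable (lborel \<Otimes>\<^sub>M lborel) (\<lambda>(r,u). k u r * f r)"
  proof (rule integrableI_bounded[OF m])
    have "(\<integral>\<^sup>+x. ennreal (norm (case x of (r,u) \<Rightarrow> k u r * f r)) \<partial>(lborel \<Otimes>\<^sub>M lborel))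
      = (\<integral>\<^sup>+r. \<integral>\<^sup>+u. ennreal (norm (k u r * f r)) \<partial>lborel \<partial>lborel)"
      by (subst lborel.nn_integral_fst[symmetric]) (use m in auto)
    also have "\<dots> = (\<integral>\<^sup>+r. ennreal (norm (N r * f r)) \<partial>lborel)"
    proof (rule nn_integral_cong)
      fix r :: real
      have "(\<integral>\<^sup>+u. ennreal (norm (k u r * f r)) \<partial>lborel) = (\<integral>\<^sup>+u. ennreal (k u r) * ennreal \<bar>f r\<bar> \<partial>lborel)"
        by (intro nn_integral_cong) (simp add: abs_mult nonneg ennreal_mult)
      also have "\<dots> = ennreal (N r) * ennreal \<bar>f r\<bar>" by (simp add: nn_integral_multc N)
      finally show "(\<integral>\<^sup>+u. ennreal (norm (k u r * f r)) \<partial>lborel) = ennreal (norm (N r * f r))"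
        by (simp add: abs_mult nonneg ennreal_mult)
    qed
    also have "\<dots> < \<infinity>" using int by (simp add: integrable_iff_bounded)
    finally show "(\<integral>\<^sup>+x. ennreal (norm (case x of (r,u) \<Rightarrow> k u r * f r)) \<partial>(lborel \<Otimes>\<^sub>M lborel)) < \<infinity>" .
  qed
  have "integrable lborel (\<lambda>u. \<integral>r. (case (r,u) of (r,u) \<Rightarrow> k u r * f r) \<partial>lborel)"
    by (rule lborel_pair.integrable_snd) (use pair in \<open>simp add: case_prod_beta'\<close>)
  then show "integrable lborel (\<lambda>u. \<integral>r. k u r * f r \<partial>lborel)" by simp
  have "(\<integral>u. (\<integral>r. k u r * f r \<partial>lborel) \<partial>lborel) = (\<integral>r. (\<integral>u. k u r * f r \<partial>lborel) \<partial>lborel)"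
    by (rule lborel_pair.Fubini_integral) (use pair in simp)
  also have "\<dots> = (\<integral>r. N r * f r \<partial>lborel)"
  proof (rule Bochner_Integration.integral_cong)
    fix r :: real
    have "(\<integral>u. k u r \<partial>lborel) = N r" using N[of r] nonneg
      by (subst integral_eq_nn_integral) auto
    then show "(\<integral>u. k u r * f r \<partial>lborel) = N r * f r" by simp
  qed simp
  finally show "(\<integral>u. (\<integral>r. k u r * f r \<partial>lborel) \<partial>lborel) = (\<integral>r. N r * f r \<partial>lborel)" .
qed

section \<open>The kernel and the covariance of fractional Brownian motion\<close>

locale hurst =
  fixes H :: real
  assumes H: "1/2 < H" "H < 1"
begin

text \<open>
  The integrand of the kernel: \<open>kernel H t r\<close> is the integral of
  \<open>density_kernel u r\<close> over \<open>u\<close> from \<open>0\<close> to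
  \<open>t\<close>. With the range of \<open>u\<close> encoded in the value \<open>0\<close> for
  \<open>u \<le> r\<close>, the order of integration can be exchanged freely.
\<close>

definition density_kernel :: "real \<Rightarrow> real \<Rightarrow> real" where
  "density_kernel u r = (if 0 < r \<and> r < u then
     kernel_const H * r powr (1/2 - H) * u powr (H - 1/2) * (u - r) powr (H - 3/2) else 0)"

lemma kernel_const_sq: "(kernel_const H)\<^sup>2 * Beta (2 - 2 * H) (H - 1/2) = H * (2 * H - 1)"
  and kernel_const_pos: "kernel_const H > 0"
proof -
  have G: "Gamma (3/2 - H) > 0" "Gamma (2 - 2*H) > 0" "Gamma (H - 1/2) > 0"
    using H by (auto intro!: Gamma_real_pos)
  have "(kernel_const H)\<^sup>2 = H * (2 * H - 1) * Gamma (3 / 2 - H) / (Gamma (2 - 2 * H) * Gamma (H - 1 / 2))"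
    unfolding kernel_const_def using G H by (intro real_sqrt_pow2) (auto intro!: divide_nonneg_pos mult_nonneg_nonneg mult_pos_pos)
  moreover have "2 - 2*H + (H - 1/2) = 3/2 - H" by (simp add: field_simps)
  ultimately show "(kernel_const H)\<^sup>2 * Beta (2 - 2 * H) (H - 1/2) = H * (2 * H - 1)"
    unfolding Beta_def using G by (simp add: field_simps)
  show "kernel_const H > 0"
    unfolding kernel_const_def using G H by (auto intro!: divide_pos_pos mult_pos_pos)
qed

lemma density_kernel_nonneg: "0 \<le> density_kernel u r"
  using kernel_const_pos by (simp add: density_kernel_def)

lemma density_kernel_measurable [measurable]:
  "case_prod density_kernel \<in> borel_measurable (borel \<Otimes>\<^sub>M borel)"
  unfolding density_kernel_def[abs_def] by measurable

text \<open>
  The map \<open>r \<mapsto> y\<close> takes \<open>[0, u]\<close> to \<open>[0, 1]\<close> and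
  has derivative \<open>(v - u) v / (u (v - r)\<^sup>2)\<close>. It turns the overlap of two
  kernel densities into a Beta integral with parameters \<open>2 - 2 H\<close> and \<open>H -
  1/2\<close>. The identity is linear once logarithms are taken.
\<close>

lemma overlap_substitution:
  assumes "0 < r" "r < u" "u < v"
  defines "y \<equiv> r * (v - u) / (u * (v - r))"
  shows "y powr (1 - 2*H) * (1 - y) powr (H - 3/2) * ((v - u) * v / (u * (v - r)\<^sup>2))
    = (v - u) powr (2 - 2*H) * (u powr (H - 1/2) * v powr (H - 1/2) * r powr (1 - 2*H)
        * (u - r) powr (H - 3/2) * (v - r) powr (H - 3/2))"
proof -
  define A B C D E where d: "A = ln r" "B = ln u" "C = ln v" "D = ln (v - u)" "E = ln (v - r)"
  define F where "F = ln (u - r)"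
  have pos: "0 < r" "0 < u" "0 < v" "0 < v - u" "0 < v - r" "0 < u - r" using assms by auto
  have 1: "1 - y = v * (u - r) / (u * (v - r))"
    using pos unfolding y_def by (simp add: field_simps)
  have y: "y > 0" "1 - y > 0" unfolding 1 using pos by (auto simp: y_def)
  have ly: "ln y = A + D - (B + E)" unfolding y_def d using pos by (simp add: ln_mult ln_div)
  have l1y: "ln (1 - y) = C + F - (B + E)" unfolding 1 d F_def using pos by (simp add: ln_mult ln_div)
  have "(v - u) * v / (u * (v - r)\<^sup>2) = exp (D + C - (B + 2 * E))"
  proof -
    have "ln ((v - u) * v / (u * (v - r)\<^sup>2)) = D + C - (B + 2 * E)"
      unfolding d using pos by (simp add: ln_mult ln_div ln_realpow)
    then show ?thesis using pos by (metis exp_ln divide_pos_pos mult_pos_pos zero_less_power)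
  qed
  then have "y powr (1 - 2*H) * (1 - y) powr (H - 3/2) * ((v - u) * v / (u * (v - r)\<^sup>2))
    = exp ((1 - 2*H) * (A + D - (B + E)) + (H - 3/2) * (C + F - (B + E)) + (D + C - (B + 2 * E)))"
    using y by (simp add: powr_def ly l1y exp_add)
  also have "(1 - 2*H) * (A + D - (B + E)) + (H - 3/2) * (C + F - (B + E)) + (D + C - (B + 2 * E))
    = (2 - 2*H) * D + ((H - 1/2) * B + (H - 1/2) * C + (1 - 2*H) * A + (H - 3/2) * F + (H - 3/2) * E)"
    by (simp add: field_simps)
  also have "exp \<dots> = (v - u) powr (2 - 2*H) * (u powr (H - 1/2) * v powr (H - 1/2) * r powr (1 - 2*H)
        * (u - r) powr (H - 3/2) * (v - r) powr (H - 3/2))"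
    using pos by (simp add: powr_def d F_def exp_add mult.assoc)
  finally show ?thesis .
qed

text \<open>
  The value is the mixed second derivative of \<open>R\<^sub>H\<close>; the constant
  \<open>kernel_const H\<close> is chosen so that the Beta value cancels.
\<close>

lemma density_kernel_overlap:
  assumes "0 < u" "u < v"
  shows "(\<integral>\<^sup>+r. ennreal (density_kernel u r * density_kernel v r) \<partial>lborel)
    = ennreal (H * (2 * H - 1) * (v - u) powr (2 * H - 2))"
proof -
  define g g' where "g r = r * (v - u) / (u * (v - r))" and "g' r = (v - u) * v / (u * (v - r)\<^sup>2)" for r
  define f where "f y = y powr (1 - 2*H) * (1 - y) powr (H - 3/2)" for y :: real
  define c where "c = (kernel_const H)\<^sup>2 * (v - u) powr (2 * H - 2)"
  have c0: "c \<ge> 0" by (simp add: c_def)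
  have g0: "g 0 = 0" "g u = 1" using assms by (auto simp: g_def)
  have fm[measurable]: "f \<in> borel_measurable borel" unfolding f_def[abs_def] by measurable
  have sub: "(\<integral>\<^sup>+x. ennreal (f x * indicator {g 0..g u} x) \<partial>lborel) = (\<integral>\<^sup>+x. ennreal (f (g x) * g' x * indicator {0..u} x) \<partial>lborel)"
  proof (rule nn_integral_substitution)
    fix x assume x: "x \<in> {0..u}"
    have "(g has_real_derivative ((v - u) * (u * (v - x)) - x * (v - u) * (u * (0 - 1))) / ((u * (v - x)) * (u * (v - x)))) (at x)"
      unfolding g_def[abs_def] using x assms by (auto intro!: derivative_eq_intros)
    also have "((v - u) * (u * (v - x)) - x * (v - u) * (u * (0 - 1))) = u * ((v - u) * v)"
      by (simp add: algebra_simps)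
    also have "u * ((v - u) * v) / ((u * (v - x)) * (u * (v - x))) = g' x"
      using assms by (simp add: g'_def power2_eq_square mult.assoc mult.left_commute)
    finally show "(g has_real_derivative g' x) (at x)" .
    show "0 \<le> g' x" using x assms by (auto simp: g'_def)
  next
    show "continuous_on {0..u} g'" unfolding g'_def[abs_def] using assms
      by (intro continuous_intros) auto
  qed (use assms in \<open>auto simp: set_borel_measurable_def\<close>)
  have "(\<integral>\<^sup>+r. ennreal (density_kernel u r * density_kernel v r) \<partial>lborel)
     = (\<integral>\<^sup>+r. ennreal c * ennreal (f (g r) * g' r * indicator {0..u} r) \<partial>lborel)"
  proof (rule nn_integral_cong_AE)
    have "AE r in lborel. r \<noteq> 0 \<and> r \<noteq> u" using AE_lborel_neq[of 0] AE_lborel_neq[of u] by eventually_elim simp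
    then show "AE r in lborel. ennreal (density_kernel u r * density_kernel v r) = ennreal c * ennreal (f (g r) * g' r * indicator {0..u} r)"
    proof eventually_elim
      case (elim r)
      show ?case
      proof (cases "0 < r \<and> r < u")
        case True
        then have r: "0 < r" "r < u" by auto
        have p1: "(v - u) powr (2 * H - 2) * (v - u) powr (2 - 2 * H) = 1"
          using assms by (simp add: powr_add[symmetric])
        have p2: "r powr (1/2 - H) * r powr (1/2 - H) = r powr (1 - 2*H)"
          using r by (simp add: powr_add[symmetric])
        have "c * (f (g r) * g' r) = (kernel_const H)\<^sup>2 * ((v - u) powr (2 * H - 2) * (v - u) powr (2 - 2*H)) * (u powr (H - 1/2) * v powr (H - 1/2) * r powr (1 - 2*H)
        * (u - r) powr (H - 3/2) * (v - r) powr (H - 3/2))"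
          using overlap_substitution[OF r assms(2)] unfolding f_def g_def g'_def c_def by simp
        also have "\<dots> = density_kernel u r * density_kernel v r"
          unfolding p1 p2[symmetric] density_kernel_def using r assms(2)
          by (simp add: power2_eq_square)
        finally have *: "density_kernel u r * density_kernel v r = c * (f (g r) * g' r)" by simp
        show ?thesis unfolding * using r c0 by (subst ennreal_mult'[symmetric]) auto
      next
        case False
        then have "density_kernel u r = 0" "r \<notin> {0..u}" using elim by (auto simp: density_kernel_def)
        then show ?thesis by simp
      qed
    qed
  qed
  also have "\<dots> = ennreal c * (\<integral>\<^sup>+r. ennreal (f (g r) * g' r * indicator {0..u} r) \<partial>lborel)"
  proof (rule nn_integral_cmult)
    show "(\<lambda>r. ennreal (f (g r) * g' r * indicator {0..u} r)) \<in> borel_measurable lborel"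
      unfolding g_def g'_def by measurable
  qed
  also have "\<dots> = ennreal c * ennreal (Beta (2 - 2*H) (H - 1/2))"
  proof -
    have "(\<integral>\<^sup>+x. ennreal (f x * indicator {g 0..g u} x) \<partial>lborel)
      = (\<integral>\<^sup>+x. ennreal (x powr ((2 - 2*H) - 1) * (1 - x) powr ((H - 1/2) - 1)) * indicator {0..1} x \<partial>lborel)"
      unfolding g0 f_def by (intro nn_integral_cong) (auto simp: indicator_def)
    also have "\<dots> = ennreal (Beta (2 - 2*H) (H - 1/2))" by (rule nn_integral_Beta) (use H in auto)
    finally show ?thesis using sub by simp
  qed
  also have "\<dots> = ennreal (c * Beta (2 - 2*H) (H - 1/2))" using c0 by (simp add: ennreal_mult')
  also have "c * Beta (2 - 2*H) (H - 1/2) = H * (2 * H - 1) * (v - u) powr (2 * H - 2)"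
    unfolding c_def kernel_const_sq[symmetric] by simp
  finally show ?thesis .
qed

lemma density_kernel_overlap':
  assumes "0 < u" "0 < v" "u \<noteq> v"
  shows "(\<integral>\<^sup>+r. ennreal (density_kernel u r * density_kernel v r) \<partial>lborel)
    = ennreal (H * (2 * H - 1) * \<bar>u - v\<bar> powr (2 * H - 2))"
proof (cases "u < v")
  case True
  then show ?thesis using density_kernel_overlap[of u v] assms by (simp add: abs_if)
next
  case False
  then show ?thesis using density_kernel_overlap[of v u] assms by (simp add: abs_if mult.commute)
qed

lemma kernel_eq_0: "\<not> (0 < r \<and> r < t) \<Longrightarrow> kernel H t r = 0"
proof (cases "r = t")
  case True
  have "(LINT u:{r..r}|lborel. u powr (H - 1/2) * (u - r) powr (H - 3/2)) = 0"
    unfolding set_lebesgue_integral_def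
    by (rule integral_eq_zero_AE) (auto simp: indicator_def)
  then show ?thesis using True by (simp add: kernel_def)
qed (auto simp: kernel_def)

text \<open>
  The Bochner integral in the definition of the kernel is \<open>0\<close> when its integrand is
  not integrable, so the point here is finiteness. It holds because \<open>u\<^bsup>H -
  1/2\<^esup>\<close> is bounded on \<open>[r, t]\<close> and \<open>H - 3/2 > -1\<close>.
\<close>

lemma nn_integral_density_kernel:
  "(\<integral>\<^sup>+u. ennreal (density_kernel u r) * indicator {0..t} u \<partial>lborel) = ennreal (kernel H t r)"
proof (cases "0 < r \<and> r < t")
  case False
  have "(\<lambda>u. ennreal (density_kernel u r) * indicator {0..t} u) = (\<lambda>u. 0)"
    using False by (auto simp: density_kernel_def indicator_def)
  then show ?thesis using kernel_eq_0[OF False] by simp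
next
  case True
  then have r: "0 < r" "r < t" by auto
  define q where "q u = indicator {r..t} u * (u powr (H - 1/2) * (u - r) powr (H - 3/2))" for u
  have q0: "q u \<ge> 0" for u by (simp add: q_def)
  have qm[measurable]: "q \<in> borel_measurable borel" unfolding q_def[abs_def] by measurable
  have "(\<integral>\<^sup>+u. ennreal (q u) \<partial>lborel) \<le> (\<integral>\<^sup>+u. ennreal (t powr (H - 1/2)) * (ennreal ((u - r) powr (H - 3/2)) * indicator {r..t} u) \<partial>lborel)"
  proof (rule nn_integral_mono)
    fix u
    show "ennreal (q u) \<le> ennreal (t powr (H - 1/2)) * (ennreal ((u - r) powr (H - 3/2)) * indicator {r..t} u)"
      using r H by (auto simp: q_def indicator_def ennreal_mult[symmetric] intro!: ennreal_leI mult_right_mono powr_mono2)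
  qed
  also have "\<dots> = ennreal (t powr (H - 1/2)) * (\<integral>\<^sup>+u. ennreal ((u - r) powr (H - 3/2)) * indicator {r..t} u \<partial>lborel)"
    by (rule nn_integral_cmult) measurable
  also have "\<dots> < \<infinity>"
    using r H by (subst nn_integral_powr_right) (auto simp: ennreal_mult_less_top)
  finally have fin: "(\<integral>\<^sup>+u. ennreal (q u) \<partial>lborel) < \<infinity>" .
  then have i: "integrable lborel q" using q0 by (intro integrableI_bounded) auto
  have "(\<integral>\<^sup>+u. ennreal (density_kernel u r) * indicator {0..t} u \<partial>lborel)
    = (\<integral>\<^sup>+u. ennreal (kernel_const H * r powr (1/2 - H)) * ennreal (q u) \<partial>lborel)"
    using r kernel_const_pos
    by (intro nn_integral_cong) (auto simp: q_def density_kernel_def indicator_def ennreal_mult[symmetric] mult.assoc)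
  also have "\<dots> = ennreal (kernel_const H * r powr (1/2 - H)) * ennreal (\<integral>u. q u \<partial>lborel)"
    using i q0 by (subst nn_integral_cmult) (auto simp: nn_integral_eq_integral)
  also have "\<dots> = ennreal (kernel H t r)"
    using r kernel_const_pos by (simp add: kernel_def q_def set_lebesgue_integral_def ennreal_mult[symmetric])
  finally show ?thesis .
qed

lemma kernel_nonneg: "0 \<le> kernel H t r"
proof (cases "0 < r \<and> r < t")
  case True
  then show ?thesis using kernel_const_pos
    unfolding kernel_def set_lebesgue_integral_def by (intro mult_nonneg_nonneg integral_nonneg_AE) auto
qed (simp add: kernel_eq_0)

lemma kernel_measurable [measurable]: "kernel H t \<in> borel_measurable borel"
proof -
  have "(\<lambda>r. \<integral>\<^sup>+u. ennreal (density_kernel u r) * indicator {0..t} u \<partial>lborel) \<in> borel_measurable borel"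
    by measurable
  then have "(\<lambda>r. enn2real (ennreal (kernel H t r))) \<in> borel_measurable borel"
    unfolding nn_integral_density_kernel by measurable
  then show ?thesis by (simp add: kernel_nonneg)
qed

lemma nn_integral_abs_powr:
  assumes "0 \<le> u" "u \<le> s"
  shows "(\<integral>\<^sup>+v. ennreal (H * (2 * H - 1) * \<bar>u - v\<bar> powr (2 * H - 2)) * indicator {0..s} v \<partial>lborel)
    = ennreal (H * (u powr (2 * H - 1) + (s - u) powr (2 * H - 1)))"
proof -
  define c where "c = H * (2 * H - 1)"
  have c: "c \<ge> 0" using H by (simp add: c_def)
  have "(\<integral>\<^sup>+v. ennreal (H * (2 * H - 1) * \<bar>u - v\<bar> powr (2 * H - 2)) * indicator {0..s} v \<partial>lborel)
    = (\<integral>\<^sup>+v. ennreal c * (ennreal ((u - v) powr (2 * H - 2)) * indicator {0..u} v)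
        + ennreal c * (ennreal ((v - u) powr (2 * H - 2)) * indicator {u..s} v) \<partial>lborel)"
    using assms H c by (intro nn_integral_cong) (auto simp: indicator_def c_def[symmetric] ennreal_mult[symmetric] abs_if)
  also have "\<dots> = ennreal c * ennreal ((u powr (2 * H - 1)) / (2 * H - 1)) + ennreal c * ennreal (((s - u) powr (2 * H - 1)) / (2 * H - 1))"
    using assms H by (simp add: nn_integral_add nn_integral_cmult nn_integral_powr_left nn_integral_powr_right)
  also have "\<dots> = ennreal (c * (u powr (2 * H - 1) / (2 * H - 1)) + c * ((s - u) powr (2 * H - 1) / (2 * H - 1)))"
    using c H by (simp add: ennreal_mult'[symmetric] ennreal_plus[symmetric] del: ennreal_plus)
  also have "c * (u powr (2 * H - 1) / (2 * H - 1)) + c * ((s - u) powr (2 * H - 1) / (2 * H - 1))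
     = H * (u powr (2 * H - 1) + (s - u) powr (2 * H - 1))"
  proof -
    have "c * (x / (2 * H - 1)) = H * x" for x using H by (simp add: c_def)
    then show ?thesis by (simp only: distrib_left)
  qed
  finally show ?thesis .
qed

text \<open>
  Tonelli's theorem moves the integration over \<open>r\<close> inside, where the overlap formula
  applies; the two remaining integrations of \<open>H (2 H - 1) \<bar>u - v\<bar>\<^bsup>2 H -
  2\<^esup>\<close> give \<open>R\<^sub>H\<close>.
\<close>

lemma nn_integral_kernel_mult_le:
  assumes "0 \<le> t" "t \<le> s"
  shows "(\<integral>\<^sup>+r. ennreal (kernel H t r * kernel H s r) \<partial>lborel) = ennreal (fbm_cov H t s)"
proof -
  let ?k = "\<lambda>u r. ennreal (density_kernel u r)"
  have "(\<integral>\<^sup>+r. ennreal (kernel H t r * kernel H s r) \<partial>lborel)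
     = (\<integral>\<^sup>+r. (\<integral>\<^sup>+u. \<integral>\<^sup>+v. (?k u r * indicator {0..t} u) * (?k v r * indicator {0..s} v) \<partial>lborel \<partial>lborel) \<partial>lborel)"
    by (subst nn_integral_cmult, measurable)
       (simp add: nn_integral_multc nn_integral_density_kernel ennreal_mult kernel_nonneg)
  also have "\<dots> = (\<integral>\<^sup>+u. (\<integral>\<^sup>+r. \<integral>\<^sup>+v. (?k u r * indicator {0..t} u) * (?k v r * indicator {0..s} v) \<partial>lborel \<partial>lborel) \<partial>lborel)"
    by (rule lborel_pair.Fubini') measurable
  also have "\<dots> = (\<integral>\<^sup>+u. (\<integral>\<^sup>+v. \<integral>\<^sup>+r. (?k u r * indicator {0..t} u) * (?k v r * indicator {0..s} v) \<partial>lborel \<partial>lborel) \<partial>lborel)"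
    by (intro nn_integral_cong lborel_pair.Fubini') measurable
  also have "\<dots> = (\<integral>\<^sup>+u. ennreal (H * (u powr (2 * H - 1) + (s - u) powr (2 * H - 1))) * indicator {0..t} u \<partial>lborel)"
  proof (rule nn_integral_cong_AE)
    show "AE u in lborel. (\<integral>\<^sup>+v. \<integral>\<^sup>+r. (?k u r * indicator {0..t} u) * (?k v r * indicator {0..s} v) \<partial>lborel \<partial>lborel)
      = ennreal (H * (u powr (2 * H - 1) + (s - u) powr (2 * H - 1))) * indicator {0..t} u"
      using AE_lborel_neq[of 0]
    proof eventually_elim
      case (elim u)
      show ?case
      proof (cases "u \<in> {0..t}")
        case True
        have "(\<integral>\<^sup>+v. \<integral>\<^sup>+r. (?k u r * indicator {0..t} u) * (?k v r * indicator {0..s} v) \<partial>lborel \<partial>lborel)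
          = (\<integral>\<^sup>+v. ennreal (H * (2 * H - 1) * \<bar>u - v\<bar> powr (2 * H - 2)) * indicator {0..s} v \<partial>lborel)"
        proof (rule nn_integral_cong_AE)
          show "AE v in lborel. (\<integral>\<^sup>+r. (?k u r * indicator {0..t} u) * (?k v r * indicator {0..s} v) \<partial>lborel)
             = ennreal (H * (2 * H - 1) * \<bar>u - v\<bar> powr (2 * H - 2)) * indicator {0..s} v"
            using AE_lborel_neq[of 0] AE_lborel_neq[of u]
          proof eventually_elim
            case (elim v)
            then show ?case
              using True \<open>u \<noteq> 0\<close> density_kernel_overlap'[of u v]
              by (cases "v \<in> {0..s}") (auto simp: ennreal_mult density_kernel_nonneg)
          qed
        qed
        also have "\<dots> = ennreal (H * (u powr (2 * H - 1) + (s - u) powr (2 * H - 1)))"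
          using True assms by (intro nn_integral_abs_powr) auto
        finally show ?thesis using True by simp
      qed simp
    qed
  qed
  also have "\<dots> = (\<integral>\<^sup>+u. ennreal H * (ennreal ((u - 0) powr (2 * H - 1)) * indicator {0..t} u)
     + ennreal H * (ennreal ((s - u) powr (2 * H - 1)) * indicator {0..t} u) \<partial>lborel)"
    using H by (intro nn_integral_cong) (auto simp: indicator_def ennreal_mult[symmetric] distrib_left)
  also have "\<dots> = ennreal H * ennreal (t powr (2 * H) / (2 * H)) + ennreal H * ennreal ((s powr (2 * H) - (s - t) powr (2 * H)) / (2 * H))"
    using nn_integral_powr_left[of "2 * H - 1" 0 t s] nn_integral_powr_right[of "2 * H - 1" 0 0 t] assms H
    by (simp add: nn_integral_add nn_integral_cmult)
  also have "\<dots> = ennreal (H * (t powr (2 * H) / (2 * H)) + H * ((s powr (2 * H) - (s - t) powr (2 * H)) / (2 * H)))"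
  proof -
    have "(s - t) powr (2 * H) \<le> s powr (2 * H)" using H assms by (intro powr_mono2) auto
    then show ?thesis
      using H by (simp add: ennreal_mult'[symmetric] ennreal_plus[symmetric] del: ennreal_plus)
  qed
  also have "H * (t powr (2 * H) / (2 * H)) + H * ((s powr (2 * H) - (s - t) powr (2 * H)) / (2 * H)) = fbm_cov H t s"
    using H assms by (simp add: fbm_cov_def field_simps abs_if)
  finally show ?thesis .
qed

lemma fbm_cov_commute: "fbm_cov H s t = fbm_cov H t s"
  by (simp add: fbm_cov_def abs_minus_commute)

lemma nn_integral_kernel_mult:
  assumes "0 \<le> t" "0 \<le> s"
  shows "(\<integral>\<^sup>+r. ennreal (kernel H t r * kernel H s r) \<partial>lborel) = ennreal (fbm_cov H t s)"
  using nn_integral_kernel_mult_le[of t s] nn_integral_kernel_mult_le[of s t] assms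
  by (cases "t \<le> s") (auto simp: mult.commute fbm_cov_commute)

end

section \<open>The integral operator: continuity and injectivity\<close>

lemma integral_half_line: "(\<integral>x. f x \<partial>half_line) = (\<integral>x. indicator {0..} x * f x \<partial>lborel)" for f :: "real \<Rightarrow> real"
  by (simp add: integral_restrict_space)

lemma integrable_half_line: "integrable half_line f \<longleftrightarrow> integrable lborel (\<lambda>x. indicator {0..} x * f x)" for f :: "real \<Rightarrow> real"
  by (simp add: integrable_restrict_space)

lemma borel_measurable_half_line: "f \<in> borel_measurable half_line \<longleftrightarrow> (\<lambda>x. indicator {0..} x * f x) \<in> borel_measurable borel" for f :: "real \<Rightarrow> real"
  by (subst borel_measurable_restrict_space_iff) auto

lemma AE_half_line: "(AE x in half_line. P x) \<longleftrightarrow> (AE x in lborel. 0 \<le> x \<longrightarrow> P x)"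
  by (subst AE_restrict_space_iff) auto

lemma L2_half_lineI:
  assumes "f \<in> borel_measurable borel" "integrable lborel (\<lambda>x. (f x)\<^sup>2)"
  shows "f \<in> L2_fun half_line"
proof -
  have "integrable lborel (\<lambda>x. indicator {0..} x *\<^sub>R (f x)\<^sup>2)"
    by (intro integrable_mult_indicator assms) auto
  then show ?thesis using assms(1)
    by (auto simp: L2_fun_def integrable_half_line intro: measurable_restrict_space1)
qed

context hurst
begin

lemma integrable_kernel_mult:
  assumes "0 \<le> t" "0 \<le> s"
  shows "integrable lborel (\<lambda>r. kernel H t r * kernel H s r)"
    "(\<integral>r. kernel H t r * kernel H s r \<partial>lborel) = fbm_cov H t s"
proof -
  have nn: "AE r in lborel. 0 \<le> kernel H t r * kernel H s r" by (simp add: kernel_nonneg)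
  show "integrable lborel (\<lambda>r. kernel H t r * kernel H s r)"
    using nn_integral_kernel_mult[OF assms] by (intro integrableI_nonneg nn) auto
  have "fbm_cov H t s \<ge> 0"
  proof -
    have *: "0 \<le> fbm_cov H a b" if "0 \<le> a" "a \<le> b" for a b
    proof -
      have "(b - a) powr (2 * H) \<le> b powr (2 * H)" using that H by (intro powr_mono2) auto
      moreover have "0 \<le> a powr (2 * H)" by simp
      ultimately have "(b - a) powr (2 * H) \<le> a powr (2 * H) + b powr (2 * H)" by linarith
      then show ?thesis using that by (simp add: fbm_cov_def)
    qed
    show ?thesis using *[of t s] *[of s t] assms by (cases "t \<le> s") (auto simp: fbm_cov_commute)
  qed
  then show "(\<integral>r. kernel H t r * kernel H s r \<partial>lborel) = fbm_cov H t s"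
    using nn_integral_kernel_mult[OF assms] nn by (subst integral_eq_nn_integral) auto
qed

lemma kernel_zero_neg: "t \<le> 0 \<Longrightarrow> kernel H t = (\<lambda>r. 0)"
  by (auto simp: kernel_eq_0)

lemma kernel_L2: "kernel H t \<in> L2_fun half_line"
proof (cases "t \<ge> 0")
  case True
  then show ?thesis using integrable_kernel_mult(1)[of t t]
    by (intro L2_half_lineI) (auto simp: power2_eq_square)
next
  case False
  then show ?thesis by (simp add: kernel_zero_neg L2_zero)
qed

lemma kernel_inner:
  assumes "0 \<le> t" "0 \<le> s"
  shows "(\<integral>r. kernel H t r * kernel H s r \<partial>half_line) = fbm_cov H t s"
proof -
  have "(\<integral>r. kernel H t r * kernel H s r \<partial>half_line) = (\<integral>r. kernel H t r * kernel H s r \<partial>lborel)"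
    unfolding integral_half_line
    by (intro Bochner_Integration.integral_cong) (auto simp: indicator_def kernel_eq_0)
  then show ?thesis using integrable_kernel_mult[OF assms] by simp
qed

text \<open>
  Since \<open>kernel H t\<close> vanishes outside \<open>(0, t)\<close>, the value of the
  operator at \<open>t\<close> is an inner product on the whole half-line.
\<close>

lemma kernel_op_eq_inner: "kernel_op H f t = (\<integral>r. f r * kernel H t r \<partial>half_line)"
  unfolding kernel_op_def set_lebesgue_integral_def integral_half_line
  by (intro Bochner_Integration.integral_cong) (auto simp: indicator_def kernel_eq_0)

lemma kernel_op_kernel: "0 \<le> t \<Longrightarrow> kernel_op H (kernel H t) = (\<lambda>s. fbm_cov H t s * indicator {0..} s)"
proof
  fix s assume "0 \<le> t"
  then show "kernel_op H (kernel H t) s = fbm_cov H t s * indicator {0..} s"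
    by (cases "s \<ge> 0") (auto simp: kernel_op_eq_inner kernel_inner kernel_zero_neg)
qed

lemma kernel_op_linear:
  assumes "f \<in> L2_fun half_line" "g \<in> L2_fun half_line"
  shows "kernel_op H (\<lambda>r. a * f r + b * g r) = (\<lambda>t. a * kernel_op H f t + b * kernel_op H g t)"
proof
  fix t
  show "kernel_op H (\<lambda>r. a * f r + b * g r) t = a * kernel_op H f t + b * kernel_op H g t"
    using L2_mult_integrable[OF assms(1) kernel_L2[of t]] L2_mult_integrable[OF assms(2) kernel_L2[of t]]
    by (simp add: kernel_op_eq_inner distrib_right mult.assoc)
qed

lemma kernel_op_cong_AE:
  assumes "f \<in> L2_fun half_line" "g \<in> L2_fun half_line" "AE r in half_line. f r = g r"
  shows "kernel_op H f = kernel_op H g"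
proof
  fix t
  show "kernel_op H f t = kernel_op H g t"
    unfolding kernel_op_eq_inner using assms L2_funD(1)[OF kernel_L2[of t]]
    by (intro integral_cong_AE) (auto simp: L2_fun_def)
qed

lemma kernel_increment_norm:
  assumes "0 \<le> t" "0 \<le> s"
  shows "(\<integral>r. (kernel H t r - kernel H s r)\<^sup>2 \<partial>half_line) = \<bar>t - s\<bar> powr (2 * H)"
proof -
  have "(\<integral>r. (kernel H t r - kernel H s r)\<^sup>2 \<partial>half_line) = fbm_cov H t t - 2 * fbm_cov H t s + fbm_cov H s s"
    unfolding L2_norm_diff[OF kernel_L2 kernel_L2] using kernel_inner assms by (simp add: power2_eq_square)
  then show ?thesis using assms by (simp add: fbm_cov_def diff_divide_distrib add_divide_distrib)
qed

text \<open>
  Cauchy-Schwarz, with the increment \<open>K\<^sub>t - K\<^sub>s\<close> of square norm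
  \<open>\<bar>t - s\<bar>\<^bsup>2 H\<^esup>\<close>.
\<close>

lemma kernel_op_Hoelder:
  assumes f: "f \<in> L2_fun half_line" and ts: "0 \<le> t" "0 \<le> s"
  shows "\<bar>kernel_op H f t - kernel_op H f s\<bar> \<le> sqrt (\<integral>r. (f r)\<^sup>2 \<partial>half_line) * \<bar>t - s\<bar> powr H"
proof -
  have "kernel_op H f t - kernel_op H f s = (\<integral>r. f r * (kernel H t r - kernel H s r) \<partial>half_line)"
    using L2_mult_integrable[OF f kernel_L2[of t]] L2_mult_integrable[OF f kernel_L2[of s]]
    by (simp add: kernel_op_eq_inner right_diff_distrib)
  then have "(kernel_op H f t - kernel_op H f s)\<^sup>2 \<le> (\<integral>r. (f r)\<^sup>2 \<partial>half_line) * \<bar>t - s\<bar> powr (2 * H)"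
    using L2_Cauchy_Schwarz[OF f L2_diff[OF kernel_L2[of t] kernel_L2[of s]]] kernel_increment_norm[OF ts]
    by simp
  also have "\<dots> = (sqrt (\<integral>r. (f r)\<^sup>2 \<partial>half_line) * \<bar>t - s\<bar> powr H)\<^sup>2"
  proof -
    have "(\<bar>t - s\<bar> powr H)\<^sup>2 = \<bar>t - s\<bar> powr (2 * H)"
      by (simp add: power2_eq_square powr_add[symmetric])
    then show ?thesis by (simp add: power_mult_distrib)
  qed
  finally have "\<bar>kernel_op H f t - kernel_op H f s\<bar>\<^sup>2 \<le> (sqrt (\<integral>r. (f r)\<^sup>2 \<partial>half_line) * \<bar>t - s\<bar> powr H)\<^sup>2"
    unfolding power2_abs .
  then show ?thesis by (rule power2_le_imp_le) simp
qed

lemma kernel_op_zero: "kernel_op H f 0 = 0"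
  by (simp add: kernel_op_eq_inner kernel_zero_neg)

lemma kernel_op_continuous:
  assumes f: "f \<in> L2_fun half_line"
  shows "continuous_on {0..} (kernel_op H f)"
  unfolding continuous_on_def
proof
  fix s :: real assume s: "s \<in> {0..}"
  let ?C = "sqrt (\<integral>r. (f r)\<^sup>2 \<partial>half_line)"
  have "((\<lambda>t. kernel_op H f t - kernel_op H f s) \<longlongrightarrow> 0) (at s within {0..})"
  proof (rule tendsto_rabs_zero_cancel, rule tendsto_sandwich[of "\<lambda>_. 0"])
    show "\<forall>\<^sub>F t in at s within {0..}. \<bar>kernel_op H f t - kernel_op H f s\<bar> \<le> ?C * \<bar>t - s\<bar> powr H"
      using s kernel_op_Hoelder[OF f, of _ s] by (auto simp: eventually_at_filter)
    have "((\<lambda>t. ?C * \<bar>t - s\<bar> powr H) \<longlongrightarrow> ?C * \<bar>s - s\<bar> powr H) (at s within {0..})"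
      using H by (intro tendsto_intros) (auto intro!: always_eventually)
    then show "((\<lambda>t. ?C * \<bar>t - s\<bar> powr H) \<longlongrightarrow> 0) (at s within {0..})" by simp
  qed auto
  then show "(kernel_op H f \<longlongrightarrow> kernel_op H f s) (at s within {0..})"
    by (simp add: LIM_zero_iff)
qed

text \<open>
  The two exponents add up to \<open>-1\<close>, so the value does not depend on \<open>s\<close>
  and \<open>t\<close>. This is what makes the Abel equation solvable.
\<close>

lemma nn_integral_Abel:
  assumes "s < t"
  shows "(\<integral>\<^sup>+u. ennreal ((t - u) powr (1/2 - H) * (u - s) powr (H - 3/2)) * indicator {s..t} u \<partial>lborel)
    = ennreal (Beta (H - 1/2) (3/2 - H))"
proof -
  have "(\<integral>\<^sup>+u. ennreal ((t - u) powr (1/2 - H) * (u - s) powr (H - 3/2)) * indicator {s..t} u \<partial>lborel)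
    = ennreal \<bar>t - s\<bar> * (\<integral>\<^sup>+x. ennreal ((t - (s + (t - s) * x)) powr (1/2 - H) * ((s + (t - s) * x) - s) powr (H - 3/2)) * indicator {s..t} (s + (t - s) * x) \<partial>lborel)"
    using assms by (intro nn_integral_real_affine) auto
  also have "\<dots> = (\<integral>\<^sup>+x. ennreal \<bar>t - s\<bar> * (ennreal ((t - (s + (t - s) * x)) powr (1/2 - H) * ((s + (t - s) * x) - s) powr (H - 3/2)) * indicator {s..t} (s + (t - s) * x)) \<partial>lborel)"
    by (subst nn_integral_cmult) measurable
  also have "\<dots> = (\<integral>\<^sup>+x. ennreal (x powr ((H - 1/2) - 1) * (1 - x) powr ((3/2 - H) - 1)) * indicator {0..1} x \<partial>lborel)"
  proof (rule nn_integral_cong)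
    fix x :: real
    have "s + (t - s) * x \<in> {s..t} \<longleftrightarrow> x \<in> {0..1}"
    proof -
      have "(t - s) * x \<le> (t - s) * 1 \<longleftrightarrow> x \<le> 1" "0 \<le> (t - s) * x \<longleftrightarrow> 0 \<le> x"
        using assms by (auto simp: zero_le_mult_iff)
      then show ?thesis unfolding atLeastAtMost_iff by (metis add_le_cancel_left add.right_neutral diff_add_cancel add.commute mult.right_neutral)
    qed
    moreover have "\<bar>t - s\<bar> * ((t - (s + (t - s) * x)) powr (1/2 - H) * ((s + (t - s) * x) - s) powr (H - 3/2))
       = x powr ((H - 1/2) - 1) * (1 - x) powr ((3/2 - H) - 1)" if "x \<in> {0..1}"
    proof -
      have 1: "t - (s + (t - s) * x) = (t - s) * (1 - x)" by (simp add: algebra_simps)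
      have 2: "(t - s) * ((t - s) powr (1/2 - H) * (t - s) powr (H - 3/2)) = 1"
        using assms by (simp add: powr_add[symmetric] powr_minus)
      have "\<bar>t - s\<bar> * ((t - (s + (t - s) * x)) powr (1/2 - H) * ((s + (t - s) * x) - s) powr (H - 3/2))
        = ((t - s) * ((t - s) powr (1/2 - H) * (t - s) powr (H - 3/2))) * (x powr (H - 3/2) * (1 - x) powr (1/2 - H))"
        unfolding 1 using assms that by (simp add: powr_mult)
      then show ?thesis unfolding 2 by simp
    qed
    ultimately show "ennreal \<bar>t - s\<bar> * (ennreal ((t - (s + (t - s) * x)) powr (1/2 - H) * ((s + (t - s) * x) - s) powr (H - 3/2)) * indicator {s..t} (s + (t - s) * x))
      = ennreal (x powr ((H - 1/2) - 1) * (1 - x) powr ((3/2 - H) - 1)) * indicator {0..1} x"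
      by (cases "x \<in> {0..1}") (simp_all add: ennreal_mult'[symmetric])
  qed
  also have "\<dots> = ennreal (Beta (H - 1/2) (3/2 - H))" by (rule nn_integral_Beta) (use H in auto)
  finally show ?thesis .
qed

lemma powr_L2: "0 \<le> t \<Longrightarrow> (\<lambda>r. indicator {0..t} r * r powr (1/2 - H)) \<in> L2_fun half_line"
proof (rule L2_half_lineI)
  assume t: "0 \<le> t"
  show "integrable lborel (\<lambda>r. (indicator {0..t} r * r powr (1/2 - H))\<^sup>2)"
  proof (rule integrableI_bounded)
    have "(\<integral>\<^sup>+r. ennreal (norm ((indicator {0..t} r * r powr (1/2 - H))\<^sup>2)) \<partial>lborel)
      = (\<integral>\<^sup>+r. ennreal ((r - 0) powr (1 - 2 * H)) * indicator {0..t} r \<partial>lborel)"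
      by (intro nn_integral_cong) (auto simp: indicator_def power2_eq_square powr_add[symmetric])
    also have "\<dots> < \<infinity>" using t H by (subst nn_integral_powr_right) auto
    finally show "(\<integral>\<^sup>+r. ennreal (norm ((indicator {0..t} r * r powr (1/2 - H))\<^sup>2)) \<partial>lborel) < \<infinity>" .
  qed measurable
qed measurable

text \<open>
  Write the operator as \<open>\<integral>\<^sub>0\<^sup>t A(u) du\<close>, where
  \<open>A(u)\<close> is a weighted Abel transform of \<open>f\<close>. If all these integrals
  vanish, then \<open>A = 0\<close> almost everywhere. Integrating \<open>A\<close> against
  \<open>(t - u)\<^bsup>1/2 - H\<^esup> u\<^bsup>1/2 - H\<^esup>\<close> undoes the Abel transform
  and leaves \<open>\<integral>\<^sub>0\<^sup>t r\<^bsup>1/2 - H\<^esup> f(r) dr = 0\<close> for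
  all \<open>t\<close>, hence \<open>f = 0\<close>.
\<close>

lemma kernel_op_injective:
  assumes f: "f \<in> L2_fun half_line" and zero: "\<And>t. 0 \<le> t \<Longrightarrow> kernel_op H f t = 0"
  shows "AE r in half_line. f r = 0"
proof -
  define g where "g r = indicator {0..} r * f r" for r
  have gm[measurable]: "g \<in> borel_measurable borel"
    using L2_funD(1)[OF f] unfolding borel_measurable_half_line g_def[abs_def] .
  define A where "A u = (\<integral>r. density_kernel u r * g r \<partial>lborel)" for u
  have Ki: "integrable lborel (\<lambda>r. kernel H t r * g r)" and K0: "0 \<le> t \<Longrightarrow> (\<integral>r. kernel H t r * g r \<partial>lborel) = 0" for t
  proof -
    have "integrable half_line (\<lambda>r. f r * kernel H t r)" by (rule L2_mult_integrable[OF f kernel_L2])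
    then show "integrable lborel (\<lambda>r. kernel H t r * g r)" by (simp add: integrable_half_line g_def mult_ac)
    show "(\<integral>r. kernel H t r * g r \<partial>lborel) = 0" if "0 \<le> t"
      using zero[OF that] by (simp add: kernel_op_eq_inner integral_half_line g_def mult_ac)
  qed
  have A: "AE u in lborel. 0 \<le> u \<longrightarrow> A u = 0"
  proof (rule zero_if_integrals_zero)
    fix t :: real assume t: "0 \<le> t"
    have N: "(\<integral>\<^sup>+u. ennreal (indicator {0..t} u * density_kernel u r) \<partial>lborel) = ennreal (kernel H t r)" for r
      unfolding nn_integral_density_kernel[symmetric]
      by (intro nn_integral_cong) (auto simp: indicator_def)
    have eq: "(\<lambda>u. \<integral>r. indicator {0..t} u * density_kernel u r * g r \<partial>lborel) = (\<lambda>u. indicator {0..t} u * A u)"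
      by (simp add: A_def mult.assoc)
    show "integrable lborel (\<lambda>u. indicator {0..t} u * A u)"
      unfolding eq[symmetric]
      by (rule Fubini_kernel(1)[OF _ _ _ _ _ N Ki]) (auto simp: density_kernel_nonneg kernel_nonneg)
    show "(\<integral>u. indicator {0..t} u * A u \<partial>lborel) = 0"
      unfolding eq[symmetric]
      by (rule trans[OF Fubini_kernel(2)[OF _ _ _ _ _ N Ki] K0[OF t]]) (auto simp: density_kernel_nonneg kernel_nonneg)
  qed
  define c where "c = kernel_const H * Beta (H - 1/2) (3/2 - H)"
  have c: "c > 0" unfolding c_def Beta_def using H kernel_const_pos
    by (intro mult_pos_pos divide_pos_pos Gamma_real_pos) auto
  have B: "AE r in lborel. 0 \<le> r \<longrightarrow> r powr (1/2 - H) * g r = 0"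
  proof (rule zero_if_integrals_zero)
    fix t :: real assume t: "0 \<le> t"
    show i: "integrable lborel (\<lambda>r. indicator {0..t} r * (r powr (1/2 - H) * g r))"
      using L2_mult_integrable[OF powr_L2[OF t] f] by (simp add: integrable_half_line g_def mult_ac)
    define w where "w u = indicator {0..t} u * ((t - u) powr (1/2 - H) * u powr (1/2 - H))" for u
    have [measurable]: "w \<in> borel_measurable borel" unfolding w_def[abs_def] by measurable
    have w0: "w u \<ge> 0" for u by (simp add: w_def)
    \<comment> \<open>The endpoints are excluded so that this is the mass of the kernel at every \<open>r\<close>, as
      the Fubini lemma requires.\<close>
    define N where "N r = indicator {0<..<t} r * (c * r powr (1/2 - H))" for r
    have N: "(\<integral>\<^sup>+u. ennreal (w u * density_kernel u r) \<partial>lborel) = ennreal (N r)" for r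
    proof (cases "r \<in> {0<..<t}")
      case False
      then have "(\<lambda>u. ennreal (w u * density_kernel u r)) = (\<lambda>u. 0)"
        by (auto simp: w_def indicator_def density_kernel_def)
      then show ?thesis using False by (simp add: N_def)
    next
      case True
      have "(\<integral>\<^sup>+u. ennreal (w u * density_kernel u r) \<partial>lborel)
        = (\<integral>\<^sup>+u. ennreal (kernel_const H * r powr (1/2 - H)) * (ennreal ((t - u) powr (1/2 - H) * (u - r) powr (H - 3/2)) * indicator {r..t} u) \<partial>lborel)"
      proof (rule nn_integral_cong)
        fix u
        show "ennreal (w u * density_kernel u r) = ennreal (kernel_const H * r powr (1/2 - H)) * (ennreal ((t - u) powr (1/2 - H) * (u - r) powr (H - 3/2)) * indicator {r..t} u)"
        proof (cases "r < u \<and> u \<le> t")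
          case True
          then have "u powr (1/2 - H) * u powr (H - 1/2) = 1"
            using \<open>r \<in> {0<..<t}\<close> by (simp add: powr_add[symmetric])
          then have "w u * density_kernel u r = kernel_const H * r powr (1/2 - H) * ((t - u) powr (1/2 - H) * (u - r) powr (H - 3/2))"
            using True \<open>r \<in> {0<..<t}\<close> by (simp add: w_def density_kernel_def mult_ac)
          then show ?thesis using True kernel_const_pos by (simp add: ennreal_mult'[symmetric])
        next
          case False
          then show ?thesis by (auto simp: w_def density_kernel_def indicator_def)
        qed
      qed
      also have "\<dots> = ennreal (kernel_const H * r powr (1/2 - H)) * ennreal (Beta (H - 1/2) (3/2 - H))"
        using True by (subst nn_integral_cmult) (auto simp: nn_integral_Abel)
      also have "\<dots> = ennreal (N r)"
        using True kernel_const_pos by (simp add: N_def c_def ennreal_mult'[symmetric] mult_ac)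
      finally show ?thesis .
    qed
    have Nae: "AE r in lborel. N r * g r = c * (indicator {0..t} r * (r powr (1/2 - H) * g r))"
      using AE_lborel_neq[of 0] AE_lborel_neq[of t] by eventually_elim (auto simp: N_def indicator_def)
    have [measurable]: "N \<in> borel_measurable borel" unfolding N_def[abs_def] by measurable
    have "integrable lborel (\<lambda>r. c * (indicator {0..t} r * (r powr (1/2 - H) * g r)))" using i by simp
    then have Ni: "integrable lborel (\<lambda>r. N r * g r)"
      by (rule integrable_cong_AE_imp) (use Nae in \<open>auto elim: eventually_mono\<close>)
    have N0: "0 \<le> N r" for r using c by (simp add: N_def)
    have "(\<integral>u. (\<integral>r. w u * density_kernel u r * g r \<partial>lborel) \<partial>lborel) = (\<integral>r. N r * g r \<partial>lborel)"
      by (rule Fubini_kernel(2)[OF _ _ _ _ _ N Ni]) (auto simp: density_kernel_nonneg w0 N0)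
    moreover have "(\<integral>u. (\<integral>r. w u * density_kernel u r * g r \<partial>lborel) \<partial>lborel) = 0"
    proof (rule integral_eq_zero_AE)
      show "AE u in lborel. (\<integral>r. w u * density_kernel u r * g r \<partial>lborel) = 0"
        using A
      proof eventually_elim
        case (elim u)
        then show ?case by (cases "0 \<le> u") (auto simp: A_def mult.assoc w_def)
      qed
    qed
    moreover have "(\<integral>r. N r * g r \<partial>lborel) = (\<integral>r. c * (indicator {0..t} r * (r powr (1/2 - H) * g r)) \<partial>lborel)"
      by (rule integral_cong_AE) (use Nae in auto)
    ultimately show "(\<integral>r. indicator {0..t} r * (r powr (1/2 - H) * g r) \<partial>lborel) = 0"
      using c by simp
  qed
  show ?thesis
    unfolding AE_half_line using B AE_lborel_neq[of 0]
    by eventually_elim (auto simp: g_def)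
qed

end

section \<open>Integration by parts for one-dimensional Gaussian laws\<close>

lemma (in prob_space) gaussian_law_moments:
  assumes [measurable]: "X \<in> borel_measurable M" and \<sigma>: "0 \<le> \<sigma>"
    and law: "distr M borel X = gaussian_law m \<sigma>"
  shows "X \<in> L2_fun M" "expectation X = m" "(\<integral>x. (X x)\<^sup>2 \<partial>M) = m\<^sup>2 + \<sigma>\<^sup>2"
    "(\<integral>x. cos (X x + \<theta>) \<partial>M) = cos (m + \<theta>) * exp (- \<sigma>\<^sup>2 / 2)"
proof -
  have main: "integrable M (\<lambda>x. (X x)\<^sup>2) \<and> expectation X = m \<and> (\<integral>x. (X x)\<^sup>2 \<partial>M) = m\<^sup>2 + \<sigma>\<^sup>2 \<and>
    (\<integral>x. cos (X x + \<theta>) \<partial>M) = cos (m + \<theta>) * exp (- \<sigma>\<^sup>2 / 2)"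
  proof (cases "\<sigma> = 0")
    case True
    then have d: "distr M borel X = return borel m" using law by (simp add: gaussian_law_def)
    have E: "expectation (\<lambda>x. g (X x)) = g m" if [measurable]: "g \<in> borel_measurable borel" for g :: "real \<Rightarrow> real"
      using integral_distr[of X M borel g] by (simp add: d integral_return)
    have "integrable M (\<lambda>x. (X x)\<^sup>2) \<longleftrightarrow> integrable (return borel m) (\<lambda>x. x\<^sup>2)"
      using integrable_distr_eq[of X M borel "\<lambda>x. x\<^sup>2"] by (simp add: d)
    moreover have "integrable (return borel m) (\<lambda>x. x\<^sup>2)"
      by (simp add: integrable_iff_bounded nn_integral_return)
    ultimately show ?thesis using E[of "\<lambda>x. x"] E[of "\<lambda>x. x\<^sup>2"] E[of "\<lambda>x. cos (x + \<theta>)"] True by simp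
  next
    case False
    with \<sigma> have s: "0 < \<sigma>" by simp
    have d: "distributed M lborel X (normal_density m \<sigma>)"
      using law False unfolding distributed_def gaussian_law_def
      by (simp add: distr_cong[OF refl sets_lborel])
    have m: "expectation X = m" using normal_distributed_expectation[OF s d] .
    have v: "variance X = \<sigma>\<^sup>2" using normal_distributed_variance[OF s d] .
    have "integrable lborel (\<lambda>x. normal_density m \<sigma> x * (x - m)^2)"
      by (rule integrable_normal_moment[OF s])
    then have i2: "integrable M (\<lambda>x. (X x - m)\<^sup>2)"
      using distributed_integrable[OF d, of "\<lambda>x. (x - m)^2"] by simp
    have i1: "integrable M (\<lambda>x. X x - m)"
      using L2_integrable[of "\<lambda>x. X x - m"] i2 by (simp add: L2_fun_def)
    have sq: "(\<lambda>x. (X x)\<^sup>2) = (\<lambda>x. (X x - m)\<^sup>2 + (2 * m) * (X x - m) + m\<^sup>2)"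
      by (auto simp: power2_eq_square algebra_simps)
    have i: "integrable M (\<lambda>x. (X x)\<^sup>2)" unfolding sq using i1 i2 by auto
    have e0: "expectation (\<lambda>x. X x - m) = 0"
    proof -
      have "integrable M (\<lambda>x. (X x - m) + m)" using i1 by (intro Bochner_Integration.integrable_add) auto
      then have "integrable M X" by simp
      then show ?thesis using m by (simp add: prob_space)
    qed
    have "(\<integral>x. (X x)\<^sup>2 \<partial>M) = (\<integral>x. (X x - m)\<^sup>2 \<partial>M) + (2 * m) * expectation (\<lambda>x. X x - m) + m\<^sup>2"
      unfolding sq using i1 i2 by (simp add: prob_space)
    then have v': "(\<integral>x. (X x)\<^sup>2 \<partial>M) = m\<^sup>2 + \<sigma>\<^sup>2" using v m e0 by simp
    define Y where "Y x = (X x - m) / \<sigma>" for x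
    have [measurable]: "Y \<in> borel_measurable M" unfolding Y_def[abs_def] by measurable
    have "distributed M lborel Y std_normal_density"
      using d normal_standard_normal_convert[OF s] unfolding Y_def[abs_def] by auto
    then have dY: "distr M borel Y = std_normal_distribution"
      unfolding distributed_def by (simp add: distr_cong[OF refl sets_lborel])
    have "complex_of_real (exp (- \<sigma>\<^sup>2 / 2)) = (\<integral>x. iexp (\<sigma> * Y x) \<partial>M)"
    proof -
      have "char std_normal_distribution \<sigma> = (\<integral>x. iexp (\<sigma> * Y x) \<partial>M)"
        unfolding dY[symmetric] char_def by (subst integral_distr) auto
      then show ?thesis by (simp add: char_std_normal_distribution)
    qed
    then have "cis (m + \<theta>) * complex_of_real (exp (- \<sigma>\<^sup>2 / 2)) = (\<integral>x. cis (m + \<theta>) * iexp (\<sigma> * Y x) \<partial>M)"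
      by simp
    also have "\<dots> = (\<integral>x. cis (X x + \<theta>) \<partial>M)"
    proof (intro Bochner_Integration.integral_cong refl)
      fix x
      have X: "X x = m + \<sigma> * Y x" using s by (simp add: Y_def)
      show "cis (m + \<theta>) * iexp (\<sigma> * Y x) = cis (X x + \<theta>)"
        unfolding X by (simp add: cis_conv_exp exp_add[symmetric] algebra_simps)
    qed
    finally have "(\<integral>x. cis (X x + \<theta>) \<partial>M) = cis (m + \<theta>) * complex_of_real (exp (- \<sigma>\<^sup>2 / 2))" by (rule sym)
    then have "Re (\<integral>x. cis (X x + \<theta>) \<partial>M) = cos (m + \<theta>) * exp (- \<sigma>\<^sup>2 / 2)" by simp
    moreover have "integrable M (\<lambda>x. cis (X x + \<theta>))"
    proof (rule integrable_const_bound[of _ 1])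
      show "(\<lambda>x. cis (X x + \<theta>)) \<in> borel_measurable M" unfolding cis_conv_exp by measurable
    qed auto
    then have "Re (\<integral>x. cis (X x + \<theta>) \<partial>M) = (\<integral>x. Re (cis (X x + \<theta>)) \<partial>M)"
      by (rule integral_Re[symmetric])
    ultimately show ?thesis using i m v' by simp
  qed
  show "X \<in> L2_fun M" "expectation X = m" "(\<integral>x. (X x)\<^sup>2 \<partial>M) = m\<^sup>2 + \<sigma>\<^sup>2"
    "(\<integral>x. cos (X x + \<theta>) \<partial>M) = cos (m + \<theta>) * exp (- \<sigma>\<^sup>2 / 2)"
    using main by (auto simp: L2_fun_def)
qed

text \<open>
  Both sides are the derivative at \<open>\<epsilon> = 0\<close> of the hypothesis, up to the
  sign: on the left by dominated convergence with bound \<open>\<bar>Y\<bar>\<close>, on the right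
  because \<open>E(X + \<epsilon> Y)\<^sup>2\<close> has derivative \<open>2 E[X Y]\<close> there.
\<close>

lemma (in prob_space) gaussian_pair_sin:
  assumes X: "X \<in> L2_fun M" and Y: "Y \<in> L2_fun M"
    and cf: "\<And>\<epsilon>. (\<integral>x. cos (X x + \<epsilon> * Y x + \<theta>) \<partial>M) = cos \<theta> * exp (- (\<integral>x. (X x + \<epsilon> * Y x)\<^sup>2 \<partial>M) / 2)"
  shows "(\<integral>x. Y x * sin (X x + \<theta>) \<partial>M) = (\<integral>x. X x * Y x \<partial>M) * (\<integral>x. cos (X x + \<theta>) \<partial>M)"
proof -
  have [measurable]: "X \<in> borel_measurable M" "Y \<in> borel_measurable M" using X Y by (auto simp: L2_fun_def)
  define a b d where "a = (\<integral>x. (X x)\<^sup>2 \<partial>M)" and "b = (\<integral>x. X x * Y x \<partial>M)" and "d = (\<integral>x. (Y x)\<^sup>2 \<partial>M)"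
  define \<phi> where "\<phi> \<epsilon> = (\<integral>x. cos (X x + \<epsilon> * Y x + \<theta>) \<partial>M)" for \<epsilon>
  have \<phi>: "\<phi> \<epsilon> = cos \<theta> * exp (- (a + 2 * \<epsilon> * b + \<epsilon>\<^sup>2 * d) / 2)" for \<epsilon>
    unfolding \<phi>_def cf a_def b_def d_def using L2_norm_add[OF X Y, of 1 \<epsilon>] by simp
  have "(\<phi> has_real_derivative (- b * \<phi> 0)) (at 0)"
    unfolding \<phi>[abs_def] by (auto intro!: derivative_eq_intros)
  then have D: "((\<lambda>\<epsilon>. (\<phi> \<epsilon> - \<phi> 0) / \<epsilon>) \<longlongrightarrow> - b * \<phi> 0) (at 0)"
    by (simp add: DERIV_def)
  define e where "e n = 1 / real (Suc n)" for n
  have e: "e \<longlonglongrightarrow> 0" "e n \<noteq> 0" for n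
    unfolding e_def[abs_def] using LIMSEQ_inverse_real_of_nat by (auto simp: inverse_eq_divide)
  have fe: "filterlim e (at 0) sequentially" unfolding filterlim_at using e by auto
  have L1: "(\<lambda>n. (\<phi> (e n) - \<phi> 0) / e n) \<longlonglongrightarrow> - b * \<phi> 0"
    by (rule filterlim_compose[OF D fe])
  have ci: "integrable M (\<lambda>x. cos (X x + \<epsilon> * Y x + \<theta>))" for \<epsilon>
    by (rule integrable_const_bound[of _ 1]) auto
  have "(\<lambda>n. \<integral>x. (cos (X x + e n * Y x + \<theta>) - cos (X x + \<theta>)) / e n \<partial>M) \<longlonglongrightarrow> (\<integral>x. - (Y x * sin (X x + \<theta>)) \<partial>M)"
  proof (rule integral_dominated_convergence[where w="\<lambda>x. \<bar>Y x\<bar>"])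
    show "integrable M (\<lambda>x. \<bar>Y x\<bar>)" using L2_integrable[OF Y] by simp
    show "AE x in M. (\<lambda>n. (cos (X x + e n * Y x + \<theta>) - cos (X x + \<theta>)) / e n) \<longlonglongrightarrow> - (Y x * sin (X x + \<theta>))"
    proof (rule AE_I2)
      fix x
      have "((\<lambda>\<epsilon>. cos (X x + \<epsilon> * Y x + \<theta>)) has_real_derivative - (Y x * sin (X x + \<theta>))) (at 0)"
        by (auto intro!: derivative_eq_intros)
      then have "((\<lambda>\<epsilon>. (cos (X x + \<epsilon> * Y x + \<theta>) - cos (X x + \<theta>)) / \<epsilon>) \<longlongrightarrow> - (Y x * sin (X x + \<theta>))) (at 0)"
        by (simp add: DERIV_def)
      from filterlim_compose[OF this fe]
      show "(\<lambda>n. (cos (X x + e n * Y x + \<theta>) - cos (X x + \<theta>)) / e n) \<longlonglongrightarrow> - (Y x * sin (X x + \<theta>))" .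
    qed
    fix n
    show "AE x in M. norm ((cos (X x + e n * Y x + \<theta>) - cos (X x + \<theta>)) / e n) \<le> \<bar>Y x\<bar>"
    proof (rule AE_I2)
      fix x
      have "\<bar>cos p - cos q\<bar> \<le> \<bar>p - q\<bar>" for p q :: real
      proof -
        have "\<bar>cos p - cos q\<bar> = 2 * \<bar>sin ((p + q) / 2)\<bar> * \<bar>sin ((q - p) / 2)\<bar>"
          by (simp add: cos_diff_cos abs_mult)
        also have "\<dots> \<le> 2 * 1 * \<bar>(q - p) / 2\<bar>"
          by (intro mult_mono abs_sin_le_one abs_sin_x_le_abs_x) auto
        finally show ?thesis by simp
      qed
      from this[of "X x + e n * Y x + \<theta>" "X x + \<theta>"]
      show "norm ((cos (X x + e n * Y x + \<theta>) - cos (X x + \<theta>)) / e n) \<le> \<bar>Y x\<bar>"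
        using e(2)[of n] by (simp add: abs_mult divide_simps mult.commute)
    qed
  qed measurable
  moreover have "(\<integral>x. (cos (X x + e n * Y x + \<theta>) - cos (X x + \<theta>)) / e n \<partial>M) = (\<phi> (e n) - \<phi> 0) / e n" for n
    using ci[of "e n"] ci[of 0] by (simp add: \<phi>_def)
  ultimately have "(\<lambda>n. (\<phi> (e n) - \<phi> 0) / e n) \<longlonglongrightarrow> (\<integral>x. - (Y x * sin (X x + \<theta>)) \<partial>M)"
    by (simp only:)
  from LIMSEQ_unique[OF L1 this]
  have "- b * \<phi> 0 = (\<integral>x. - (Y x * sin (X x + \<theta>)) \<partial>M)" .
  then show ?thesis by (simp add: \<phi>_def b_def)
qed

section \<open>Linear spans and the Cameron-Martin space\<close>

definition lin_span :: "('i \<Rightarrow> 'a \<Rightarrow> real) \<Rightarrow> 'i set \<Rightarrow> ('a \<Rightarrow> real) set" where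
  "lin_span g A = {(\<lambda>x. \<Sum>t\<in>I. c t * g t x) | I c. finite I \<and> I \<subseteq> A}"

lemma lin_spanE:
  assumes "X \<in> lin_span g A"
  obtains I c where "X = (\<lambda>x. \<Sum>t\<in>I. c t * g t x)" "finite I" "I \<subseteq> A"
  using assms unfolding lin_span_def by blast

lemma lin_spanI: "finite I \<Longrightarrow> I \<subseteq> A \<Longrightarrow> (\<lambda>x. \<Sum>t\<in>I. c t * g t x) \<in> lin_span g A"
  unfolding lin_span_def by blast

lemma lin_span_zero: "(\<lambda>x. 0) \<in> lin_span g A"
  unfolding lin_span_def by (intro CollectI exI[of _ "{}"]) auto

lemma lin_span_base: "t \<in> A \<Longrightarrow> g t \<in> lin_span g A"
  unfolding lin_span_def by (intro CollectI exI[of _ "{t}"] exI[of _ "\<lambda>_. 1"]) auto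

lemma lin_span_lincomb:
  assumes "X \<in> lin_span g A" "Y \<in> lin_span g A"
  shows "(\<lambda>x. a * X x + b * Y x) \<in> lin_span g A"
proof -
  obtain I c J d where X: "X = (\<lambda>x. \<Sum>t\<in>I. c t * g t x)" "finite I" "I \<subseteq> A"
    and Y: "Y = (\<lambda>x. \<Sum>t\<in>J. d t * g t x)" "finite J" "J \<subseteq> A"
    using assms unfolding lin_span_def by blast
  have "(\<lambda>x. a * X x + b * Y x) = (\<lambda>x. \<Sum>t\<in>I \<union> J. (a * (if t \<in> I then c t else 0) + b * (if t \<in> J then d t else 0)) * g t x)"
  proof
    fix x
    have 1: "X x = (\<Sum>t\<in>I \<union> J. (if t \<in> I then c t else 0) * g t x)"
      unfolding X(1) using X(2) Y(2) by (intro sum.mono_neutral_cong_left) auto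
    have 2: "Y x = (\<Sum>t\<in>I \<union> J. (if t \<in> J then d t else 0) * g t x)"
      unfolding Y(1) using X(2) Y(2) by (intro sum.mono_neutral_cong_left) auto
    show "a * X x + b * Y x = (\<Sum>t\<in>I \<union> J. (a * (if t \<in> I then c t else 0) + b * (if t \<in> J then d t else 0)) * g t x)"
      unfolding 1 2 by (simp add: sum_distrib_left sum.distrib[symmetric] algebra_simps)
  qed
  then show ?thesis unfolding lin_span_def using X Y
    by (intro CollectI exI[of _ "I \<union> J"] exI[of _ "\<lambda>t. a * (if t \<in> I then c t else 0) + b * (if t \<in> J then d t else 0)"]) auto
qed

lemma lin_span_sum:
  assumes "\<And>i. i \<in> J \<Longrightarrow> X i \<in> lin_span g A"
  shows "(\<lambda>x. \<Sum>i\<in>J. c i * X i x) \<in> lin_span g A"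
proof (cases "finite J")
  case True
  then show ?thesis using assms
  proof (induction J rule: finite_induct)
    case (insert i J)
    then show ?case using lin_span_lincomb[of "X i" g A "\<lambda>x. \<Sum>i\<in>J. c i * X i x" "c i" 1] by simp
  qed (simp add: lin_span_zero)
qed (simp add: lin_span_zero)

lemma lin_span_L2:
  assumes "\<And>t. t \<in> A \<Longrightarrow> g t \<in> L2_fun M" "X \<in> lin_span g A"
  shows "X \<in> L2_fun M"
  using assms unfolding lin_span_def by (auto intro!: L2_sum)

lemma square_add_le: "(a + b)\<^sup>2 \<le> 2 * a\<^sup>2 + 2 * (b::real)\<^sup>2"
  using sum_squares_bound[of a b] by (simp add: power2_sum)

lemma L2_nn_integral: "f \<in> L2_fun M \<Longrightarrow> (\<integral>\<^sup>+x. ennreal ((f x)\<^sup>2) \<partial>M) = ennreal (\<integral>x. (f x)\<^sup>2 \<partial>M)"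
  by (intro nn_integral_eq_integral) (auto simp: L2_fun_def)

context hurst
begin

lemma CM_dot_L2: "h \<in> CM_space H \<Longrightarrow> CM_dot H h \<in> L2_fun half_line"
  unfolding CM_dot_def CM_space_def by (rule inv_into_into)

lemma kernel_op_CM_dot: "h \<in> CM_space H \<Longrightarrow> kernel_op H (CM_dot H h) = h"
  unfolding CM_dot_def CM_space_def using f_inv_into_f[of h "kernel_op H" "L2_fun half_line"] by simp

lemma kernel_op_in_CM: "f \<in> L2_fun half_line \<Longrightarrow> kernel_op H f \<in> CM_space H"
  by (simp add: CM_space_def)

text \<open>
  \<open>CM_dot H\<close> chooses some preimage; by injectivity it differs from \<open>f\<close>
  on a null set only.
\<close>

lemma CM_dot_kernel_op:
  assumes f: "f \<in> L2_fun half_line"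
  shows "AE r in half_line. CM_dot H (kernel_op H f) r = f r"
proof -
  note h = kernel_op_in_CM[OF f]
  have "AE r in half_line. CM_dot H (kernel_op H f) r - f r = 0"
  proof (rule kernel_op_injective[OF L2_diff[OF CM_dot_L2[OF h] f]])
    fix t
    show "kernel_op H (\<lambda>r. CM_dot H (kernel_op H f) r - f r) t = 0"
      using kernel_op_linear[OF CM_dot_L2[OF h] f, of 1 "-1"] kernel_op_CM_dot[OF h] by simp
  qed
  then show ?thesis by eventually_elim simp
qed

lemma CM_inner_kernel_op:
  assumes f: "f \<in> L2_fun half_line"
  shows "CM_inner H (kernel_op H f) (kernel_op H f) = (\<integral>r. (f r)\<^sup>2 \<partial>half_line)"
  unfolding CM_inner_def power2_eq_square
  using CM_dot_kernel_op[OF f] L2_funD(1)[OF f] L2_funD(1)[OF CM_dot_L2[OF kernel_op_in_CM[OF f]]]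
  by (intro integral_cong_AE) (auto elim: eventually_mono)

text \<open>
  Orthogonality to \<open>kernel H t\<close> for all \<open>t \<ge> 0\<close> says that the image
  under the operator vanishes, so density is another form of injectivity.
\<close>

lemma kernel_span_dense:
  assumes f: "f \<in> L2_fun half_line"
  shows "\<exists>v. (\<forall>n. v n \<in> lin_span (kernel H) {0..}) \<and> (\<lambda>n. \<integral>r. (f r - v n r)\<^sup>2 \<partial>half_line) \<longlonglongrightarrow> 0"
proof (rule L2_dense_if_orthogonal_trivial[OF _ lin_span_zero lin_span_lincomb _ f])
  show "lin_span (kernel H) {0..} \<subseteq> L2_fun half_line"
    using lin_span_L2[of "{0..}" "kernel H" half_line] kernel_L2 by blast
  fix g assume g: "g \<in> L2_fun half_line"
    and orth: "\<And>k. k \<in> lin_span (kernel H) {0..} \<Longrightarrow> (\<integral>r. g r * k r \<partial>half_line) = 0"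
  show "AE r in half_line. g r = 0"
    by (rule kernel_op_injective[OF g]) (simp add: kernel_op_eq_inner orth lin_span_base)
qed

end

section \<open>The Wiener isometry\<close>

locale fbm_wiener = hurst +
  fixes P :: "(real \<Rightarrow> real) measure" and \<delta> :: "(real \<Rightarrow> real) \<Rightarrow> (real \<Rightarrow> real) \<Rightarrow> real"
  assumes fbm: "fbm_law H P" and iso: "CM_isometry H P \<delta>"
begin

sublocale prob_space P
  using fbm by (simp add: fbm_law_def)

text \<open>
  \<open>wiener_map f\<close> is the Wiener integral \<open>\<integral>\<^sub>0\<^sup>\<infinity>
  f dB\<close>, obtained from \<open>\<delta>\<close> without reference to the Brownian motion
  \<open>B\<close>.
\<close>

definition wiener_map :: "(real \<Rightarrow> real) \<Rightarrow> (real \<Rightarrow> real) \<Rightarrow> real" where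
  "wiener_map f = \<delta> (kernel_op H f)"

abbreviation coords :: "((real \<Rightarrow> real) \<Rightarrow> real) set" where
  "coords \<equiv> lin_span (\<lambda>t w. w t) {0..}"

lemma coord_measurable: "0 \<le> t \<Longrightarrow> (\<lambda>w. w t) \<in> borel_measurable P"
  using fbm by (simp add: fbm_law_def gaussian_process_def)

lemma coords_gaussian:
  assumes "X \<in> coords"
  shows "\<exists>m \<sigma>. 0 \<le> \<sigma> \<and> distr P borel X = gaussian_law m \<sigma>"
  using assms fbm unfolding lin_span_def fbm_law_def gaussian_process_def by blast

lemma coords_measurable: "X \<in> coords \<Longrightarrow> X \<in> borel_measurable P"
  unfolding lin_span_def by (auto intro!: borel_measurable_sum borel_measurable_times coord_measurable)

lemma coords_L2:
  assumes "X \<in> coords" shows "X \<in> L2_fun P"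
proof -
  obtain m \<sigma> where "0 \<le> \<sigma>" "distr P borel X = gaussian_law m \<sigma>" using coords_gaussian[OF assms] by blast
  from gaussian_law_moments(1)[OF coords_measurable[OF assms] this] show ?thesis .
qed

lemma coord_L2: "0 \<le> t \<Longrightarrow> (\<lambda>w. w t) \<in> L2_fun P"
  by (rule coords_L2, rule lin_span_base[of t "{0..}" "\<lambda>t w. w t"]) simp

lemma coords_mean:
  assumes "X \<in> coords" shows "(\<integral>w. X w \<partial>P) = 0"
proof -
  obtain I c where X: "X = (\<lambda>w. \<Sum>t\<in>I. c t * w t)" "finite I" "I \<subseteq> {0..}"
    using lin_spanE[OF assms] .
  have "(\<integral>w. X w \<partial>P) = (\<Sum>t\<in>I. c t * (\<integral>w. w t \<partial>P))"
    unfolding X(1) using X(3) L2_integrable[OF coord_L2] by (subst Bochner_Integration.integral_sum) auto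
  also have "\<dots> = 0"
    using X(3) fbm by (intro sum.neutral) (auto simp: fbm_law_def)
  finally show ?thesis .
qed

text \<open>
  A linear combination of coordinates is Gaussian with mean \<open>0\<close>, so its
  characteristic function is real.
\<close>

lemma coords_cos:
  assumes X: "X \<in> coords"
  shows "(\<integral>w. cos (X w + \<theta>) \<partial>P) = cos \<theta> * exp (- (\<integral>w. (X w)\<^sup>2 \<partial>P) / 2)"
proof -
  obtain m \<sigma> where g: "0 \<le> \<sigma>" "distr P borel X = gaussian_law m \<sigma>" using coords_gaussian[OF X] by blast
  note mom = gaussian_law_moments[OF coords_measurable[OF X] g]
  have "m = 0" using mom(2) coords_mean[OF X] by simp
  then show ?thesis using mom(3) mom(4)[of \<theta>] by simp
qed

lemma coords_sin:
  assumes X: "X \<in> coords" and Y: "Y \<in> coords"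
  shows "(\<integral>w. Y w * sin (X w + \<theta>) \<partial>P) = (\<integral>w. X w * Y w \<partial>P) * (\<integral>w. cos (X w + \<theta>) \<partial>P)"
proof (rule gaussian_pair_sin[OF coords_L2[OF X] coords_L2[OF Y]])
  fix \<epsilon>
  have "(\<lambda>w. X w + \<epsilon> * Y w) \<in> coords" using lin_span_lincomb[OF X Y, of 1 \<epsilon>] by simp
  from coords_cos[OF this]
  show "(\<integral>w. cos (X w + \<epsilon> * Y w + \<theta>) \<partial>P) = cos \<theta> * exp (- (\<integral>w. (X w + \<epsilon> * Y w)\<^sup>2 \<partial>P) / 2)" .
qed

lemma wiener_L2: "f \<in> L2_fun half_line \<Longrightarrow> wiener_map f \<in> L2_fun P"
  using iso kernel_op_in_CM unfolding CM_isometry_def wiener_map_def by blast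

lemma wiener_norm: "f \<in> L2_fun half_line \<Longrightarrow> (\<integral>w. (wiener_map f w)\<^sup>2 \<partial>P) = (\<integral>r. (f r)\<^sup>2 \<partial>half_line)"
  using iso kernel_op_in_CM CM_inner_kernel_op unfolding CM_isometry_def wiener_map_def by simp

lemma wiener_lincomb:
  assumes "f \<in> L2_fun half_line" "g \<in> L2_fun half_line"
  shows "AE w in P. wiener_map (\<lambda>r. a * f r + b * g r) w = a * wiener_map f w + b * wiener_map g w"
  using iso assms kernel_op_in_CM unfolding CM_isometry_def wiener_map_def by (simp add: kernel_op_linear)

lemma wiener_zero: "AE w in P. wiener_map (\<lambda>r. 0) w = 0"
  using wiener_lincomb[OF L2_zero L2_zero, of 0 0] by simp

lemma wiener_sum:
  assumes "\<And>i. i \<in> I \<Longrightarrow> f i \<in> L2_fun half_line"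
  shows "AE w in P. wiener_map (\<lambda>r. \<Sum>i\<in>I. c i * f i r) w = (\<Sum>i\<in>I. c i * wiener_map (f i) w)"
proof (cases "finite I")
  case True
  then show ?thesis using assms
  proof (induction I rule: finite_induct)
    case empty
    then show ?case using wiener_zero by simp
  next
    case (insert i I)
    have "AE w in P. wiener_map (\<lambda>r. \<Sum>i\<in>I. c i * f i r) w = (\<Sum>i\<in>I. c i * wiener_map (f i) w)"
      using insert by auto
    moreover have "AE w in P. wiener_map (\<lambda>r. c i * f i r + 1 * (\<Sum>i\<in>I. c i * f i r)) w
       = c i * wiener_map (f i) w + 1 * wiener_map (\<lambda>r. \<Sum>i\<in>I. c i * f i r) w"
      using insert.prems by (intro wiener_lincomb L2_sum) auto
    ultimately show ?case by eventually_elim (use insert.hyps in simp)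
  qed
next
  case False
  then show ?thesis using wiener_zero by simp
qed

lemma wiener_kernel: "0 \<le> t \<Longrightarrow> AE w in P. wiener_map (kernel H t) w = w t"
  using iso unfolding CM_isometry_def wiener_map_def by (simp add: kernel_op_kernel)

text \<open>
  Polarization of \<open>wiener_norm\<close>; the linearity of the map holds almost surely only,
  so the squared norm of the sum is compared under the integral.
\<close>

lemma wiener_inner:
  assumes f: "f \<in> L2_fun half_line" and g: "g \<in> L2_fun half_line"
  shows "(\<integral>w. wiener_map f w * wiener_map g w \<partial>P) = (\<integral>r. f r * g r \<partial>half_line)"
proof -
  note F = wiener_L2[OF f] and G = wiener_L2[OF g]
  have "(\<integral>w. (1 * wiener_map f w + 1 * wiener_map g w)\<^sup>2 \<partial>P) = (\<integral>w. (wiener_map (\<lambda>r. 1 * f r + 1 * g r) w)\<^sup>2 \<partial>P)"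
  proof (rule integral_cong_AE)
    show "AE w in P. (1 * wiener_map f w + 1 * wiener_map g w)\<^sup>2 = (wiener_map (\<lambda>r. 1 * f r + 1 * g r) w)\<^sup>2"
      using wiener_lincomb[OF f g, of 1 1] by eventually_elim simp
  qed (use L2_funD(1)[OF F] L2_funD(1)[OF G] L2_funD(1)[OF wiener_L2[OF L2_lincomb[OF f g, of 1 1]]] in auto)
  also have "\<dots> = (\<integral>r. (1 * f r + 1 * g r)\<^sup>2 \<partial>half_line)"
    by (rule wiener_norm[OF L2_lincomb[OF f g]])
  finally show ?thesis
    unfolding L2_norm_add[OF F G] L2_norm_add[OF f g] wiener_norm[OF f] wiener_norm[OF g] by simp
qed

lemma wiener_coord:
  assumes f: "f \<in> L2_fun half_line" and t: "0 \<le> t"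
  shows "(\<integral>w. w t * wiener_map f w \<partial>P) = kernel_op H f t"
proof -
  have "(\<integral>w. w t * wiener_map f w \<partial>P) = (\<integral>w. wiener_map f w * wiener_map (kernel H t) w \<partial>P)"
  proof (rule integral_cong_AE)
    show "AE w in P. w t * wiener_map f w = wiener_map f w * wiener_map (kernel H t) w"
      using wiener_kernel[OF t] by eventually_elim simp
  qed (use L2_funD(1)[OF wiener_L2[OF f]] L2_funD(1)[OF wiener_L2[OF kernel_L2]] coord_measurable[OF t] in auto)
  then show ?thesis by (simp add: wiener_inner[OF f kernel_L2] kernel_op_eq_inner)
qed

lemma wiener_span:
  assumes "v \<in> lin_span (kernel H) {0..}"
  shows "\<exists>X\<in>coords. AE w in P. wiener_map v w = X w"
proof -
  obtain I c where v: "v = (\<lambda>r. \<Sum>t\<in>I. c t * kernel H t r)" "finite I" "I \<subseteq> {0..}"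
    using lin_spanE[OF assms] .
  have "AE w in P. wiener_map v w = (\<Sum>t\<in>I. c t * wiener_map (kernel H t) w)"
    unfolding v(1) using wiener_sum[of I "kernel H" c] kernel_L2 by simp
  moreover have "AE w in P. \<forall>t\<in>I. wiener_map (kernel H t) w = w t"
  proof (rule AE_finite_allI[OF v(2)])
    fix t assume "t \<in> I"
    then show "AE w in P. wiener_map (kernel H t) w = w t" using v(3) by (intro wiener_kernel) auto
  qed
  ultimately have "AE w in P. wiener_map v w = (\<Sum>t\<in>I. c t * w t)"
  proof eventually_elim
    case (elim w)
    then show ?case by (metis (no_types, lifting) sum.cong)
  qed
  moreover define X :: "(real \<Rightarrow> real) \<Rightarrow> real" where "X = (\<lambda>w. \<Sum>t\<in>I. c t * w t)"
  moreover have "X \<in> coords"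
    unfolding X_def by (rule lin_spanI[OF v(2,3), of c "\<lambda>t w. w t"])
  ultimately show ?thesis by (intro bexI[of _ X]) simp
qed

lemma wiener_approx:
  assumes f: "f \<in> L2_fun half_line"
  shows "\<exists>Y. (\<forall>n. Y n \<in> coords) \<and> (\<lambda>n. \<integral>w. (wiener_map f w - Y n w)\<^sup>2 \<partial>P) \<longlonglongrightarrow> 0"
proof -
  obtain v where v: "\<And>n. v n \<in> lin_span (kernel H) {0..}" and lim: "(\<lambda>n. \<integral>r. (f r - v n r)\<^sup>2 \<partial>half_line) \<longlonglongrightarrow> 0"
    using kernel_span_dense[OF f] by blast
  have vL: "v n \<in> L2_fun half_line" for n using lin_span_L2[OF kernel_L2 v] .
  have "\<forall>n. \<exists>X. X \<in> coords \<and> (AE w in P. wiener_map (v n) w = X w)"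
    using wiener_span[OF v] unfolding Bex_def by (rule allI)
  from choice[OF this] obtain Y where Y': "\<forall>n. Y n \<in> coords \<and> (AE w in P. wiener_map (v n) w = Y n w)" ..
  have Y: "Y n \<in> coords" "AE w in P. wiener_map (v n) w = Y n w" for n
    using Y'[rule_format, of n] by simp_all
  have "(\<integral>w. (wiener_map f w - Y n w)\<^sup>2 \<partial>P) = (\<integral>r. (f r - v n r)\<^sup>2 \<partial>half_line)" for n
  proof -
    have "(\<integral>w. (wiener_map f w - Y n w)\<^sup>2 \<partial>P) = (\<integral>w. (wiener_map (\<lambda>r. 1 * f r + (-1) * v n r) w)\<^sup>2 \<partial>P)"
    proof (rule integral_cong_AE)
      show "AE w in P. (wiener_map f w - Y n w)\<^sup>2 = (wiener_map (\<lambda>r. 1 * f r + (-1) * v n r) w)\<^sup>2"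
        using wiener_lincomb[OF f vL, of 1 "-1" n] Y(2)[of n] by eventually_elim simp
    qed (use L2_funD(1)[OF wiener_L2[OF f]] coords_measurable[OF Y(1)] L2_funD(1)[OF wiener_L2[OF L2_lincomb[OF f vL, of 1 "-1"]]] in auto)
    also have "\<dots> = (\<integral>r. (1 * f r + (-1) * v n r)\<^sup>2 \<partial>half_line)"
      by (rule wiener_norm[OF L2_lincomb[OF f vL]])
    finally show ?thesis by simp
  qed
  with lim Y(1) show ?thesis by (intro exI[of _ Y]) simp
qed

lemma bounded_L2: "X \<in> borel_measurable P \<Longrightarrow> (\<And>w. \<bar>X w\<bar> \<le> 1) \<Longrightarrow> X \<in> L2_fun P"
  unfolding L2_fun_def by (auto intro!: integrable_const_bound[of _ 1] simp: abs_square_le_1)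

text \<open>
  The formula holds for linear combinations of coordinates in place of \<open>wiener_map
  f\<close>. Both sides are continuous in that argument for convergence in
  \<open>L\<^sup>2\<close>, and \<open>wiener_map f\<close> is a limit of such combinations.
\<close>

lemma wiener_sin:
  assumes f: "f \<in> L2_fun half_line" and u: "\<And>i. 0 \<le> u i"
  shows "(\<integral>w. wiener_map f w * sin ((\<Sum>i<m. c i * w (u i)) + \<theta>) \<partial>P)
    = (\<Sum>i<m. c i * kernel_op H f (u i)) * (\<integral>w. cos ((\<Sum>i<m. c i * w (u i)) + \<theta>) \<partial>P)"
proof -
  define X where "X w = (\<Sum>i<m. c i * w (u i))" for w :: "real \<Rightarrow> real"
  have X: "X \<in> coords" unfolding X_def
    by (intro lin_span_sum lin_span_base[of _ _ "\<lambda>t w. w t"]) (simp add: u)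
  note Xm = coords_measurable[OF X]
  obtain Y where Y: "\<And>n. Y n \<in> coords" and lim: "(\<lambda>n. \<integral>w. (wiener_map f w - Y n w)\<^sup>2 \<partial>P) \<longlonglongrightarrow> 0"
    using wiener_approx[OF f] by blast
  have s: "(\<lambda>w. sin (X w + \<theta>)) \<in> L2_fun P" using Xm by (intro bounded_L2) auto
  have 1: "(\<lambda>n. \<integral>w. Y n w * sin (X w + \<theta>) \<partial>P) \<longlonglongrightarrow> (\<integral>w. wiener_map f w * sin (X w + \<theta>) \<partial>P)"
    by (rule L2_limit_mult[OF wiener_L2[OF f] s coords_L2[OF Y] lim])
  have "(\<lambda>n. \<integral>w. Y n w * X w \<partial>P) \<longlonglongrightarrow> (\<integral>w. wiener_map f w * X w \<partial>P)"
    by (rule L2_limit_mult[OF wiener_L2[OF f] coords_L2[OF X] coords_L2[OF Y] lim])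
  then have "(\<lambda>n. (\<integral>w. X w * Y n w \<partial>P) * (\<integral>w. cos (X w + \<theta>) \<partial>P)) \<longlonglongrightarrow> (\<integral>w. wiener_map f w * X w \<partial>P) * (\<integral>w. cos (X w + \<theta>) \<partial>P)"
    by (intro tendsto_intros) (simp add: mult.commute)
  with 1 have "(\<integral>w. wiener_map f w * sin (X w + \<theta>) \<partial>P) = (\<integral>w. wiener_map f w * X w \<partial>P) * (\<integral>w. cos (X w + \<theta>) \<partial>P)"
    unfolding coords_sin[OF X Y] by (rule LIMSEQ_unique)
  also have "(\<integral>w. wiener_map f w * X w \<partial>P) = (\<Sum>i<m. c i * kernel_op H f (u i))"
  proof -
    have "(\<integral>w. wiener_map f w * X w \<partial>P) = (\<integral>w. (\<Sum>i<m. c i * (w (u i) * wiener_map f w)) \<partial>P)"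
      unfolding X_def by (simp add: sum_distrib_left mult_ac)
    also have "\<dots> = (\<Sum>i<m. c i * (\<integral>w. w (u i) * wiener_map f w \<partial>P))"
      using L2_mult_integrable[OF coord_L2[OF u] wiener_L2[OF f]] by (subst Bochner_Integration.integral_sum) auto
    finally show ?thesis using wiener_coord[OF f u] by simp
  qed
  finally show ?thesis unfolding X_def .
qed

lemma indicator_L2: "indicator {0..t} \<in> L2_fun half_line" for t :: real
proof (rule L2_half_lineI)
  have "(\<lambda>x. (indicator {0..t} x)\<^sup>2 :: real) = indicator {0..t}" by (auto simp: indicator_def)
  then show "integrable lborel (\<lambda>x. (indicator {0..t} x)\<^sup>2 :: real)"
    by (auto intro!: integrable_real_indicator simp: emeasure_lborel_Icc_eq)
qed auto

text \<open>
  On the half-line the indicator of \<open>(s\<^sub>i, s\<^sub>i\<^sub>+\<^sub>1]\<close> is a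
  difference of indicators of intervals starting at \<open>0\<close>, whose images are values of
  \<open>B\<close>.
\<close>

lemma wiener_step_fun:
  assumes B: "continuous_version P (\<lambda>t. \<delta> (kernel_op H (indicator {0..t}))) B"
    and s: "0 \<le> s 0" "mono s"
  shows "step_fun n s c \<in> L2_fun half_line"
    and "AE w in P. wiener_map (step_fun n s c) w = step_integral B n s c w"
proof -
  define g where "g r = (\<Sum>i<n. c i * (1 * indicator {0..s (Suc i)} r + (-1) * indicator {0..s i} r))" for r :: real
  have si: "0 \<le> s i" for i using s monoD[OF s(2), of 0 i] by simp
  have eq: "indicator {s i<..s (Suc i)} r = (1 * indicator {0..s (Suc i)} r + (-1) * indicator {0..s i} r :: real)" if "0 \<le> r" for r :: real and i
    using that si[of i] monoD[OF s(2), of i "Suc i"] by (auto simp: indicator_def)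
  have gL: "g \<in> L2_fun half_line" unfolding g_def[abs_def]
    by (intro L2_sum L2_lincomb indicator_L2)
  have geq: "step_fun n s c r = g r" if "0 \<le> r" for r
    unfolding step_fun_def g_def by (simp only: eq[OF that])
  have AEeq: "AE r in half_line. step_fun n s c r = g r"
    unfolding AE_half_line using geq by auto
  have sm: "step_fun n s c \<in> borel_measurable half_line"
    unfolding step_fun_def[abs_def] by (intro measurable_restrict_space1) measurable
  have "integrable half_line (\<lambda>r. (step_fun n s c r)\<^sup>2)"
    by (rule integrable_cong_AE_imp[OF L2_funD(2)[OF gL]]) (use sm AEeq in \<open>auto elim: eventually_mono\<close>)
  then show sL: "step_fun n s c \<in> L2_fun half_line" using sm by (simp add: L2_fun_def)
  have Bt: "AE w in P. wiener_map (indicator {0..t}) w = B t w" if "0 \<le> t" for t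
    using B that unfolding continuous_version_def wiener_map_def by (auto elim: eventually_mono)
  have 1: "AE w in P. wiener_map g w = (\<Sum>i<n. c i * wiener_map (\<lambda>r. 1 * indicator {0..s (Suc i)} r + (-1) * indicator {0..s i} r) w)"
    unfolding g_def[abs_def] by (intro wiener_sum L2_lincomb indicator_L2)
  have 2: "AE w in P. \<forall>i\<in>{..<n}. wiener_map (\<lambda>r. 1 * indicator {0..s (Suc i)} r + (-1) * indicator {0..s i} r) w = B (s (Suc i)) w - B (s i) w"
  proof (rule AE_finite_allI)
    fix i
    show "AE w in P. wiener_map (\<lambda>r. 1 * indicator {0..s (Suc i)} r + (-1) * indicator {0..s i} r) w = B (s (Suc i)) w - B (s i) w"
      using wiener_lincomb[OF indicator_L2 indicator_L2, of 1 "s (Suc i)" "-1" "s i"] Bt[OF si[of i]] Bt[OF si[of "Suc i"]]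
      by eventually_elim simp
  qed simp
  have W: "wiener_map (step_fun n s c) = wiener_map g"
    unfolding wiener_map_def using kernel_op_cong_AE[OF sL gL AEeq] by simp
  show "AE w in P. wiener_map (step_fun n s c) w = step_integral B n s c w"
    unfolding W using 1 2 by eventually_elim (simp add: step_integral_def)
qed

text \<open>
  For step functions the two integrals agree, and both sides are \<open>L\<^sup>2\<close> limits
  of the same step integrals.
\<close>

lemma wiener_integral_eq_wiener:
  assumes B: "continuous_version P (\<lambda>t. \<delta> (kernel_op H (indicator {0..t}))) B"
    and f: "f \<in> L2_fun half_line" and X: "wiener_integral P B f X"
  shows "AE w in P. X w = wiener_map f w"
proof -
  obtain n s c where s: "\<And>k. 0 \<le> s k 0 \<and> mono (s k)"
    and l1: "(\<lambda>k. \<integral>\<^sup>+r. ennreal ((f r - step_fun (n k) (s k) (c k) r)\<^sup>2) \<partial>half_line) \<longlonglongrightarrow> 0"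
    and l2: "(\<lambda>k. \<integral>\<^sup>+\<omega>. ennreal ((X \<omega> - step_integral B (n k) (s k) (c k) \<omega>)\<^sup>2) \<partial>P) \<longlonglongrightarrow> 0"
    using X unfolding wiener_integral_def by blast
  have Xm[measurable]: "X \<in> borel_measurable P" using X by (simp add: wiener_integral_def)
  have Wm[measurable]: "wiener_map f \<in> borel_measurable P" using wiener_L2[OF f] by (simp add: L2_fun_def)
  define S where "S k = step_fun (n k) (s k) (c k)" for k
  define J where "J k = step_integral B (n k) (s k) (c k)" for k
  have SL: "S k \<in> L2_fun half_line" and SJ: "AE w in P. wiener_map (S k) w = J k w" for k
    using wiener_step_fun[OF B, of "s k" "n k" "c k"] s[of k] by (auto simp: S_def J_def)
  have Jm[measurable]: "J k \<in> borel_measurable P" for k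
  proof -
    have "0 \<le> s k i" for i using s[of k] monoD[of "s k" 0 i] by (metis le0 order_trans)
    then show ?thesis using B unfolding J_def step_integral_def[abs_def] continuous_version_def continuous_paths_def
      by (intro borel_measurable_sum borel_measurable_times borel_measurable_diff) auto
  qed
  have W: "(\<integral>\<^sup>+w. ennreal ((wiener_map f w - J k w)\<^sup>2) \<partial>P) = (\<integral>\<^sup>+r. ennreal ((f r - S k r)\<^sup>2) \<partial>half_line)" for k
  proof -
    have "(\<integral>\<^sup>+w. ennreal ((wiener_map f w - J k w)\<^sup>2) \<partial>P) = (\<integral>\<^sup>+w. ennreal ((wiener_map (\<lambda>r. 1 * f r + (-1) * S k r) w)\<^sup>2) \<partial>P)"
    proof (rule nn_integral_cong_AE)
      show "AE w in P. ennreal ((wiener_map f w - J k w)\<^sup>2) = ennreal ((wiener_map (\<lambda>r. 1 * f r + (-1) * S k r) w)\<^sup>2)"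
        using wiener_lincomb[OF f SL, of 1 "-1" k] SJ[of k] by eventually_elim simp
    qed
    also have "\<dots> = (\<integral>\<^sup>+r. ennreal ((1 * f r + (-1) * S k r)\<^sup>2) \<partial>half_line)"
      unfolding L2_nn_integral[OF wiener_L2[OF L2_lincomb[OF f SL]]] L2_nn_integral[OF L2_lincomb[OF f SL]] wiener_norm[OF L2_lincomb[OF f SL]] ..
    finally show ?thesis by simp
  qed
  have "(\<integral>\<^sup>+w. ennreal ((X w - wiener_map f w)\<^sup>2) \<partial>P) \<le> 2 * (\<integral>\<^sup>+w. ennreal ((X w - J k w)\<^sup>2) \<partial>P) + 2 * (\<integral>\<^sup>+r. ennreal ((f r - S k r)\<^sup>2) \<partial>half_line)" for k
  proof -
    have "(\<integral>\<^sup>+w. ennreal ((X w - wiener_map f w)\<^sup>2) \<partial>P) \<le> (\<integral>\<^sup>+w. 2 * ennreal ((X w - J k w)\<^sup>2) + 2 * ennreal ((wiener_map f w - J k w)\<^sup>2) \<partial>P)"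
    proof (rule nn_integral_mono)
      fix w
      have "(X w - wiener_map f w)\<^sup>2 \<le> 2 * (X w - J k w)\<^sup>2 + 2 * (wiener_map f w - J k w)\<^sup>2"
        using square_add_le[of "X w - J k w" "J k w - wiener_map f w"] by (simp add: power2_commute)
      then have "ennreal ((X w - wiener_map f w)\<^sup>2) \<le> ennreal (2 * (X w - J k w)\<^sup>2 + 2 * (wiener_map f w - J k w)\<^sup>2)"
        by (rule ennreal_leI)
      then show "ennreal ((X w - wiener_map f w)\<^sup>2) \<le> 2 * ennreal ((X w - J k w)\<^sup>2) + 2 * ennreal ((wiener_map f w - J k w)\<^sup>2)"
        by (simp add: ennreal_mult)
    qed
    also have "\<dots> = 2 * (\<integral>\<^sup>+w. ennreal ((X w - J k w)\<^sup>2) \<partial>P) + 2 * (\<integral>\<^sup>+w. ennreal ((wiener_map f w - J k w)\<^sup>2) \<partial>P)"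
      by (subst nn_integral_add) (auto simp: nn_integral_cmult)
    finally show ?thesis unfolding W .
  qed
  note bound = this
  have "(\<lambda>k. 2 * (\<integral>\<^sup>+w. ennreal ((X w - J k w)\<^sup>2) \<partial>P) + 2 * (\<integral>\<^sup>+r. ennreal ((f r - S k r)\<^sup>2) \<partial>half_line)) \<longlonglongrightarrow> 2 * 0 + 2 * 0"
    using l1 l2 unfolding S_def J_def by (intro tendsto_add ennreal_tendsto_cmult) auto
  then have "(\<integral>\<^sup>+w. ennreal ((X w - wiener_map f w)\<^sup>2) \<partial>P) \<le> 2 * 0 + 2 * 0"
    by (rule tendsto_lowerbound) (use bound in auto)
  then have "(\<integral>\<^sup>+w. ennreal ((X w - wiener_map f w)\<^sup>2) \<partial>P) = 0" by simp
  then have "AE w in P. ennreal ((X w - wiener_map f w)\<^sup>2) = 0"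
    by (subst (asm) nn_integral_0_iff_AE) auto
  then show ?thesis by eventually_elim simp
qed

end

section \<open>Trigonometric polynomials in countably many variables\<close>

inductive_set trig_polys :: "((nat \<Rightarrow> real) \<Rightarrow> real) set" where
  trig_cos: "(\<lambda>x. k * cos ((\<Sum>i<m. c i * x i) + \<theta>)) \<in> trig_polys"
| trig_add: "p \<in> trig_polys \<Longrightarrow> q \<in> trig_polys \<Longrightarrow> (\<lambda>x. p x + q x) \<in> trig_polys"

lemma trig_const: "(\<lambda>x. k) \<in> trig_polys"
  using trig_cos[where k = k and m = 0 and \<theta> = 0] by simp

lemma trig_sin: "(\<lambda>x. sin (x j / L)) \<in> trig_polys"
proof -
  have "(\<Sum>i<Suc j. (if i = j then 1 / L else 0) * x i) = x j / L" for x :: "nat \<Rightarrow> real"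
    by (subst sum.remove[of _ j]) (auto intro!: sum.neutral)
  then show ?thesis
    using trig_cos[where k = 1 and m = "Suc j" and c = "\<lambda>i. if i = j then 1 / L else 0" and \<theta> = "- pi/2"]
    by (simp add: cos_diff del: sum.lessThan_Suc)
qed

text \<open>
  \<open>2 cos A cos B = cos (A - B) + cos (A + B)\<close>, after padding the two coefficient
  vectors to a common length.
\<close>

lemma trig_cos_mult: "(\<lambda>x. (k * cos ((\<Sum>i<m. c i * x i) + \<theta>)) * (l * cos ((\<Sum>i<n. d i * x i) + \<eta>))) \<in> trig_polys"
proof -
  define M where "M = max m n"
  define c' where "c' i = (if i < m then c i else 0)" for i
  define d' where "d' i = (if i < n then d i else 0)" for i
  have 1: "(\<Sum>i<m. c i * x i) = (\<Sum>i<M. c' i * x i)" "(\<Sum>i<n. d i * x i) = (\<Sum>i<M. d' i * x i)" for x :: "nat \<Rightarrow> real"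
    unfolding c'_def d'_def M_def by (auto intro!: sum.mono_neutral_cong_left split: if_splits)
  have "(\<lambda>x. (k * l / 2) * cos ((\<Sum>i<M. (c' i - d' i) * x i) + (\<theta> - \<eta>)) + (k * l / 2) * cos ((\<Sum>i<M. (c' i + d' i) * x i) + (\<theta> + \<eta>))) \<in> trig_polys"
    by (intro trig_add trig_cos)
  also have "(\<lambda>x. (k * l / 2) * cos ((\<Sum>i<M. (c' i - d' i) * x i) + (\<theta> - \<eta>)) + (k * l / 2) * cos ((\<Sum>i<M. (c' i + d' i) * x i) + (\<theta> + \<eta>)))
     = (\<lambda>x. (k * cos ((\<Sum>i<m. c i * x i) + \<theta>)) * (l * cos ((\<Sum>i<n. d i * x i) + \<eta>)))"
  proof
    fix x :: "nat \<Rightarrow> real"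
    define A B where "A = (\<Sum>i<M. c' i * x i) + \<theta>" and "B = (\<Sum>i<M. d' i * x i) + \<eta>"
    have AB: "(\<Sum>i<M. (c' i - d' i) * x i) + (\<theta> - \<eta>) = A - B" "(\<Sum>i<M. (c' i + d' i) * x i) + (\<theta> + \<eta>) = A + B"
      by (simp_all add: A_def B_def left_diff_distrib distrib_right sum_subtractf sum.distrib)
    show "(k * l / 2) * cos ((\<Sum>i<M. (c' i - d' i) * x i) + (\<theta> - \<eta>)) + (k * l / 2) * cos ((\<Sum>i<M. (c' i + d' i) * x i) + (\<theta> + \<eta>))
      = (k * cos ((\<Sum>i<m. c i * x i) + \<theta>)) * (l * cos ((\<Sum>i<n. d i * x i) + \<eta>))"
      unfolding 1 AB unfolding A_def[symmetric] B_def[symmetric] by (simp add: cos_diff cos_add algebra_simps)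
  qed
  finally show ?thesis .
qed

lemma trig_mult: "p \<in> trig_polys \<Longrightarrow> q \<in> trig_polys \<Longrightarrow> (\<lambda>x. p x * q x) \<in> trig_polys"
proof (induction p rule: trig_polys.induct)
  case (trig_cos k c m \<theta>)
  then show ?case
  proof (induction q rule: trig_polys.induct)
    case (trig_cos l d n \<eta>)
    show ?case by (rule trig_cos_mult)
  next
    case (trig_add p q)
    from trig_polys.trig_add[OF trig_add.IH] show ?case by (simp only: distrib_left)
  qed
next
  case (trig_add p q')
  from trig_polys.trig_add[OF trig_add.IH[OF trig_add.prems]] show ?case by (simp only: distrib_right)
qed

lemma trig_bounded: "p \<in> trig_polys \<Longrightarrow> \<exists>K. \<forall>x. \<bar>p x\<bar> \<le> K"
proof (induction rule: trig_polys.induct)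
  case (trig_cos k c m \<theta>)
  then show ?case by (auto intro!: exI[of _ "\<bar>k\<bar>"] mult_left_le simp: abs_mult)
next
  case (trig_add p q)
  then obtain K L where "\<forall>x. \<bar>p x\<bar> \<le> K" "\<forall>x. \<bar>q x\<bar> \<le> L" by blast
  then have "\<bar>p x + q x\<bar> \<le> K + L" for x
    using abs_triangle_ineq[of "p x" "q x"] by (metis add_mono order_trans)
  then show ?case by blast
qed

lemma trig_continuous: "p \<in> trig_polys \<Longrightarrow> continuous_on UNIV p"
  by (induction rule: trig_polys.induct)
     (intro continuous_intros continuous_on_product_then_coordinatewise[OF continuous_on_id, simplified id_def]; simp)+

lemma compact_cube: "compact {y :: nat \<Rightarrow> real. \<forall>i. y i \<in> {-1..1}}"
proof -
  have "compactin (product_topology (\<lambda>_::nat. euclideanreal) UNIV) (PiE UNIV (\<lambda>_. {-1..1}))"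
    by (subst compactin_PiE) auto
  moreover have "PiE UNIV (\<lambda>_. {-1..1}) = {y :: nat \<Rightarrow> real. \<forall>i. y i \<in> {-1..1}}"
    by (auto simp: PiE_def Pi_def)
  ultimately show ?thesis
    by (simp only: euclidean_product_topology compactin_euclidean_iff)
qed

lemma tendsto_coordinatewise:
  fixes x :: "nat \<Rightarrow> real"
  assumes \<Phi>: "continuous_on UNIV \<Phi>" and lim: "\<And>i. ((\<lambda>n. y n i) \<longlongrightarrow> x i) F"
  shows "((\<lambda>n. \<Phi> (y n)) \<longlongrightarrow> \<Phi> x) F"
proof -
  have "(y \<longlongrightarrow> x) F"
    using lim limitin_componentwise[of "\<lambda>_::nat. euclideanreal" UNIV y x F]
    unfolding euclidean_product_topology by simp
  then show ?thesis
    using \<Phi> continuous_on_tendsto_compose[OF \<Phi>] by auto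
qed

lemma scaled_sin_tendsto: "(\<lambda>n. real (Suc n) * sin (x / real (Suc n))) \<longlonglongrightarrow> x"
proof -
  have "((\<lambda>e. sin (x * e)) has_real_derivative x) (at 0)"
    by (auto intro!: derivative_eq_intros)
  then have "((\<lambda>e. sin (x * e) / e) \<longlongrightarrow> x) (at 0)" by (simp add: DERIV_def)
  moreover have "filterlim (\<lambda>n. 1 / real (Suc n)) (at 0) sequentially"
    unfolding filterlim_at using LIMSEQ_inverse_real_of_nat by (auto simp: inverse_eq_divide)
  ultimately have "(\<lambda>n. sin (x * (1 / real (Suc n))) / (1 / real (Suc n))) \<longlonglongrightarrow> x"
    by (rule filterlim_compose)
  then show ?thesis by (simp add: mult.commute)
qed

text \<open>
  Every polynomial in the variables \<open>sin (x\<^sub>i / L)\<close> is a trigonometric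
  polynomial, and the values of these variables lie in the compact cube \<open>[-1,
  1]\<^sup>\<nat>\<close>. So Stone-Weierstrass on the cube approximates \<open>\<Phi>(L sin(x /
  L))\<close> uniformly in all \<open>x\<close>, although the space of all \<open>x\<close> is not
  compact.
\<close>

lemma trig_approx_step:
  assumes \<Phi>: "continuous_on UNIV \<Phi>" and e: "0 < e"
  shows "\<exists>p\<in>trig_polys. \<forall>x. \<bar>\<Phi> (\<lambda>i. L * sin (x i / L)) - p x\<bar> < e"
proof -
  define S where "S = {y :: nat \<Rightarrow> real. \<forall>i. y i \<in> {-1..1}}"
  define R where "R = {P. continuous_on S P \<and> (\<lambda>x. P (\<lambda>i. sin (x i / L))) \<in> trig_polys}"
  interpret function_ring_on R S
  proof
    show "compact S" unfolding S_def by (rule compact_cube)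
    show "f \<in> R \<Longrightarrow> continuous_on S f" for f by (simp add: R_def)
    show "f \<in> R \<Longrightarrow> g \<in> R \<Longrightarrow> (\<lambda>x. f x + g x) \<in> R" for f g
      by (auto simp: R_def intro!: continuous_intros trig_add)
    show "f \<in> R \<Longrightarrow> g \<in> R \<Longrightarrow> (\<lambda>x. f x * g x) \<in> R" for f g
      by (auto simp: R_def intro!: continuous_intros trig_mult)
    show "(\<lambda>_. c) \<in> R" for c by (auto simp: R_def trig_const)
    show "\<exists>f\<in>R. f x \<noteq> f y" if "x \<noteq> y" for x y
    proof -
      from that have "\<exists>j. x j \<noteq> y j" by (simp add: fun_eq_iff)
      then obtain j where "x j \<noteq> y j" ..
      moreover have "continuous_on S (\<lambda>y. y j)"
        by (rule continuous_on_product_then_coordinatewise) (rule continuous_on_id)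
      then have "(\<lambda>y. y j) \<in> R" using trig_sin[of j L] by (simp add: R_def)
      ultimately show ?thesis by (intro bexI[of _ "\<lambda>y. y j"])
    qed
  qed
  have "continuous_on S (\<lambda>y. \<Phi> (\<lambda>i. L * y i))"
  proof (rule continuous_on_compose2[OF \<Phi>])
    show "continuous_on S (\<lambda>y i. L * y i)"
      by (intro continuous_on_coordinatewise_then_product continuous_on_mult continuous_on_const
          continuous_on_product_then_coordinatewise[OF continuous_on_id])
  qed auto
  from Stone_Weierstrass_basic[OF this e]
  obtain g where g: "g \<in> R" "\<And>y. y \<in> S \<Longrightarrow> \<bar>\<Phi> (\<lambda>i. L * y i) - g y\<bar> < e" by blast
  have "(\<lambda>i. sin (x i / L)) \<in> S" for x by (simp add: S_def)
  from g(2)[OF this] g(1) show ?thesis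
    unfolding R_def by (intro bexI[of _ "\<lambda>x. g (\<lambda>i. sin (x i / L))"]) auto
qed

text \<open>
  Since \<open>L sin(x / L)\<close> tends to \<open>x\<close> as \<open>L\<close> grows,
  \<open>\<Phi>(L sin(x / L))\<close> tends to \<open>\<Phi>(x)\<close> with the bound on
  \<open>\<Phi>\<close> preserved.
\<close>

lemma trig_approx:
  assumes \<Phi>: "continuous_on UNIV \<Phi>" and K: "\<And>x. \<bar>\<Phi> x\<bar> \<le> K"
  shows "\<exists>p. (\<forall>n. p n \<in> trig_polys) \<and> (\<forall>n x. \<bar>p n x\<bar> \<le> K + 1) \<and> (\<forall>x. (\<lambda>n. p n x) \<longlonglongrightarrow> \<Phi> x)"
proof -
  have "\<forall>n. \<exists>p. p \<in> trig_polys \<and> (\<forall>x. \<bar>\<Phi> (\<lambda>i. real (Suc n) * sin (x i / real (Suc n))) - p x\<bar> < 1 / real (Suc n))"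
    using trig_approx_step[OF \<Phi>, of "1 / real (Suc n)" "real (Suc n)" for n] unfolding Bex_def by simp
  from choice[OF this] obtain p where p': "\<forall>n. p n \<in> trig_polys \<and> (\<forall>x. \<bar>\<Phi> (\<lambda>i. real (Suc n) * sin (x i / real (Suc n))) - p n x\<bar> < 1 / real (Suc n))" ..
  have p: "p n \<in> trig_polys" "\<bar>\<Phi> (\<lambda>i. real (Suc n) * sin (x i / real (Suc n))) - p n x\<bar> < 1 / real (Suc n)" for n x
    using p'[rule_format, of n] by blast+
  have "\<bar>p n x\<bar> \<le> K + 1" for n x
  proof -
    have "1 / real (Suc n) \<le> 1" by simp
    then show ?thesis using p(2)[of n x] K[of "\<lambda>i. real (Suc n) * sin (x i / real (Suc n))"] by linarith
  qed
  moreover have "(\<lambda>n. p n x) \<longlonglongrightarrow> \<Phi> x" for x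
  proof -
    have l: "(\<lambda>n. \<Phi> (\<lambda>i. real (Suc n) * sin (x i / real (Suc n)))) \<longlonglongrightarrow> \<Phi> x"
      by (rule tendsto_coordinatewise[OF \<Phi> scaled_sin_tendsto])
    have "(\<lambda>n. \<Phi> (\<lambda>i. real (Suc n) * sin (x i / real (Suc n))) - p n x) \<longlonglongrightarrow> 0"
    proof (rule Lim_null_comparison)
      show "\<forall>\<^sub>F n in sequentially. norm (\<Phi> (\<lambda>i. real (Suc n) * sin (x i / real (Suc n))) - p n x) \<le> 1 / real (Suc n)"
        using p(2)[THEN less_imp_le] by (simp del: of_nat_Suc)
      show "(\<lambda>n. 1 / real (Suc n)) \<longlonglongrightarrow> 0"
        using LIMSEQ_inverse_real_of_nat by (simp add: inverse_eq_divide)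
    qed
    from tendsto_diff[OF l this] show ?thesis by simp
  qed
  ultimately show ?thesis using p(1) by (intro exI[of _ p]) simp
qed

section \<open>From trigonometric polynomials to bounded continuous functions\<close>

text \<open>
  The mean of \<open>\<Phi>\<close> over the segment from \<open>x\<close> to \<open>x +
  \<epsilon> a\<close>. For smooth \<open>\<Phi>\<close> the mean of its derivative in direction
  \<open>a\<close> is the difference quotient, which is why a formula for averages involves no
  derivatives.
\<close>

definition segment_avg :: "(nat \<Rightarrow> real) \<Rightarrow> ((nat \<Rightarrow> real) \<Rightarrow> real) \<Rightarrow> real \<Rightarrow> (nat \<Rightarrow> real) \<Rightarrow> real" where
  "segment_avg a \<Phi> \<epsilon> x = (\<integral>s. indicator {0..1} s * \<Phi> (\<lambda>i. x i + \<epsilon> * s * a i) \<partial>lborel)"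

lemma line_continuous:
  fixes \<Phi> :: "(nat \<Rightarrow> real) \<Rightarrow> real"
  assumes "continuous_on UNIV \<Phi>"
  shows "continuous_on UNIV (\<lambda>s. \<Phi> (\<lambda>i. x i + \<epsilon> * s * a i))"
proof (rule continuous_on_compose2[OF assms])
  show "continuous_on UNIV (\<lambda>s i. x i + \<epsilon> * s * a i)"
    by (intro continuous_on_coordinatewise_then_product continuous_on_add continuous_on_mult
        continuous_on_const continuous_on_id)
qed auto

lemma line_integrable:
  fixes \<Phi> :: "(nat \<Rightarrow> real) \<Rightarrow> real"
  assumes \<Phi>: "continuous_on UNIV \<Phi>" and K: "\<And>x. \<bar>\<Phi> x\<bar> \<le> K"
  shows "integrable lborel (\<lambda>s. indicator {0..1} s * \<Phi> (\<lambda>i. x i + \<epsilon> * s * a i))"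
proof (rule Bochner_Integration.integrable_bound[of lborel "\<lambda>s. K * indicator {0..1} s"])
  show "integrable lborel (\<lambda>s::real. K * indicator {0..1} s)"
    by (intro integrable_mult_right integrable_real_indicator) (auto simp: emeasure_lborel_Icc_eq)
  have [measurable]: "(\<lambda>s. \<Phi> (\<lambda>i. x i + \<epsilon> * s * a i)) \<in> borel_measurable borel"
    by (rule borel_measurable_continuous_onI[OF line_continuous[OF \<Phi>]])
  show "(\<lambda>s. indicator {0..1} s * \<Phi> (\<lambda>i. x i + \<epsilon> * s * a i)) \<in> borel_measurable lborel"
    by measurable
  show "AE s in lborel. norm (indicator {0..1} s * \<Phi> (\<lambda>i. x i + \<epsilon> * s * a i)) \<le> norm (K * indicator {0..1} s)"
    using K by (auto simp: indicator_def intro!: AE_I2 order_trans[OF K])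
qed

lemma segment_avg_bounded:
  fixes \<Phi> :: "(nat \<Rightarrow> real) \<Rightarrow> real"
  assumes \<Phi>: "continuous_on UNIV \<Phi>" and K: "\<And>x. \<bar>\<Phi> x\<bar> \<le> K"
  shows "\<bar>segment_avg a \<Phi> \<epsilon> x\<bar> \<le> K"
proof -
  have i: "integrable lborel (\<lambda>s::real. K * indicator {0..1} s)"
    by (intro integrable_mult_right integrable_real_indicator) (auto simp: emeasure_lborel_Icc_eq)
  have "\<bar>segment_avg a \<Phi> \<epsilon> x\<bar> \<le> (\<integral>s. \<bar>indicator {0..1} s * \<Phi> (\<lambda>i. x i + \<epsilon> * s * a i)\<bar> \<partial>lborel)"
    unfolding segment_avg_def by (rule integral_abs_bound)
  also have "\<dots> \<le> (\<integral>s. K * indicator {0..1} s \<partial>(lborel :: real measure))"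
  proof (rule Bochner_Integration.integral_mono)
    show "integrable lborel (\<lambda>s. \<bar>indicator {0..1} s * \<Phi> (\<lambda>i. x i + \<epsilon> * s * a i)\<bar>)"
      using line_integrable[OF \<Phi> K, of x \<epsilon> a] by (rule integrable_abs)
    show "integrable lborel (\<lambda>s::real. K * indicator {0..1} s)" by (rule i)
    show "\<bar>indicator {0..1} s * \<Phi> (\<lambda>i. x i + \<epsilon> * s * a i)\<bar> \<le> K * indicator {0..1} s" for s
      by (simp add: indicator_def K)
  qed
  also have "\<dots> = K" by simp
  finally show ?thesis .
qed

lemma abs_mult_le: "\<bar>l\<bar> \<le> K \<Longrightarrow> \<bar>y * l\<bar> \<le> K * \<bar>y\<bar>" for l K y :: real
  unfolding abs_mult by (subst mult.commute) (rule mult_right_mono, auto)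

lemma segment_avg_limit:
  fixes p :: "nat \<Rightarrow> (nat \<Rightarrow> real) \<Rightarrow> real" and q :: "real \<Rightarrow> real"
  assumes c: "\<And>n. continuous_on UNIV (p n)" and K: "\<And>n x. \<bar>p n x\<bar> \<le> K"
    and lim: "\<And>s. 0 \<le> s \<Longrightarrow> s \<le> 1 \<Longrightarrow> (\<lambda>n. p n (\<lambda>i. x i + e n * s * a i)) \<longlonglongrightarrow> q s"
    and q: "q \<in> borel_measurable borel"
  shows "(\<lambda>n. segment_avg a (p n) (e n) x) \<longlonglongrightarrow> (\<integral>s. indicator {0..1} s * q s \<partial>lborel)"
  unfolding segment_avg_def
proof (rule integral_dominated_convergence[where w="\<lambda>s. K * indicator {0..1} s"])
  show "integrable lborel (\<lambda>s::real. K * indicator {0..1} s)"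
    by (intro integrable_mult_right integrable_real_indicator) (auto simp: emeasure_lborel_Icc_eq)
  show "(\<lambda>s. indicator {0..1} s * q s) \<in> borel_measurable lborel" using q by measurable
  show "(\<lambda>s. indicator {0..1} s * p n (\<lambda>i. x i + e n * s * a i)) \<in> borel_measurable lborel" for n
    using line_integrable[OF c K] by (rule borel_measurable_integrable)
  show "AE s in lborel. (\<lambda>n. indicator {0..1} s * p n (\<lambda>i. x i + e n * s * a i)) \<longlonglongrightarrow> indicator {0..1} s * q s"
    using lim by (auto intro!: AE_I2 simp: indicator_def)
  show "AE s in lborel. norm (indicator {0..1} s * p n (\<lambda>i. x i + e n * s * a i)) \<le> K * indicator {0..1} s" for n
    using K by (auto simp: indicator_def intro!: AE_I2)
qed

lemma segment_avg_cos:
  assumes e: "\<epsilon> \<noteq> 0" and \<alpha>_def: "\<alpha> = (\<Sum>i<m. c i * a i)"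
  shows "segment_avg a (\<lambda>x. k * cos ((\<Sum>i<m. c i * x i) + \<theta>)) \<epsilon> x =
    (if \<alpha> = 0 then k * cos ((\<Sum>i<m. c i * x i) + \<theta>)
     else k * (sin ((\<Sum>i<m. c i * x i) + (\<theta> + \<epsilon> * \<alpha>)) - sin ((\<Sum>i<m. c i * x i) + \<theta>)) / (\<epsilon> * \<alpha>))"
proof -
  define A where "A = (\<Sum>i<m. c i * x i) + \<theta>"
  have A: "(\<Sum>i<m. c i * (x i + \<epsilon> * s * a i)) + \<theta> = A + \<epsilon> * s * \<alpha>" for s
    by (simp add: A_def \<alpha>_def distrib_left sum.distrib sum_distrib_left mult_ac)
  have I: "segment_avg a (\<lambda>x. k * cos ((\<Sum>i<m. c i * x i) + \<theta>)) \<epsilon> x = (\<integral>s. indicator {0..1} s *\<^sub>R (k * cos (A + \<epsilon> * s * \<alpha>)) \<partial>lborel)"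
    unfolding segment_avg_def A by simp
  show ?thesis
  proof (cases "\<alpha> = 0")
    case True
    then show ?thesis unfolding I by (simp add: A_def)
  next
    case False
    have "(\<integral>s. indicator {0..1} s *\<^sub>R (k * cos (A + \<epsilon> * s * \<alpha>)) \<partial>lborel)
      = k * sin (A + \<epsilon> * 1 * \<alpha>) / (\<epsilon> * \<alpha>) - k * sin (A + \<epsilon> * 0 * \<alpha>) / (\<epsilon> * \<alpha>)"
    proof (rule integral_FTC_atLeastAtMost)
      fix s :: real
      have "((\<lambda>s. k * sin (A + \<epsilon> * s * \<alpha>) / (\<epsilon> * \<alpha>)) has_real_derivative (k * cos (A + \<epsilon> * s * \<alpha>))) (at s within {0..1})"
        using e False by (auto intro!: derivative_eq_intros)
      then show "((\<lambda>s. k * sin (A + \<epsilon> * s * \<alpha>) / (\<epsilon> * \<alpha>)) has_vector_derivative (k * cos (A + \<epsilon> * s * \<alpha>))) (at s within {0..1})"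
        by (simp add: has_real_derivative_iff_has_vector_derivative)
    qed (auto intro!: continuous_intros)
    then show ?thesis unfolding I using False by (simp add: A_def right_diff_distrib diff_divide_distrib add_ac)
  qed
qed

context prob_space
begin

lemma trig_measurable:
  assumes [measurable]: "\<And>i. X i \<in> borel_measurable M"
  shows "p \<in> trig_polys \<Longrightarrow> (\<lambda>\<omega>. p (\<lambda>i. X i \<omega> + b i)) \<in> borel_measurable M"
  by (induction rule: trig_polys.induct) measurable

text \<open>
  The integration by parts formula, averaged over the segment. For \<open>cos\<close> the average
  is a difference of two sines divided by \<open>\<epsilon> \<alpha>\<close>, where
  \<open>\<alpha>\<close> is the covariance of \<open>Y\<close> with the linear form; the factor
  \<open>\<alpha>\<close> produced by the hypothesis cancels this denominator. If \<open>\<alpha>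
  = 0\<close>, both sides vanish.
\<close>

lemma trig_shift:
  fixes X :: "nat \<Rightarrow> 'a \<Rightarrow> real" and a :: "nat \<Rightarrow> real"
  assumes [measurable]: "\<And>i. X i \<in> borel_measurable M" and Y: "integrable M Y"
    and sin: "\<And>m c \<theta>. (\<integral>\<omega>. Y \<omega> * sin ((\<Sum>i<m. c i * X i \<omega>) + \<theta>) \<partial>M)
       = (\<Sum>i<m. c i * a i) * (\<integral>\<omega>. cos ((\<Sum>i<m. c i * X i \<omega>) + \<theta>) \<partial>M)"
    and e: "\<epsilon> \<noteq> 0" and p: "p \<in> trig_polys"
  shows "(\<lambda>\<omega>. segment_avg a p \<epsilon> (\<lambda>i. X i \<omega>)) \<in> borel_measurable M \<and>
    (\<integral>\<omega>. Y \<omega> * segment_avg a p \<epsilon> (\<lambda>i. X i \<omega>) \<partial>M) = (\<integral>\<omega>. (p (\<lambda>i. X i \<omega> + \<epsilon> * a i) - p (\<lambda>i. X i \<omega>)) / \<epsilon> \<partial>M)"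
  using p
proof (induction rule: trig_polys.induct)
  case (trig_cos k c m \<theta>)
  have [measurable]: "Y \<in> borel_measurable M" using Y by auto
  define \<alpha> where "\<alpha> = (\<Sum>i<m. c i * a i)"
  define A where "A \<omega> = (\<Sum>i<m. c i * X i \<omega>)" for \<omega>
  have [measurable]: "A \<in> borel_measurable M" unfolding A_def[abs_def] by measurable
  have A': "(\<Sum>i<m. c i * (X i \<omega> + \<epsilon> * a i)) + \<theta> = A \<omega> + (\<theta> + \<epsilon> * \<alpha>)" for \<omega>
    by (simp add: A_def \<alpha>_def distrib_left sum.distrib sum_distrib_left mult_ac)
  have S: "(\<integral>\<omega>. Y \<omega> * sin (A \<omega> + \<eta>) \<partial>M) = \<alpha> * (\<integral>\<omega>. cos (A \<omega> + \<eta>) \<partial>M)" for \<eta>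
    using sin[of c m \<eta>] by (simp add: A_def \<alpha>_def)
  have iS: "integrable M (\<lambda>\<omega>. Y \<omega> * sin (A \<omega> + \<eta>))" for \<eta>
    by (rule Bochner_Integration.integrable_bound[OF Y]) (auto simp: abs_mult mult_left_le)
  have iC: "integrable M (\<lambda>\<omega>. cos (A \<omega> + \<eta>))" for \<eta>
    by (rule integrable_const_bound[of _ 1]) auto
  have L: "segment_avg a (\<lambda>x. k * cos ((\<Sum>i<m. c i * x i) + \<theta>)) \<epsilon> (\<lambda>i. X i \<omega>) =
    (if \<alpha> = 0 then k * cos (A \<omega> + \<theta>) else k * (sin (A \<omega> + (\<theta> + \<epsilon> * \<alpha>)) - sin (A \<omega> + \<theta>)) / (\<epsilon> * \<alpha>))" for \<omega>
    unfolding segment_avg_cos[OF e \<alpha>_def] A_def ..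
  have R: "(\<integral>\<omega>. (k * cos (A \<omega> + (\<theta> + \<epsilon> * \<alpha>)) - k * cos (A \<omega> + \<theta>)) / \<epsilon> \<partial>M)
     = (k * (\<integral>\<omega>. cos (A \<omega> + (\<theta> + \<epsilon> * \<alpha>)) \<partial>M) - k * (\<integral>\<omega>. cos (A \<omega> + \<theta>) \<partial>M)) / \<epsilon>"
    using iC by simp
  have main: "(\<integral>\<omega>. Y \<omega> * (if \<alpha> = 0 then k * cos (A \<omega> + \<theta>) else k * (sin (A \<omega> + (\<theta> + \<epsilon> * \<alpha>)) - sin (A \<omega> + \<theta>)) / (\<epsilon> * \<alpha>)) \<partial>M)
     = (\<integral>\<omega>. (k * cos (A \<omega> + (\<theta> + \<epsilon> * \<alpha>)) - k * cos (A \<omega> + \<theta>)) / \<epsilon> \<partial>M)"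
  proof (cases "\<alpha> = 0")
    case True
    have "(\<integral>\<omega>. Y \<omega> * (k * cos (A \<omega> + \<theta>)) \<partial>M) = k * (\<integral>\<omega>. Y \<omega> * sin (A \<omega> + (\<theta> + pi/2)) \<partial>M)"
      by (simp add: sin_add cos_add add.assoc[symmetric] mult.left_commute)
    also have "\<dots> = 0" unfolding S using True by simp
    finally show ?thesis using True by simp
  next
    case False
    have "(\<integral>\<omega>. Y \<omega> * (k * (sin (A \<omega> + (\<theta> + \<epsilon> * \<alpha>)) - sin (A \<omega> + \<theta>)) / (\<epsilon> * \<alpha>)) \<partial>M)
      = (\<integral>\<omega>. k / (\<epsilon> * \<alpha>) * (Y \<omega> * sin (A \<omega> + (\<theta> + \<epsilon> * \<alpha>)) - Y \<omega> * sin (A \<omega> + \<theta>)) \<partial>M)"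
      by (intro Bochner_Integration.integral_cong) (auto simp: field_simps)
    also have "\<dots> = k / (\<epsilon> * \<alpha>) * (\<alpha> * (\<integral>\<omega>. cos (A \<omega> + (\<theta> + \<epsilon> * \<alpha>)) \<partial>M) - \<alpha> * (\<integral>\<omega>. cos (A \<omega> + \<theta>) \<partial>M))"
      using iS by (simp add: S)
    also have "\<dots> = (k * (\<integral>\<omega>. cos (A \<omega> + (\<theta> + \<epsilon> * \<alpha>)) \<partial>M) - k * (\<integral>\<omega>. cos (A \<omega> + \<theta>) \<partial>M)) / \<epsilon>"
      using False by (simp add: right_diff_distrib[symmetric])
    finally show ?thesis unfolding R using False by simp
  qed
  show ?case unfolding L A' using main by (auto simp: A_def[symmetric])
next
  case (trig_add p q)
  have [measurable]: "Y \<in> borel_measurable M" using Y by auto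
  obtain K1 K2 where K: "\<And>x. \<bar>p x\<bar> \<le> K1" "\<And>x. \<bar>q x\<bar> \<le> K2"
    using trig_bounded[OF trig_add.hyps(1)] trig_bounded[OF trig_add.hyps(2)] by auto
  note c = trig_continuous[OF trig_add.hyps(1)] trig_continuous[OF trig_add.hyps(2)]
  have L: "segment_avg a (\<lambda>x. p x + q x) \<epsilon> x = segment_avg a p \<epsilon> x + segment_avg a q \<epsilon> x" for x
    unfolding segment_avg_def using line_integrable[OF c(1) K(1), of x \<epsilon> a] line_integrable[OF c(2) K(2), of x \<epsilon> a]
    by (simp add: distrib_left)
  have iY: "integrable M (\<lambda>\<omega>. Y \<omega> * segment_avg a r \<epsilon> (\<lambda>i. X i \<omega>))"
    if "(\<lambda>\<omega>. segment_avg a r \<epsilon> (\<lambda>i. X i \<omega>)) \<in> borel_measurable M" "continuous_on UNIV r" "\<And>x. \<bar>r x\<bar> \<le> K" for r K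
  proof (rule Bochner_Integration.integrable_bound)
    show "integrable M (\<lambda>\<omega>. K * Y \<omega>)" using Y by simp
    have "\<bar>segment_avg a r \<epsilon> x\<bar> \<le> \<bar>K\<bar>" for x using segment_avg_bounded[OF that(2,3)] by (rule order_trans) simp
    then show "AE \<omega> in M. norm (Y \<omega> * segment_avg a r \<epsilon> (\<lambda>i. X i \<omega>)) \<le> norm (K * Y \<omega>)"
      using abs_mult_le[of "segment_avg a r \<epsilon> (\<lambda>i. X i \<omega>)" "\<bar>K\<bar>" "Y \<omega>" for \<omega>]
      by (intro AE_I2) (simp add: abs_mult[of K])
  qed (use that in auto)
  have ir: "integrable M (\<lambda>\<omega>. r (\<lambda>i. X i \<omega> + b i))" if "r \<in> trig_polys" "\<And>x. \<bar>r x\<bar> \<le> K" for r K b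
    by (rule integrable_const_bound[of _ K]) (use that trig_measurable[OF assms(1) that(1)] in auto)
  have ir0: "integrable M (\<lambda>\<omega>. r (\<lambda>i. X i \<omega>))" if "r \<in> trig_polys" "\<And>x. \<bar>r x\<bar> \<le> K" for r K
    using ir[OF that, of "\<lambda>_. 0"] by simp
  have Lm: "(\<lambda>\<omega>. segment_avg a p \<epsilon> (\<lambda>i. X i \<omega>)) \<in> borel_measurable M" "(\<lambda>\<omega>. segment_avg a q \<epsilon> (\<lambda>i. X i \<omega>)) \<in> borel_measurable M"
    using trig_add.IH by auto
  show ?case
    unfolding L using borel_measurable_add[OF Lm] trig_add.IH iY[OF _ c(1) K(1)] iY[OF _ c(2) K(2)]
      ir[OF trig_add.hyps(1) K(1)] ir[OF trig_add.hyps(2) K(2)] ir0[OF trig_add.hyps(1) K(1)] ir0[OF trig_add.hyps(2) K(2)]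
    by (simp add: distrib_left add_divide_distrib diff_divide_distrib)
qed

text \<open>
  Both sides of the formula of \<open>trig_shift\<close> pass to bounded pointwise limits.
  Measurability of the limits also comes from the approximation.
\<close>

lemma bounded_continuous_shift:
  fixes X :: "nat \<Rightarrow> 'a \<Rightarrow> real" and a :: "nat \<Rightarrow> real"
  assumes X[measurable]: "\<And>i. X i \<in> borel_measurable M" and Y: "integrable M Y"
    and sin: "\<And>m c \<theta>. (\<integral>\<omega>. Y \<omega> * sin ((\<Sum>i<m. c i * X i \<omega>) + \<theta>) \<partial>M)
       = (\<Sum>i<m. c i * a i) * (\<integral>\<omega>. cos ((\<Sum>i<m. c i * X i \<omega>) + \<theta>) \<partial>M)"
    and \<Phi>: "continuous_on UNIV \<Phi>" and K: "\<And>x. \<bar>\<Phi> x\<bar> \<le> K"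
    and e: "\<epsilon> \<noteq> 0"
  shows "(\<lambda>\<omega>. \<Phi> (\<lambda>i. X i \<omega> + b i)) \<in> borel_measurable M"
    "(\<lambda>\<omega>. segment_avg a \<Phi> \<epsilon> (\<lambda>i. X i \<omega>)) \<in> borel_measurable M"
    "(\<integral>\<omega>. Y \<omega> * segment_avg a \<Phi> \<epsilon> (\<lambda>i. X i \<omega>) \<partial>M) = (\<integral>\<omega>. (\<Phi> (\<lambda>i. X i \<omega> + \<epsilon> * a i) - \<Phi> (\<lambda>i. X i \<omega>)) / \<epsilon> \<partial>M)"
proof -
  have Ym[measurable]: "Y \<in> borel_measurable M" using Y by auto
  obtain p where p: "\<And>n. p n \<in> trig_polys" and pK: "\<And>n x. \<bar>p n x\<bar> \<le> K + 1" and plim: "\<And>x. (\<lambda>n. p n x) \<longlonglongrightarrow> \<Phi> x"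
    using trig_approx[OF \<Phi> K] by auto
  note pc = trig_continuous[OF p]
  have K0: "0 \<le> K" using K[of "\<lambda>_. 0"] by linarith
  note sh = trig_shift[OF X Y sin e p]
  have pm[measurable]: "(\<lambda>\<omega>. p n (\<lambda>i. X i \<omega> + b i)) \<in> borel_measurable M" for n b
    by (rule trig_measurable[OF X p])
  show \<Phi>m: "(\<lambda>\<omega>. \<Phi> (\<lambda>i. X i \<omega> + b i)) \<in> borel_measurable M" for b
    by (rule borel_measurable_LIMSEQ_real[OF plim pm])
  have Lm: "(\<lambda>\<omega>. segment_avg a (p n) \<epsilon> (\<lambda>i. X i \<omega>)) \<in> borel_measurable M" for n using sh[of n] by blast
  have L: "(\<lambda>n. segment_avg a (p n) \<epsilon> x) \<longlonglongrightarrow> segment_avg a \<Phi> \<epsilon> x" for x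
    unfolding segment_avg_def[of a \<Phi>]
    by (rule segment_avg_limit[OF pc pK plim]) (rule borel_measurable_continuous_onI[OF line_continuous[OF \<Phi>]])
  show \<Phi>L: "(\<lambda>\<omega>. segment_avg a \<Phi> \<epsilon> (\<lambda>i. X i \<omega>)) \<in> borel_measurable M"
    by (rule borel_measurable_LIMSEQ_real[OF L Lm])
  have "(\<lambda>n. \<integral>\<omega>. Y \<omega> * segment_avg a (p n) \<epsilon> (\<lambda>i. X i \<omega>) \<partial>M) \<longlonglongrightarrow> (\<integral>\<omega>. Y \<omega> * segment_avg a \<Phi> \<epsilon> (\<lambda>i. X i \<omega>) \<partial>M)"
  proof (rule integral_dominated_convergence[where w="\<lambda>\<omega>. (K + 1) * \<bar>Y \<omega>\<bar>"])
    show "integrable M (\<lambda>\<omega>. (K + 1) * \<bar>Y \<omega>\<bar>)" using Y by simp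
    show "AE \<omega> in M. (\<lambda>n. Y \<omega> * segment_avg a (p n) \<epsilon> (\<lambda>i. X i \<omega>)) \<longlonglongrightarrow> Y \<omega> * segment_avg a \<Phi> \<epsilon> (\<lambda>i. X i \<omega>)"
      by (intro AE_I2 tendsto_mult tendsto_const L)
    show "AE \<omega> in M. norm (Y \<omega> * segment_avg a (p n) \<epsilon> (\<lambda>i. X i \<omega>)) \<le> (K + 1) * \<bar>Y \<omega>\<bar>" for n
      unfolding real_norm_def by (intro AE_I2 abs_mult_le segment_avg_bounded[OF pc pK])
  qed (use \<Phi>L Lm in auto)
  moreover have "(\<lambda>n. \<integral>\<omega>. (p n (\<lambda>i. X i \<omega> + \<epsilon> * a i) - p n (\<lambda>i. X i \<omega>)) / \<epsilon> \<partial>M)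
     \<longlonglongrightarrow> (\<integral>\<omega>. (\<Phi> (\<lambda>i. X i \<omega> + \<epsilon> * a i) - \<Phi> (\<lambda>i. X i \<omega>)) / \<epsilon> \<partial>M)"
  proof (rule integral_dominated_convergence[where w="\<lambda>\<omega>. 2 * (K + 1) / \<bar>\<epsilon>\<bar>"])
    show "AE \<omega> in M. (\<lambda>n. (p n (\<lambda>i. X i \<omega> + \<epsilon> * a i) - p n (\<lambda>i. X i \<omega>)) / \<epsilon>) \<longlonglongrightarrow> (\<Phi> (\<lambda>i. X i \<omega> + \<epsilon> * a i) - \<Phi> (\<lambda>i. X i \<omega>)) / \<epsilon>"
      using e by (intro AE_I2 tendsto_divide tendsto_diff plim tendsto_const) auto
    show "AE \<omega> in M. norm ((p n (\<lambda>i. X i \<omega> + \<epsilon> * a i) - p n (\<lambda>i. X i \<omega>)) / \<epsilon>) \<le> 2 * (K + 1) / \<bar>\<epsilon>\<bar>" for n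
    proof (rule AE_I2)
      fix \<omega>
      have "\<bar>p n (\<lambda>i. X i \<omega> + \<epsilon> * a i) - p n (\<lambda>i. X i \<omega>)\<bar> \<le> (K + 1) + (K + 1)"
        by (rule order_trans[OF abs_triangle_ineq4 add_mono[OF pK pK]])
      then have "\<bar>p n (\<lambda>i. X i \<omega> + \<epsilon> * a i) - p n (\<lambda>i. X i \<omega>)\<bar> \<le> 2 * (K + 1)" by simp
      then show "norm ((p n (\<lambda>i. X i \<omega> + \<epsilon> * a i) - p n (\<lambda>i. X i \<omega>)) / \<epsilon>) \<le> 2 * (K + 1) / \<bar>\<epsilon>\<bar>"
        using e by (simp add: divide_right_mono)
    qed
    show "(\<lambda>\<omega>. (\<Phi> (\<lambda>i. X i \<omega> + \<epsilon> * a i) - \<Phi> (\<lambda>i. X i \<omega>)) / \<epsilon>) \<in> borel_measurable M"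
      using \<Phi>m[of "\<lambda>i. \<epsilon> * a i"] \<Phi>m[of "\<lambda>i. 0"] by simp
    show "(\<lambda>\<omega>. (p n (\<lambda>i. X i \<omega> + \<epsilon> * a i) - p n (\<lambda>i. X i \<omega>)) / \<epsilon>) \<in> borel_measurable M" for n
      using pm[of n "\<lambda>i. \<epsilon> * a i"] pm[of n "\<lambda>i. 0"] by simp
  qed simp
  ultimately show "(\<integral>\<omega>. Y \<omega> * segment_avg a \<Phi> \<epsilon> (\<lambda>i. X i \<omega>) \<partial>M) = (\<integral>\<omega>. (\<Phi> (\<lambda>i. X i \<omega> + \<epsilon> * a i) - \<Phi> (\<lambda>i. X i \<omega>)) / \<epsilon> \<partial>M)"
    using sh by (auto intro: LIMSEQ_unique)
qed

text \<open>
  As \<open>\<epsilon>\<close> tends to \<open>0\<close>, the segment shrinks to its starting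
  point and the difference quotient tends to \<open>D\<close>, boundedly in both cases.
\<close>

lemma integration_by_parts_directional:
  fixes X :: "nat \<Rightarrow> 'a \<Rightarrow> real" and a :: "nat \<Rightarrow> real"
  assumes X[measurable]: "\<And>i. X i \<in> borel_measurable M" and Y: "integrable M Y"
    and sin: "\<And>m c \<theta>. (\<integral>\<omega>. Y \<omega> * sin ((\<Sum>i<m. c i * X i \<omega>) + \<theta>) \<partial>M)
       = (\<Sum>i<m. c i * a i) * (\<integral>\<omega>. cos ((\<Sum>i<m. c i * X i \<omega>) + \<theta>) \<partial>M)"
    and \<Phi>: "continuous_on UNIV \<Phi>" and K: "\<And>x. \<bar>\<Phi> x\<bar> \<le> K"
    and L: "\<And>\<epsilon> x. \<bar>\<Phi> (\<lambda>i. x i + \<epsilon> * a i) - \<Phi> x\<bar> \<le> L * \<bar>\<epsilon>\<bar>"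
    and D: "\<And>x. ((\<lambda>\<epsilon>. (\<Phi> (\<lambda>i. x i + \<epsilon> * a i) - \<Phi> x) / \<epsilon>) \<longlongrightarrow> D x) (at 0)"
  shows "(\<integral>\<omega>. Y \<omega> * \<Phi> (\<lambda>i. X i \<omega>) \<partial>M) = (\<integral>\<omega>. D (\<lambda>i. X i \<omega>) \<partial>M)"
proof -
  have Ym[measurable]: "Y \<in> borel_measurable M" using Y by auto
  define e where "e n = 1 / real (Suc n)" for n
  have e: "e \<longlonglongrightarrow> 0" "e n \<noteq> 0" for n
    unfolding e_def[abs_def] using LIMSEQ_inverse_real_of_nat by (auto simp: inverse_eq_divide)
  have fe: "filterlim e (at 0) sequentially" unfolding filterlim_at using e by auto
  note sh = bounded_continuous_shift[OF X Y sin \<Phi> K e(2)]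
  have \<Phi>m: "(\<lambda>\<omega>. \<Phi> (\<lambda>i. X i \<omega> + b i)) \<in> borel_measurable M" for b by (rule sh(1))
  have \<Phi>m0: "(\<lambda>\<omega>. \<Phi> (\<lambda>i. X i \<omega>)) \<in> borel_measurable M" using \<Phi>m[of "\<lambda>_. 0"] by simp
  have lim: "(\<lambda>n. segment_avg a \<Phi> (e n) x) \<longlonglongrightarrow> \<Phi> x" for x
  proof -
    have "(\<lambda>n. segment_avg a \<Phi> (e n) x) \<longlonglongrightarrow> (\<integral>s. indicator {0..1} s * \<Phi> x \<partial>(lborel :: real measure))"
    proof (rule segment_avg_limit[OF \<Phi> K])
      fix s :: real
      have "(\<lambda>n. x i + e n * s * a i) \<longlonglongrightarrow> x i + 0 * s * a i" for i
        by (intro tendsto_intros e)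
      then show "(\<lambda>n. \<Phi> (\<lambda>i. x i + e n * s * a i)) \<longlonglongrightarrow> \<Phi> x"
        by (intro tendsto_coordinatewise[OF \<Phi>]) simp
    qed simp
    then show ?thesis by simp
  qed
  have "(\<lambda>n. \<integral>\<omega>. Y \<omega> * segment_avg a \<Phi> (e n) (\<lambda>i. X i \<omega>) \<partial>M) \<longlonglongrightarrow> (\<integral>\<omega>. Y \<omega> * \<Phi> (\<lambda>i. X i \<omega>) \<partial>M)"
  proof (rule integral_dominated_convergence[where w="\<lambda>\<omega>. K * \<bar>Y \<omega>\<bar>"])
    show "integrable M (\<lambda>\<omega>. K * \<bar>Y \<omega>\<bar>)" using Y by simp
    show "AE \<omega> in M. (\<lambda>n. Y \<omega> * segment_avg a \<Phi> (e n) (\<lambda>i. X i \<omega>)) \<longlonglongrightarrow> Y \<omega> * \<Phi> (\<lambda>i. X i \<omega>)"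
      by (intro AE_I2 tendsto_mult tendsto_const lim)
    show "AE \<omega> in M. norm (Y \<omega> * segment_avg a \<Phi> (e n) (\<lambda>i. X i \<omega>)) \<le> K * \<bar>Y \<omega>\<bar>" for n
      unfolding real_norm_def by (intro AE_I2 abs_mult_le segment_avg_bounded[OF \<Phi> K])
  qed (use sh(2) \<Phi>m0 in auto)
  moreover have "(\<lambda>n. \<integral>\<omega>. (\<Phi> (\<lambda>i. X i \<omega> + e n * a i) - \<Phi> (\<lambda>i. X i \<omega>)) / e n \<partial>M) \<longlonglongrightarrow> (\<integral>\<omega>. D (\<lambda>i. X i \<omega>) \<partial>M)"
  proof (rule integral_dominated_convergence[where w="\<lambda>\<omega>. L"])
    show dl: "AE \<omega> in M. (\<lambda>n. (\<Phi> (\<lambda>i. X i \<omega> + e n * a i) - \<Phi> (\<lambda>i. X i \<omega>)) / e n) \<longlonglongrightarrow> D (\<lambda>i. X i \<omega>)"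
      by (intro AE_I2 filterlim_compose[OF D fe])
    show m: "(\<lambda>\<omega>. (\<Phi> (\<lambda>i. X i \<omega> + e n * a i) - \<Phi> (\<lambda>i. X i \<omega>)) / e n) \<in> borel_measurable M" for n
      using \<Phi>m[of "\<lambda>i. e n * a i"] \<Phi>m0 by simp
    show "(\<lambda>\<omega>. D (\<lambda>i. X i \<omega>)) \<in> borel_measurable M"
      by (rule borel_measurable_LIMSEQ_real[OF filterlim_compose[OF D fe] m])
    show "AE \<omega> in M. norm ((\<Phi> (\<lambda>i. X i \<omega> + e n * a i) - \<Phi> (\<lambda>i. X i \<omega>)) / e n) \<le> L" for n
      using L[of _ "e n"] e(2)[of n] by (auto intro!: AE_I2 simp: divide_le_eq)
  qed simp
  ultimately show ?thesis unfolding sh(3) by (rule LIMSEQ_unique)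
qed

end

section \<open>The mean of the random time\<close>

text \<open>
  The integral defining \<open>Gamma x\<close> is at least its part over \<open>[1, 2]\<close>,
  where the integrand is at least \<open>exp (- 2)\<close>. A bound uniform in \<open>x\<close> is
  needed because it controls all coefficients of the Mittag-Leffler series at once.
\<close>

lemma Gamma_lower_bound:
  assumes "1 \<le> (x::real)"
  shows "exp (- 2) \<le> Gamma x"
proof -
  have "ennreal (exp (- 2)) = (\<integral>\<^sup>+t. ennreal (exp (- 2)) * indicator {1..2} t \<partial>(lborel :: real measure))"
    by (simp add: nn_integral_cmult_indicator)
  also have "\<dots> \<le> (\<integral>\<^sup>+t. ennreal (indicator {0..} t * t powr (x - 1) / exp t) \<partial>lborel)"
  proof (rule nn_integral_mono)
    fix t :: real
    show "ennreal (exp (- 2)) * indicator {1..2} t \<le> ennreal (indicator {0..} t * t powr (x - 1) / exp t)"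
    proof (cases "t \<in> {1..2}")
      case True
      have "1 \<le> t powr (x - 1)" using True assms by (intro ge_one_powr_ge_zero) auto
      moreover have "exp (- 2) \<le> exp (- t)" using True by simp
      ultimately have "exp (- 2) * 1 \<le> exp (- t) * t powr (x - 1)" by (intro mult_mono) auto
      also have "\<dots> = indicator {0..} t * t powr (x - 1) / exp t"
        using True by (simp add: exp_minus divide_inverse)
      finally have "ennreal (exp (- 2)) \<le> ennreal (indicator {0..} t * t powr (x - 1) / exp t)"
        by (intro ennreal_leI) simp
      then show ?thesis using True by simp
    qed simp
  qed
  also have "\<dots> = ennreal (Gamma x)"
    using Gamma_conv_nn_integral_real[of x] assms by simp
  finally show ?thesis using Gamma_real_pos[of x] assms by (subst (asm) ennreal_le_iff) auto
qed

lemma mittag_leffler_zero: "mittag_leffler \<beta> 0 = 1"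
proof -
  have "(\<lambda>n. 0 ^ n / Gamma (\<beta> * real n + 1)) sums (\<Sum>n\<in>{0}. 0 ^ n / Gamma (\<beta> * real n + 1))"
    by (rule sums_finite) auto
  then have "(\<Sum>n. 0 ^ n / Gamma (\<beta> * real n + 1)) = (\<Sum>n\<in>{0}. 0 ^ n / Gamma (\<beta> * real n + 1))"
    by (rule sums_unique[symmetric])
  then show ?thesis unfolding mittag_leffler_def by simp
qed

lemma mittag_leffler_slope:
  assumes \<beta>: "0 < \<beta>" and s: "0 < s" "s \<le> 1/2"
  shows "(1 - mittag_leffler \<beta> (- s)) / s \<le> 2 * exp 2"
proof -
  define c where "c n = (- s) ^ n / Gamma (\<beta> * real n + 1)" for n
  have c: "norm (c n) \<le> exp 2 * s ^ n" for n
  proof -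
    have G: "exp (- 2) \<le> Gamma (\<beta> * real n + 1)" using \<beta> by (intro Gamma_lower_bound) simp
    moreover have "0 < Gamma (\<beta> * real n + 1)" using G exp_gt_zero[of "- 2 :: real"] by linarith
    ultimately have "inverse (Gamma (\<beta> * real n + 1)) \<le> inverse (exp (- 2))"
      by (intro le_imp_inverse_le exp_gt_zero)
    then have "s ^ n * inverse (Gamma (\<beta> * real n + 1)) \<le> s ^ n * exp 2"
      using s by (intro mult_left_mono) (simp_all add: exp_minus)
    moreover have "norm (c n) = s ^ n * inverse (Gamma (\<beta> * real n + 1))"
      unfolding c_def real_norm_def abs_divide power_abs abs_minus_cancel
        abs_of_pos[OF s(1)] abs_of_pos[OF \<open>0 < Gamma (\<beta> * real n + 1)\<close>] by (rule divide_inverse)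
    ultimately show ?thesis by (simp add: mult.commute)
  qed
  have gs: "summable (\<lambda>n. exp 2 * s ^ n)" by (rule summable_mult[OF summable_geometric]) (use s in simp)
  have cs: "summable c" by (rule summable_comparison_test[OF exI[of _ 0] gs]) (simp only: c simp_thms)
  have "1 - mittag_leffler \<beta> (- s) = - (\<Sum>n. c (Suc n))"
  proof -
    have "c 0 = 1" by (simp add: c_def)
    moreover have "mittag_leffler \<beta> (- s) = suminf c" unfolding mittag_leffler_def c_def[abs_def] ..
    ultimately show ?thesis using suminf_split_head[OF cs] by linarith
  qed
  also have "\<dots> \<le> (\<Sum>n. exp 2 * s * s ^ n)"
  proof -
    have s1: "summable (\<lambda>n. c (Suc n))" using cs by (simp add: summable_Suc_iff)
    have s2: "summable (\<lambda>n. exp 2 * s * s ^ n)" by (rule summable_mult[OF summable_geometric]) (use s in simp)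
    have "(\<Sum>n. - c (Suc n)) \<le> (\<Sum>n. exp 2 * s * s ^ n)"
    proof (rule suminf_le)
      show "- c (Suc n) \<le> exp 2 * s * s ^ n" for n
      proof -
        have "- c (Suc n) \<le> norm (c (Suc n))" unfolding real_norm_def by (rule abs_ge_minus_self)
        also have "\<dots> \<le> exp 2 * s ^ Suc n" by (rule c)
        also have "\<dots> = exp 2 * s * s ^ n" by (simp only: power_Suc mult.assoc)
        finally show ?thesis .
      qed
      show "summable (\<lambda>n. - c (Suc n))" by (rule summable_minus[OF s1])
    qed (rule s2)
    then show ?thesis by (simp only: suminf_minus[OF s1])
  qed
  also have "\<dots> = exp 2 * s * (1 / (1 - s))"
  proof -
    have "norm s < 1" using s by simp
    then show ?thesis by (simp only: suminf_mult[OF summable_geometric] suminf_geometric)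
  qed
  also have "\<dots> \<le> exp 2 * s * 2"
  proof (rule mult_left_mono)
    show "1 / (1 - s) \<le> 2" using s by (subst pos_divide_le_eq) auto
  qed (use s in simp)
  finally have "1 - mittag_leffler \<beta> (- s) \<le> 2 * exp 2 * s" by (simp only: mult_ac)
  then show ?thesis using s by (simp only: pos_divide_le_eq)
qed

text \<open>
  The mean is the derivative at \<open>0\<close> of the Laplace transform, up to the sign: by
  Fatou's lemma it is at most the lower limit of the slopes \<open>(1 - E\<^sub>\<beta>(- s)) /
  s\<close>, and these are bounded because the series has bounded coefficients.
\<close>

lemma time_law_moment:
  assumes \<beta>: "0 < \<beta>" and M: "M_density \<beta> M"
  shows "prob_space (time_law M)" "integrable (time_law M) (\<lambda>\<tau>. \<tau>)" "space (time_law M) = {0..}"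
    "sets (time_law M) = sets half_line"
proof -
  show "space (time_law M) = {0..}" by (simp add: time_law_def)
  show "sets (time_law M) = sets half_line" by (simp add: time_law_def)
  have Mm[measurable]: "M \<in> borel_measurable half_line" using M by (simp add: M_density_def)
  have M0: "AE \<tau> in half_line. 0 \<le> M \<tau>" using M by (auto simp: M_density_def AE_half_line)
  have L: "has_bochner_integral half_line (\<lambda>\<tau>. exp (- s * \<tau>) * M \<tau>) (mittag_leffler \<beta> (- s))" if "0 \<le> s" for s
    using M that by (simp add: M_density_def)
  have L0: "integrable half_line M" "(\<integral>\<tau>. M \<tau> \<partial>half_line) = 1"
    using L[of 0] by (auto simp: has_bochner_integral_iff mittag_leffler_zero)
  show "prob_space (time_law M)"
  proof
    have "emeasure (time_law M) (space (time_law M)) = (\<integral>\<^sup>+\<tau>. ennreal (M \<tau>) \<partial>half_line)"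
      unfolding time_law_def space_density
      by (subst emeasure_density) (auto intro!: nn_integral_cong simp: sets_restrict_space_iff)
    also have "\<dots> = 1" using L0 M0 by (simp add: nn_integral_eq_integral)
    finally show "emeasure (time_law M) (space (time_law M)) = 1" .
  qed
  have id[measurable]: "(\<lambda>\<tau>::real. \<tau>) \<in> borel_measurable half_line"
    by (rule measurable_restrict_space1) simp
  \<comment> \<open>All \<open>s n\<close> are at most \<open>1/2\<close>, where the bound on the slopes holds.\<close>
  define s where "s n = 1 / (real n + 2)" for n
  have s: "0 < s n" "s n \<le> 1/2" for n by (auto simp: s_def field_simps)
  have sl: "s \<longlonglongrightarrow> 0" unfolding s_def by real_asymp
  have fs: "filterlim s (at 0) sequentially" unfolding filterlim_at using s sl by (auto simp: less_imp_neq[symmetric])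
  have lim: "(\<lambda>n. (1 - exp (- s n * \<tau>)) / s n) \<longlonglongrightarrow> \<tau>" for \<tau>
  proof -
    have "((\<lambda>e. - exp (- e * \<tau>)) has_real_derivative \<tau>) (at 0)" by (auto intro!: derivative_eq_intros)
    then have "((\<lambda>e. (1 - exp (- e * \<tau>)) / e) \<longlongrightarrow> \<tau>) (at 0)" by (simp add: DERIV_def)
    then show ?thesis by (rule filterlim_compose[OF _ fs])
  qed
  have "(\<integral>\<^sup>+\<tau>. ennreal (M \<tau> * \<tau>) \<partial>half_line) = (\<integral>\<^sup>+\<tau>. liminf (\<lambda>n. ennreal (M \<tau> * ((1 - exp (- s n * \<tau>)) / s n))) \<partial>half_line)"
  proof (rule nn_integral_cong)
    fix \<tau>
    have "(\<lambda>n. ennreal (M \<tau> * ((1 - exp (- s n * \<tau>)) / s n))) \<longlonglongrightarrow> ennreal (M \<tau> * \<tau>)"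
      by (intro tendsto_intros lim)
    then show "ennreal (M \<tau> * \<tau>) = liminf (\<lambda>n. ennreal (M \<tau> * ((1 - exp (- s n * \<tau>)) / s n)))"
      using lim_imp_Liminf[OF sequentially_bot] by metis
  qed
  also have "\<dots> \<le> liminf (\<lambda>n. \<integral>\<^sup>+\<tau>. ennreal (M \<tau> * ((1 - exp (- s n * \<tau>)) / s n)) \<partial>half_line)"
    by (rule nn_integral_liminf) measurable
  also have "\<dots> \<le> liminf (\<lambda>n. ennreal (2 * exp 2))"
  proof (intro Liminf_mono always_eventually allI)
    fix n
    have i: "has_bochner_integral half_line (\<lambda>\<tau>. (M \<tau> - exp (- s n * \<tau>) * M \<tau>) / s n) ((1 - mittag_leffler \<beta> (- s n)) / s n)"
      using L[of "s n"] L[of 0] s[of n] by (intro has_bochner_integral_divide has_bochner_integral_diff) (auto simp: mittag_leffler_zero)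
    have "(\<integral>\<^sup>+\<tau>. ennreal (M \<tau> * ((1 - exp (- s n * \<tau>)) / s n)) \<partial>half_line) = (\<integral>\<^sup>+\<tau>. ennreal ((M \<tau> - exp (- s n * \<tau>) * M \<tau>) / s n) \<partial>half_line)"
      by (intro nn_integral_cong) (simp add: algebra_simps diff_divide_distrib)
    also have "\<dots> = ennreal ((1 - mittag_leffler \<beta> (- s n)) / s n)"
    proof -
      have "AE \<tau> in half_line. 0 \<le> (M \<tau> - exp (- s n * \<tau>) * M \<tau>) / s n"
        unfolding AE_half_line
      proof (intro AE_I2 impI)
        fix \<tau> :: real assume "0 \<le> \<tau>"
        then have "exp (- s n * \<tau>) * M \<tau> \<le> 1 * M \<tau>"
          using s[of n] M by (intro mult_right_mono) (auto simp: M_density_def)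
        then show "0 \<le> (M \<tau> - exp (- s n * \<tau>) * M \<tau>) / s n" using s[of n] by simp
      qed
      from nn_integral_eq_integral[OF integrable.intros[OF i] this]
      show ?thesis unfolding has_bochner_integral_integral_eq[OF i] .
    qed
    also have "\<dots> \<le> ennreal (2 * exp 2)" by (intro ennreal_leI mittag_leffler_slope \<beta> s)
    finally show "(\<integral>\<^sup>+\<tau>. ennreal (M \<tau> * ((1 - exp (- s n * \<tau>)) / s n)) \<partial>half_line) \<le> ennreal (2 * exp 2)" .
  qed
  also have "\<dots> < \<infinity>" by (simp add: Liminf_const)
  finally have "(\<integral>\<^sup>+\<tau>. ennreal (M \<tau> * \<tau>) \<partial>half_line) < \<infinity>" .
  then have "integrable half_line (\<lambda>\<tau>. M \<tau> * \<tau>)"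
    using M by (intro integrableI_nonneg) (auto simp: AE_half_line M_density_def)
  then show "integrable (time_law M) (\<lambda>\<tau>. \<tau>)"
    unfolding time_law_def using M0 by (subst integrable_density) auto
qed

section \<open>Directional derivatives of smooth functions\<close>

lemma Cb_smooth_local: "f \<in> Cb_smooth n \<Longrightarrow> (\<And>i. i < n \<Longrightarrow> x i = y i) \<Longrightarrow> f x = f y"
  unfolding Cb_smooth_def by blast

lemma Cb_smooth_continuous: "f \<in> Cb_smooth n \<Longrightarrow> continuous_on UNIV f"
  unfolding Cb_smooth_def by (auto dest!: spec[of _ "[]"])

lemma Cb_smooth_bounded:
  assumes "f \<in> Cb_smooth n" shows "\<exists>K. \<forall>x. \<bar>f x\<bar> \<le> K"
proof -
  have "bounded (range f)" using assms unfolding Cb_smooth_def by (auto dest!: spec[of _ "[]"])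
  then show ?thesis unfolding bounded_iff by auto
qed

lemma Cb_smooth_partial_continuous: "f \<in> Cb_smooth n \<Longrightarrow> i < n \<Longrightarrow> continuous_on UNIV (partial_deriv i f)"
  unfolding Cb_smooth_def by (auto dest!: spec[of _ "[i]"])

lemma Cb_smooth_partial_bounded:
  assumes "f \<in> Cb_smooth n"
  shows "\<exists>K\<ge>0. \<forall>i<n. \<forall>x. \<bar>partial_deriv i f x\<bar> \<le> K"
proof -
  have "\<exists>K. \<forall>x. \<bar>partial_deriv i f x\<bar> \<le> K" if "i < n" for i
  proof -
    have "bounded (range (partial_deriv i f))" using assms that unfolding Cb_smooth_def by (auto dest!: spec[of _ "[i]"])
    then show ?thesis unfolding bounded_iff by auto
  qed
  then obtain K where K: "\<And>i x. i < n \<Longrightarrow> \<bar>partial_deriv i f x\<bar> \<le> K i" by metis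
  have "\<bar>partial_deriv i f x\<bar> \<le> (\<Sum>i<n. \<bar>K i\<bar>)" if "i < n" for i x
  proof -
    have "\<bar>K i\<bar> \<le> (\<Sum>i<n. \<bar>K i\<bar>)" using that by (intro member_le_sum) auto
    then show ?thesis using K[OF that, of x] by linarith
  qed
  then show ?thesis by (intro exI[of _ "\<Sum>i<n. \<bar>K i\<bar>"]) (auto intro: sum_nonneg)
qed

lemma Cb_smooth_has_partial:
  assumes "f \<in> Cb_smooth n" "i < n"
  shows "((\<lambda>s. f (x(i := s))) has_real_derivative partial_deriv i f (x(i := r))) (at r)"
proof -
  have "\<forall>i<n. \<forall>x. (\<lambda>s. f (x(i := s))) differentiable at (x i)"
    using assms(1) unfolding Cb_smooth_def by (auto dest!: spec[of _ "[]"])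
  from this[rule_format, OF assms(2), of "x(i := r)"] show ?thesis
    unfolding partial_deriv_def by (simp add: DERIV_deriv_iff_real_differentiable)
qed

text \<open>
  The point \<open>z j \<epsilon>\<close> has the first \<open>j\<close> coordinates of
  \<open>x\<close> moved already. Passing to the next point changes one coordinate, so the mean
  value theorem applies to one partial derivative.
\<close>

lemma Cb_smooth_directional_step:
  fixes x a :: "nat \<Rightarrow> real"
  assumes f: "f \<in> Cb_smooth n" and j: "j < n"
  defines "z \<equiv> \<lambda>j \<epsilon> i. if i < j then x i + \<epsilon> * a i else x i"
  shows "\<exists>\<xi>. \<bar>\<xi> - x j\<bar> \<le> \<bar>\<epsilon> * a j\<bar> \<and> f (z (Suc j) \<epsilon>) - f (z j \<epsilon>) = \<epsilon> * a j * partial_deriv j f ((z j \<epsilon>)(j := \<xi>))"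
proof -
  define \<phi> where "\<phi> s = f ((z j \<epsilon>)(j := s))" for s
  have d: "(\<phi> has_real_derivative partial_deriv j f ((z j \<epsilon>)(j := s))) (at s)" for s
    unfolding \<phi>_def[abs_def] by (rule Cb_smooth_has_partial[OF f j])
  have z1: "(z j \<epsilon>)(j := x j + \<epsilon> * a j) = z (Suc j) \<epsilon>" and z2: "(z j \<epsilon>)(j := x j) = z j \<epsilon>"
    by (auto simp: z_def fun_eq_iff less_Suc_eq)
  have e: "f (z (Suc j) \<epsilon>) - f (z j \<epsilon>) = \<phi> (x j + \<epsilon> * a j) - \<phi> (x j)"
    unfolding \<phi>_def z1 z2 ..
  consider "0 < \<epsilon> * a j" | "\<epsilon> * a j < 0" | "\<epsilon> * a j = 0" by linarith
  then show ?thesis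
  proof cases
    case 1
    from MVT2[of "x j" "x j + \<epsilon> * a j" \<phi> "\<lambda>s. partial_deriv j f ((z j \<epsilon>)(j := s))"] 1 d
    obtain \<xi> where "x j < \<xi>" "\<xi> < x j + \<epsilon> * a j" "\<phi> (x j + \<epsilon> * a j) - \<phi> (x j) = (x j + \<epsilon> * a j - x j) * partial_deriv j f ((z j \<epsilon>)(j := \<xi>))"
      by auto
    then show ?thesis unfolding e by (intro exI[of _ \<xi>]) auto
  next
    case 2
    from MVT2[of "x j + \<epsilon> * a j" "x j" \<phi> "\<lambda>s. partial_deriv j f ((z j \<epsilon>)(j := s))"] 2 d
    obtain \<xi> where "x j + \<epsilon> * a j < \<xi>" "\<xi> < x j" "\<phi> (x j) - \<phi> (x j + \<epsilon> * a j) = (x j - (x j + \<epsilon> * a j)) * partial_deriv j f ((z j \<epsilon>)(j := \<xi>))"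
      by auto
    then show ?thesis unfolding e by (intro exI[of _ \<xi>]) (auto simp: algebra_simps)
  next
    case 3
    then show ?thesis unfolding e by (intro exI[of _ "x j"]) auto
  qed
qed

text \<open>
  Only partial derivatives are given. Moving the coordinates one after the other expresses the
  increment by partial derivatives at intermediate points, and their joint continuity lets these
  points converge to \<open>x\<close>.
\<close>

lemma Cb_smooth_directional:
  assumes f: "f \<in> Cb_smooth n"
  shows "\<And>x a. ((\<lambda>\<epsilon>. (f (\<lambda>i. x i + \<epsilon> * a i) - f x) / \<epsilon>) \<longlongrightarrow> (\<Sum>i<n. a i * partial_deriv i f x)) (at 0)"
    and "\<And>x a \<epsilon> K. (\<And>i x. i < n \<Longrightarrow> \<bar>partial_deriv i f x\<bar> \<le> K) \<Longrightarrow> \<bar>f (\<lambda>i. x i + \<epsilon> * a i) - f x\<bar> \<le> (\<Sum>i<n. \<bar>a i\<bar>) * K * \<bar>\<epsilon>\<bar>"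
proof -
  fix x a :: "nat \<Rightarrow> real"
  define z where "z j \<epsilon> i = (if i < j then x i + \<epsilon> * a i else x i)" for j \<epsilon> i
  define \<xi> where "\<xi> j \<epsilon> = (SOME r. \<bar>r - x j\<bar> \<le> \<bar>\<epsilon> * a j\<bar> \<and>
    f (z (Suc j) \<epsilon>) - f (z j \<epsilon>) = \<epsilon> * a j * partial_deriv j f ((z j \<epsilon>)(j := r)))" for j \<epsilon>
  have \<xi>': "\<bar>\<xi> j \<epsilon> - x j\<bar> \<le> \<bar>\<epsilon> * a j\<bar> \<and>
    f (z (Suc j) \<epsilon>) - f (z j \<epsilon>) = \<epsilon> * a j * partial_deriv j f ((z j \<epsilon>)(j := \<xi> j \<epsilon>))" if "j < n" for j \<epsilon>
  proof -
    have z: "z = (\<lambda>j \<epsilon> i. if i < j then x i + \<epsilon> * a i else x i)" by (simp add: z_def[abs_def])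
    have "\<exists>r. \<bar>r - x j\<bar> \<le> \<bar>\<epsilon> * a j\<bar> \<and> f (z (Suc j) \<epsilon>) - f (z j \<epsilon>) = \<epsilon> * a j * partial_deriv j f ((z j \<epsilon>)(j := r))"
      using Cb_smooth_directional_step[OF f that, of x \<epsilon> a] unfolding z .
    from someI_ex[OF this] show ?thesis unfolding \<xi>_def .
  qed
  note \<xi> = \<xi>'[THEN conjunct1] \<xi>'[THEN conjunct2]
  have tele: "f (\<lambda>i. x i + \<epsilon> * a i) - f x = (\<Sum>j<n. \<epsilon> * a j * partial_deriv j f ((z j \<epsilon>)(j := \<xi> j \<epsilon>)))" for \<epsilon>
  proof -
    have "f (\<lambda>i. x i + \<epsilon> * a i) = f (z n \<epsilon>)" by (rule Cb_smooth_local[OF f]) (simp add: z_def)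
    moreover have "z 0 \<epsilon> = x" by (auto simp: z_def)
    moreover have "f (z n \<epsilon>) - f (z 0 \<epsilon>) = (\<Sum>j<n. f (z (Suc j) \<epsilon>) - f (z j \<epsilon>))"
      by (rule sum_lessThan_telescope[of "\<lambda>j. f (z j \<epsilon>)" n, symmetric])
    ultimately have "f (\<lambda>i. x i + \<epsilon> * a i) - f x = (\<Sum>j<n. f (z (Suc j) \<epsilon>) - f (z j \<epsilon>))" by (simp only:)
    also have "\<dots> = (\<Sum>j<n. \<epsilon> * a j * partial_deriv j f ((z j \<epsilon>)(j := \<xi> j \<epsilon>)))"
      by (intro sum.cong refl \<xi>(2)) simp
    finally show ?thesis .
  qed
  show "((\<lambda>\<epsilon>. (f (\<lambda>i. x i + \<epsilon> * a i) - f x) / \<epsilon>) \<longlongrightarrow> (\<Sum>i<n. a i * partial_deriv i f x)) (at 0)"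
  proof -
    have "((\<lambda>\<epsilon>. \<Sum>j<n. a j * partial_deriv j f ((z j \<epsilon>)(j := \<xi> j \<epsilon>))) \<longlongrightarrow> (\<Sum>i<n. a i * partial_deriv i f x)) (at 0)"
    proof (intro tendsto_sum tendsto_mult tendsto_const)
      fix j assume "j \<in> {..<n}"
      then have j: "j < n" by simp
      show "((\<lambda>\<epsilon>. partial_deriv j f ((z j \<epsilon>)(j := \<xi> j \<epsilon>))) \<longlongrightarrow> partial_deriv j f x) (at 0)"
      proof (rule tendsto_coordinatewise[OF Cb_smooth_partial_continuous[OF f j]])
        fix i
        have 1: "((\<lambda>\<epsilon>. \<xi> j \<epsilon>) \<longlongrightarrow> x j) (at 0)"
        proof -
          have "((\<lambda>\<epsilon>. \<bar>\<epsilon> * a j\<bar>) \<longlongrightarrow> \<bar>0 * a j\<bar>) (at 0)" by (intro tendsto_intros)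
          then have *: "((\<lambda>\<epsilon>. \<bar>\<epsilon> * a j\<bar>) \<longlongrightarrow> 0) (at 0)" by simp
          have "((\<lambda>\<epsilon>. \<xi> j \<epsilon> - x j) \<longlongrightarrow> 0) (at 0)"
            by (rule Lim_null_comparison[OF _ *])
               (unfold real_norm_def, intro always_eventually allI \<xi>(1) j)
          then show ?thesis by (simp add: LIM_zero_iff)
        qed
        have "((\<lambda>\<epsilon>. x i + \<epsilon> * a i) \<longlongrightarrow> x i + 0 * a i) (at 0)" by (intro tendsto_intros)
        then have 2: "((\<lambda>\<epsilon>. z j \<epsilon> i) \<longlongrightarrow> x i) (at 0)" by (cases "i < j") (simp_all add: z_def)
        show "((\<lambda>\<epsilon>. ((z j \<epsilon>)(j := \<xi> j \<epsilon>)) i) \<longlongrightarrow> x i) (at 0)"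
          using 1 2 by (cases "i = j") auto
      qed
    qed
    moreover have "\<forall>\<^sub>F \<epsilon> in at 0. (\<Sum>j<n. a j * partial_deriv j f ((z j \<epsilon>)(j := \<xi> j \<epsilon>))) = (f (\<lambda>i. x i + \<epsilon> * a i) - f x) / \<epsilon>"
      unfolding tele eventually_at_filter
    proof (intro always_eventually allI impI)
      fix \<epsilon> :: real assume "\<epsilon> \<noteq> 0"
      then show "(\<Sum>j<n. a j * partial_deriv j f ((z j \<epsilon>)(j := \<xi> j \<epsilon>)))
        = (\<Sum>j<n. \<epsilon> * a j * partial_deriv j f ((z j \<epsilon>)(j := \<xi> j \<epsilon>))) / \<epsilon>"
        unfolding sum_divide_distrib by (intro sum.cong refl) simp
    qed
    ultimately show ?thesis by (rule Lim_transform_eventually)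
  qed
  fix \<epsilon> K :: real assume K: "\<And>i x. i < n \<Longrightarrow> \<bar>partial_deriv i f x\<bar> \<le> K"
  have "\<bar>f (\<lambda>i. x i + \<epsilon> * a i) - f x\<bar> \<le> (\<Sum>j<n. \<bar>\<epsilon> * a j * partial_deriv j f ((z j \<epsilon>)(j := \<xi> j \<epsilon>))\<bar>)"
    unfolding tele by (rule sum_abs)
  also have "\<dots> \<le> (\<Sum>j<n. \<bar>\<epsilon>\<bar> * \<bar>a j\<bar> * K)"
    unfolding abs_mult by (intro sum_mono mult_left_mono K) auto
  also have "\<dots> = (\<Sum>i<n. \<bar>a i\<bar>) * K * \<bar>\<epsilon>\<bar>"
    by (simp add: sum_distrib_left sum_distrib_right mult_ac)
  finally show "\<bar>f (\<lambda>i. x i + \<epsilon> * a i) - f x\<bar> \<le> (\<Sum>i<n. \<bar>a i\<bar>) * K * \<bar>\<epsilon>\<bar>" .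
qed

section \<open>Cylinder functions of a path at a random time\<close>

text \<open>
  By continuity of paths, \<open>X (\<phi> \<tau>)\<close> is the limit of \<open>X\<close>
  evaluated at the grid points \<open>\<lfloor>n \<phi> \<tau>\<rfloor> / n\<close>; for each
  \<open>n\<close> only countably many times occur.
\<close>

lemma random_time_measurable:
  assumes X: "continuous_paths M X" and \<phi>: "\<phi> \<in> borel_measurable N" "\<And>\<tau>. \<tau> \<in> space N \<Longrightarrow> 0 \<le> \<phi> \<tau>"
  shows "(\<lambda>x. X (\<phi> (snd x)) (fst x)) \<in> borel_measurable (M \<Otimes>\<^sub>M N)"
proof (rule borel_measurable_LIMSEQ_real)
  define k where "k n x = nat \<lfloor>real (Suc n) * \<phi> (snd x)\<rfloor>" for n and x :: "'a \<times> 'b"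
  note [measurable] = \<phi>(1)
  show "(\<lambda>x. X (real (k n x) / real (Suc n)) (fst x)) \<in> borel_measurable (M \<Otimes>\<^sub>M N)" for n
  proof (rule measurable_compose_countable[where g = "k n" and f = "\<lambda>i x. X (real i / real (Suc n)) (fst x)"])
    show "k n \<in> measurable (M \<Otimes>\<^sub>M N) (count_space UNIV)" unfolding k_def[abs_def] by measurable
    show "(\<lambda>x. X (real i / real (Suc n)) (fst x)) \<in> borel_measurable (M \<Otimes>\<^sub>M N)" for i
      using X unfolding continuous_paths_def by (intro measurable_compose[OF measurable_fst]) auto
  qed
  fix x assume x: "x \<in> space (M \<Otimes>\<^sub>M N)"
  then have p: "0 \<le> \<phi> (snd x)" using \<phi>(2) by (auto simp: space_pair_measure)
  have "(\<lambda>n. real (k n x) / real (Suc n)) \<longlonglongrightarrow> \<phi> (snd x)"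
  proof (rule tendsto_sandwich[of "\<lambda>n. \<phi> (snd x) - 1 / real (Suc n)" _ _ "\<lambda>n. \<phi> (snd x)"])
    have b: "real (Suc n) * \<phi> (snd x) - 1 \<le> real (k n x)" "real (k n x) \<le> real (Suc n) * \<phi> (snd x)" for n
      using p unfolding k_def by (auto simp: of_nat_nat simp del: of_nat_Suc)
    show "\<forall>\<^sub>F n in sequentially. \<phi> (snd x) - 1 / real (Suc n) \<le> real (k n x) / real (Suc n)"
    proof (intro always_eventually allI)
      fix n
      have "(real (Suc n) * \<phi> (snd x) - 1) / real (Suc n) \<le> real (k n x) / real (Suc n)"
        by (intro divide_right_mono b) simp
      then show "\<phi> (snd x) - 1 / real (Suc n) \<le> real (k n x) / real (Suc n)"
        by (simp add: diff_divide_distrib del: of_nat_Suc)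
    qed
    show "\<forall>\<^sub>F n in sequentially. real (k n x) / real (Suc n) \<le> \<phi> (snd x)"
      using b(2) by (intro always_eventually allI) (simp add: pos_divide_le_eq mult.commute del: of_nat_Suc)
    have "(\<lambda>n. \<phi> (snd x) - 1 / real (Suc n)) \<longlonglongrightarrow> \<phi> (snd x) - 0"
      using LIMSEQ_inverse_real_of_nat by (intro tendsto_intros) (simp add: inverse_eq_divide)
    then show "(\<lambda>n. \<phi> (snd x) - 1 / real (Suc n)) \<longlonglongrightarrow> \<phi> (snd x)" by simp
  qed simp
  moreover have "continuous_on {0..} (\<lambda>t. X t (fst x))"
    using X x unfolding continuous_paths_def by (auto simp: space_pair_measure)
  ultimately show "(\<lambda>n. X (real (k n x) / real (Suc n)) (fst x)) \<longlonglongrightarrow> X (\<phi> (snd x)) (fst x)"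
    by (intro continuous_on_tendsto_compose[of "{0..}" "\<lambda>t. X t (fst x)"]) (use p in auto)
qed

lemma continuous_on_reindex:
  fixes F :: "(nat \<Rightarrow> real) \<Rightarrow> real" and k :: "nat \<Rightarrow> nat"
  assumes F: "continuous_on UNIV F"
  shows "continuous_on UNIV (\<lambda>x. F (\<lambda>i. x (k i)))"
proof -
  have "continuous_on UNIV (\<lambda>(x::nat \<Rightarrow> real) i. x (k i))"
  proof (rule continuous_on_coordinatewise_then_product)
    fix i show "continuous_on UNIV (\<lambda>x :: nat \<Rightarrow> real. x (k i))"
      using continuous_on_product_then_coordinatewise[OF continuous_on_id, of UNIV "k i"] .
  qed
  from continuous_on_compose2[OF F this] show ?thesis by simp
qed

text \<open>
  The coordinates from \<open>n\<close> on, on which \<open>f\<close> does not depend, are set to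
  \<open>0\<close>. In \<open>cylinder_funs\<close> they are path values at arbitrary, possibly
  negative times, outside the index set of the Gaussian process.
\<close>

definition cylinder :: "real \<Rightarrow> nat \<Rightarrow> (nat \<Rightarrow> real) \<Rightarrow> ((nat \<Rightarrow> real) \<Rightarrow> real) \<Rightarrow> (real \<Rightarrow> real) \<times> real \<Rightarrow> real" where
  "cylinder H n t f = (\<lambda>(w, \<tau>). f (\<lambda>i. if i < n then w (t i * time_H H \<tau>) else 0))"

definition cylinder_deriv :: "real \<Rightarrow> nat \<Rightarrow> (nat \<Rightarrow> real) \<Rightarrow> ((nat \<Rightarrow> real) \<Rightarrow> real) \<Rightarrow> (real \<Rightarrow> real) \<Rightarrow> (real \<Rightarrow> real) \<times> real \<Rightarrow> real" where
  "cylinder_deriv H n t f h = (\<lambda>(w, \<tau>). \<Sum>i<n. h (t i * time_H H \<tau>) * cylinder H n t (partial_deriv i f) (w, \<tau>))"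

lemma cylinder_fun_eq_cyl:
  assumes f: "f \<in> Cb_smooth n"
  shows "(\<lambda>(w, \<tau>). f (\<lambda>i. w (t i * time_H H \<tau>))) = cylinder H n t f"
  unfolding cylinder_def by (intro ext) (auto intro!: Cb_smooth_local[OF f])

lemma D1_cyl:
  assumes f: "f \<in> Cb_smooth n"
  shows "D1 h (cylinder H n t f) = cylinder_deriv H n t f h"
proof (intro ext, clarify)
  fix w :: "real \<Rightarrow> real" and \<tau> :: real
  define x where "x i = (if i < n then w (t i * time_H H \<tau>) else 0)" for i
  define a where "a i = (if i < n then h (t i * time_H H \<tau>) else 0)" for i
  have "(\<lambda>i. if i < n then w (t i * time_H H \<tau>) + \<epsilon> * h (t i * time_H H \<tau>) else 0) = (\<lambda>i. x i + \<epsilon> * a i)" for \<epsilon>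
    by (auto simp: x_def a_def)
  then have "D1 h (cylinder H n t f) (w, \<tau>) = Lim (at 0) (\<lambda>\<epsilon>. (f (\<lambda>i. x i + \<epsilon> * a i) - f x) / \<epsilon>)"
    unfolding D1_def cylinder_def by (simp add: x_def[abs_def, symmetric])
  also have "\<dots> = (\<Sum>i<n. a i * partial_deriv i f x)"
    by (intro tendsto_Lim Cb_smooth_directional(1)[OF f]) simp
  also have "\<dots> = cylinder_deriv H n t f h (w, \<tau>)"
    by (simp add: cylinder_deriv_def cylinder_def a_def x_def[abs_def])
  finally show "D1 h (cylinder H n t f) (w, \<tau>) = cylinder_deriv H n t f h (w, \<tau>)" .
qed

lemma scaled_time_measurable:
  assumes "sets N = sets half_line"
  shows "(\<lambda>\<tau>. c * time_H H \<tau>) \<in> borel_measurable N"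
proof -
  have "(\<lambda>\<tau>. c * time_H H \<tau>) \<in> borel_measurable half_line"
    unfolding time_H_def by (intro measurable_restrict_space1) measurable
  then show ?thesis using measurable_cong_sets[OF assms refl] by blast
qed

context fbm_wiener
begin

lemma coord_continuous_paths: "continuous_paths P (\<lambda>t w. w t)"
  using fbm coord_measurable unfolding continuous_paths_def fbm_law_def path_space_def by auto

lemma cyl_measurable:
  assumes f: "continuous_on UNIV f" and t: "\<And>i. i < n \<Longrightarrow> 0 \<le> t i" and N: "sets N = sets half_line"
  shows "cylinder H n t f \<in> borel_measurable (P \<Otimes>\<^sub>M N)"
proof -
  have "(\<lambda>x i. if i < n then fst x (t i * time_H H (snd x)) else 0) \<in> borel_measurable (P \<Otimes>\<^sub>M N)"
  proof (rule measurable_coordinatewise_then_product)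
    fix i
    have "(\<lambda>x. fst x (t i * time_H H (snd x))) \<in> borel_measurable (P \<Otimes>\<^sub>M N)" if "i < n"
      using t[OF that] random_time_measurable[OF coord_continuous_paths scaled_time_measurable[OF N], of "t i"]
      by (simp add: time_H_def)
    then show "(\<lambda>x. if i < n then fst x (t i * time_H H (snd x)) else 0) \<in> borel_measurable (P \<Otimes>\<^sub>M N)"
      by (cases "i < n") simp_all
  qed
  from measurable_compose[OF this borel_measurable_continuous_onI[OF f]]
  show ?thesis unfolding cylinder_def by (simp add: case_prod_beta')
qed

lemma CM_time_measurable:
  assumes h: "h \<in> CM_space H" and c: "0 \<le> c" and N: "sets N = sets half_line"
  shows "(\<lambda>x. h (c * time_H H (snd x))) \<in> borel_measurable (P \<Otimes>\<^sub>M N)"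
proof -
  have "continuous_on {0..} h"
    using kernel_op_continuous[OF CM_dot_L2[OF h]] by (simp add: kernel_op_CM_dot[OF h])
  then have "continuous_paths P (\<lambda>t w. h t)" by (simp add: continuous_paths_def)
  from random_time_measurable[OF this scaled_time_measurable[OF N]] c
  show ?thesis by (simp add: time_H_def)
qed

lemma cyl_deriv_measurable:
  assumes f: "f \<in> Cb_smooth n" and h: "h \<in> CM_space H" and t: "\<And>i. i < n \<Longrightarrow> 0 \<le> t i" and N: "sets N = sets half_line"
  shows "cylinder_deriv H n t f h \<in> borel_measurable (P \<Otimes>\<^sub>M N)"
proof -
  have "(\<lambda>x. \<Sum>i<n. h (t i * time_H H (snd x)) * cylinder H n t (partial_deriv i f) x) \<in> borel_measurable (P \<Otimes>\<^sub>M N)"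
    using t by (intro borel_measurable_sum borel_measurable_times CM_time_measurable[OF h _ N]
      cyl_measurable[OF Cb_smooth_partial_continuous[OF f] _ N]) auto
  then show ?thesis unfolding cylinder_deriv_def by (simp add: case_prod_beta')
qed

text \<open>
  Hoelder continuity of \<open>h\<close> gives a multiple of \<open>(s \<tau>\<^sub>H)\<^sup>H =
  s\<^sup>H \<tau>\<^sup>1\<^sup>/\<^sup>2\<close>, and \<open>\<tau>\<^sup>1\<^sup>/\<^sup>2
  \<le> 1 + \<tau>\<close>.
\<close>

lemma CM_growth:
  assumes h: "h \<in> CM_space H"
  shows "\<exists>C\<ge>0. \<forall>\<tau>\<ge>0. \<forall>s. 0 \<le> s \<and> s \<le> T \<longrightarrow> \<bar>h (s * time_H H \<tau>)\<bar> \<le> C * (1 + \<tau>)"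
proof -
  define A where "A = sqrt (\<integral>r. (CM_dot H h r)\<^sup>2 \<partial>half_line)"
  have A: "A \<ge> 0" by (simp add: A_def)
  have "\<bar>h (s * time_H H \<tau>)\<bar> \<le> A * T powr H * (1 + \<tau>)" if \<tau>: "0 \<le> \<tau>" and s: "0 \<le> s" "s \<le> T" for \<tau> s
  proof -
    have p: "0 \<le> s * time_H H \<tau>" using s by (simp add: time_H_def)
    have "\<bar>kernel_op H (CM_dot H h) (s * time_H H \<tau>) - kernel_op H (CM_dot H h) 0\<bar> \<le> A * \<bar>s * time_H H \<tau> - 0\<bar> powr H"
      unfolding A_def by (rule kernel_op_Hoelder[OF CM_dot_L2[OF h] p]) simp
    then have "\<bar>h (s * time_H H \<tau>)\<bar> \<le> A * (s * time_H H \<tau>) powr H"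
      using p by (simp add: kernel_op_CM_dot[OF h] kernel_op_zero[of "CM_dot H h", unfolded kernel_op_CM_dot[OF h]])
    also have "(s * time_H H \<tau>) powr H = s powr H * \<tau> powr (1/2)"
      using s H by (simp add: powr_mult time_H_def powr_powr)
    also have "A * (s powr H * \<tau> powr (1/2)) \<le> A * (T powr H * (1 + \<tau>))"
    proof -
      have "\<tau> powr (1/2) = sqrt \<tau>" using \<tau> by (simp add: powr_half_sqrt)
      also have "\<dots> \<le> 1 + \<tau>" using \<tau> by (intro real_le_lsqrt) (auto simp: power2_eq_square algebra_simps)
      finally show ?thesis using A s H by (intro mult_left_mono mult_mono powr_mono2) auto
    qed
    finally show ?thesis by (simp add: mult.assoc)
  qed
  then show ?thesis using A by (intro exI[of _ "A * T powr H"]) auto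
qed

text \<open>
  The operator is causal: its value at \<open>u\<close> depends on the argument up to time
  \<open>u\<close> only. So stopping the Wiener integral at \<open>S\<close> does not change its
  covariances with path values before \<open>S\<close>.
\<close>

lemma kernel_op_stopped:
  assumes h: "h \<in> CM_space H" and u: "0 \<le> u" "u \<le> S"
  shows "kernel_op H (\<lambda>r. CM_dot H h r * indicator {0..S} r) u = h u"
proof -
  have "kernel_op H (\<lambda>r. CM_dot H h r * indicator {0..S} r) u = kernel_op H (CM_dot H h) u"
    unfolding kernel_op_eq_inner integral_half_line
    using u by (intro Bochner_Integration.integral_cong) (auto simp: indicator_def kernel_eq_0)
  then show ?thesis by (simp add: kernel_op_CM_dot[OF h])
qed

lemma stopped_L2: "f \<in> L2_fun half_line \<Longrightarrow> (\<lambda>r. f r * indicator {0..S} r) \<in> L2_fun half_line"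
  by (rule L2_indicator) (auto simp: sets_restrict_space_iff)

lemma wiener_ibp:
  fixes u :: "nat \<Rightarrow> real"
  assumes h: "h \<in> CM_space H" and u: "\<And>i. 0 \<le> u i \<and> u i \<le> S"
    and \<Phi>: "continuous_on UNIV \<Phi>" and K: "\<And>x. \<bar>\<Phi> x\<bar> \<le> K"
    and L: "\<And>\<epsilon> x. \<bar>\<Phi> (\<lambda>i. x i + \<epsilon> * h (u i)) - \<Phi> x\<bar> \<le> L * \<bar>\<epsilon>\<bar>"
    and D: "\<And>x. ((\<lambda>\<epsilon>. (\<Phi> (\<lambda>i. x i + \<epsilon> * h (u i)) - \<Phi> x) / \<epsilon>) \<longlongrightarrow> D x) (at 0)"
  shows "(\<integral>w. wiener_map (\<lambda>r. CM_dot H h r * indicator {0..S} r) w * \<Phi> (\<lambda>i. w (u i)) \<partial>P) = (\<integral>w. D (\<lambda>i. w (u i)) \<partial>P)"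
proof (rule integration_by_parts_directional[OF _ _ _ \<Phi> K L D])
  note fL = stopped_L2[OF CM_dot_L2[OF h], of S]
  show "(\<lambda>w. w (u i)) \<in> borel_measurable P" for i using u by (intro coord_measurable) simp
  show "integrable P (wiener_map (\<lambda>r. CM_dot H h r * indicator {0..S} r))"
    by (rule L2_integrable[OF wiener_L2[OF fL]])
  show "(\<integral>w. wiener_map (\<lambda>r. CM_dot H h r * indicator {0..S} r) w * sin ((\<Sum>i<m. c i * w (u i)) + \<theta>) \<partial>P)
     = (\<Sum>i<m. c i * h (u i)) * (\<integral>w. cos ((\<Sum>i<m. c i * w (u i)) + \<theta>) \<partial>P)" for m c \<theta>
    using wiener_sin[OF fL, of u c m \<theta>] u by (simp add: kernel_op_stopped[OF h])
qed

text \<open>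
  The two lists of time points are merged into one sequence, with those of \<open>f\<close> at
  even and those of \<open>g\<close> at odd indices. The product is then a single function
  \<open>\<Phi>\<close> of the path values, and unused indices carry the time \<open>0\<close>,
  where the path vanishes.
\<close>

lemma cylinder_ibp:
  assumes h: "h \<in> CM_space H" and \<tau>: "0 \<le> \<tau>"
    and f: "f \<in> Cb_smooth n" "\<And>i. i < n \<Longrightarrow> 0 \<le> t i \<and> t i \<le> T"
    and g: "g \<in> Cb_smooth m" "\<And>i. i < m \<Longrightarrow> 0 \<le> s i \<and> s i \<le> T" and T: "0 \<le> T"
  shows "(\<integral>w. wiener_map (\<lambda>r. CM_dot H h r * indicator {0..T * time_H H \<tau>} r) w * (cylinder H n t f (w, \<tau>) * cylinder H m s g (w, \<tau>)) \<partial>P)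
   = (\<integral>w. cylinder_deriv H n t f h (w, \<tau>) * cylinder H m s g (w, \<tau>) + cylinder H n t f (w, \<tau>) * cylinder_deriv H m s g h (w, \<tau>) \<partial>P)"
proof -
  define \<sigma> where "\<sigma> = time_H H \<tau>"
  have \<sigma>: "0 \<le> \<sigma>" by (simp add: \<sigma>_def time_H_def)
  define u where "u k = (if even k then (if k div 2 < n then t (k div 2) * \<sigma> else 0) else (if k div 2 < m then s (k div 2) * \<sigma> else 0))" for k :: nat
  have u: "0 \<le> u k \<and> u k \<le> T * \<sigma>" for k
  proof -
    have "0 \<le> p * \<sigma> \<and> p * \<sigma> \<le> T * \<sigma>" if "0 \<le> p \<and> p \<le> T" for p
      using that \<sigma> mult_right_mono[of p T \<sigma>] by simp
    note * = this
    have "(0::real) \<le> 0 \<and> 0 \<le> T * \<sigma>" using *[of 0] T by simp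
    then show ?thesis
      unfolding u_def by (cases "even k"; cases "k div 2 < n"; cases "k div 2 < m") (simp_all only: if_True if_False *[OF f(2)] *[OF g(2)] simp_thms)
  qed
  define \<Phi> where "\<Phi> x = f (\<lambda>i. x (2 * i)) * g (\<lambda>i. x (2 * i + 1))" for x :: "nat \<Rightarrow> real"
  define D where "D x = (\<Sum>i<n. h (u (2 * i)) * partial_deriv i f (\<lambda>i. x (2 * i))) * g (\<lambda>i. x (2 * i + 1))
     + f (\<lambda>i. x (2 * i)) * (\<Sum>i<m. h (u (2 * i + 1)) * partial_deriv i g (\<lambda>i. x (2 * i + 1)))" for x :: "nat \<Rightarrow> real"
  obtain Kf where "\<forall>x. \<bar>f x\<bar> \<le> Kf" using Cb_smooth_bounded[OF f(1)] ..
  then have Kf: "\<bar>f x\<bar> \<le> Kf" for x ..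
  obtain Kg where "\<forall>x. \<bar>g x\<bar> \<le> Kg" using Cb_smooth_bounded[OF g(1)] ..
  then have Kg: "\<bar>g x\<bar> \<le> Kg" for x ..
  obtain Lf where Lf': "0 \<le> Lf \<and> (\<forall>i<n. \<forall>x. \<bar>partial_deriv i f x\<bar> \<le> Lf)"
    using Cb_smooth_partial_bounded[OF f(1)] ..
  have Lf: "\<bar>partial_deriv i f x\<bar> \<le> Lf" if "i < n" for i x using Lf' that by simp
  obtain Lg where Lg': "0 \<le> Lg \<and> (\<forall>i<m. \<forall>x. \<bar>partial_deriv i g x\<bar> \<le> Lg)"
    using Cb_smooth_partial_bounded[OF g(1)] ..
  have Lg: "\<bar>partial_deriv i g x\<bar> \<le> Lg" if "i < m" for i x using Lg' that by simp
  have K0: "0 \<le> Kf" "0 \<le> Kg" using order_trans[OF abs_ge_zero Kf] order_trans[OF abs_ge_zero Kg] by simp_all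
  have \<Phi>: "continuous_on UNIV \<Phi>"
    unfolding \<Phi>_def
    by (rule continuous_on_mult[OF continuous_on_reindex[OF Cb_smooth_continuous[OF f(1)], of "\<lambda>i. 2 * i"]
          continuous_on_reindex[OF Cb_smooth_continuous[OF g(1)], of "\<lambda>i. 2 * i + 1"]])
  have \<Phi>K: "\<bar>\<Phi> x\<bar> \<le> Kf * Kg" for x
    unfolding \<Phi>_def abs_mult by (rule mult_mono[OF Kf Kg K0(1) abs_ge_zero])
  define af where "af = (\<lambda>i. h (u (2 * i)))"
  define ag where "ag = (\<lambda>i. h (u (2 * i + 1)))"
  define cf where "cf = (\<Sum>i<n. \<bar>af i\<bar>) * Lf"
  define cg where "cg = (\<Sum>i<m. \<bar>ag i\<bar>) * Lg"
  have inc: "\<bar>f (\<lambda>i. x (2 * i) + \<epsilon> * af i) - f (\<lambda>i. x (2 * i))\<bar> \<le> cf * \<bar>\<epsilon>\<bar>"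
    "\<bar>g (\<lambda>i. x (2 * i + 1) + \<epsilon> * ag i) - g (\<lambda>i. x (2 * i + 1))\<bar> \<le> cg * \<bar>\<epsilon>\<bar>" for x \<epsilon>
    unfolding cf_def cg_def by (rule Cb_smooth_directional(2)[OF f(1) Lf] Cb_smooth_directional(2)[OF g(1) Lg], assumption)+
  have \<Phi>e: "\<Phi> (\<lambda>i. x i + \<epsilon> * h (u i)) = f (\<lambda>i. x (2 * i) + \<epsilon> * af i) * g (\<lambda>i. x (2 * i + 1) + \<epsilon> * ag i)" for x \<epsilon>
    by (simp add: \<Phi>_def af_def ag_def)
  have split: "\<Phi> (\<lambda>i. x i + \<epsilon> * h (u i)) - \<Phi> x =
     (f (\<lambda>i. x (2 * i) + \<epsilon> * af i) - f (\<lambda>i. x (2 * i))) * g (\<lambda>i. x (2 * i + 1) + \<epsilon> * ag i)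
     + f (\<lambda>i. x (2 * i)) * (g (\<lambda>i. x (2 * i + 1) + \<epsilon> * ag i) - g (\<lambda>i. x (2 * i + 1)))" for x \<epsilon>
    unfolding \<Phi>e unfolding \<Phi>_def by (simp only: left_diff_distrib right_diff_distrib)
  have L: "\<bar>\<Phi> (\<lambda>i. x i + \<epsilon> * h (u i)) - \<Phi> x\<bar> \<le> (cf * Kg + Kf * cg) * \<bar>\<epsilon>\<bar>" for x \<epsilon>
  proof -
    have c0: "0 \<le> cf * \<bar>\<epsilon>\<bar>" using inc(1)[of x \<epsilon>] by (rule order_trans[OF abs_ge_zero])
    have prod: "\<bar>p * q\<bar> \<le> P * Q" if "\<bar>p\<bar> \<le> P" "\<bar>q\<bar> \<le> Q" "0 \<le> P" for p q P Q :: real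
      unfolding abs_mult using that by (intro mult_mono) auto
    have "\<bar>\<Phi> (\<lambda>i. x i + \<epsilon> * h (u i)) - \<Phi> x\<bar> \<le> (cf * \<bar>\<epsilon>\<bar>) * Kg + Kf * (cg * \<bar>\<epsilon>\<bar>)"
      unfolding split
      by (rule order_trans[OF abs_triangle_ineq add_mono[OF prod[OF inc(1) Kg c0] prod[OF Kf inc(2) K0(1)]]])
    also have "\<dots> = (cf * Kg + Kf * cg) * \<bar>\<epsilon>\<bar>" by (simp only: distrib_right distrib_left mult_ac)
    finally show ?thesis .
  qed
  have Dl: "((\<lambda>\<epsilon>. (\<Phi> (\<lambda>i. x i + \<epsilon> * h (u i)) - \<Phi> x) / \<epsilon>) \<longlongrightarrow> D x) (at 0)" for x
  proof -
    have gl: "((\<lambda>\<epsilon>. g (\<lambda>i. x (2 * i + 1) + \<epsilon> * ag i)) \<longlongrightarrow> g (\<lambda>i. x (2 * i + 1))) (at 0)"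
    proof (rule tendsto_coordinatewise[OF Cb_smooth_continuous[OF g(1)]])
      fix i
      have "((\<lambda>\<epsilon>. x (2 * i + 1) + \<epsilon> * ag i) \<longlongrightarrow> x (2 * i + 1) + 0 * ag i) (at 0)" by (intro tendsto_intros)
      then show "((\<lambda>\<epsilon>. x (2 * i + 1) + \<epsilon> * ag i) \<longlongrightarrow> x (2 * i + 1)) (at 0)" by simp
    qed
    have "((\<lambda>\<epsilon>. (f (\<lambda>i. x (2 * i) + \<epsilon> * af i) - f (\<lambda>i. x (2 * i))) / \<epsilon> * g (\<lambda>i. x (2 * i + 1) + \<epsilon> * ag i)
       + f (\<lambda>i. x (2 * i)) * ((g (\<lambda>i. x (2 * i + 1) + \<epsilon> * ag i) - g (\<lambda>i. x (2 * i + 1))) / \<epsilon>)) \<longlongrightarrow>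
       (\<Sum>i<n. af i * partial_deriv i f (\<lambda>i. x (2 * i))) * g (\<lambda>i. x (2 * i + 1))
       + f (\<lambda>i. x (2 * i)) * (\<Sum>i<m. ag i * partial_deriv i g (\<lambda>i. x (2 * i + 1)))) (at 0)"
      by (intro tendsto_add tendsto_mult tendsto_const gl Cb_smooth_directional(1)[OF f(1)] Cb_smooth_directional(1)[OF g(1)])
    then show ?thesis
      unfolding split D_def af_def ag_def by (simp add: add_divide_distrib)
  qed
  note ibp = wiener_ibp[OF h u \<Phi> \<Phi>K L Dl]
  have xf: "(\<lambda>i. if i < n then w (t i * \<sigma>) else 0) = (\<lambda>i. w (u (2 * i)))"
    and xg: "(\<lambda>i. if i < m then w (s i * \<sigma>) else 0) = (\<lambda>i. w (u (2 * i + 1)))" if "w 0 = 0" for w :: "real \<Rightarrow> real"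
    using that by (auto simp: u_def fun_eq_iff)
  have w0: "w 0 = 0" if "w \<in> space P" for w using that fbm by (auto simp: fbm_law_def path_space_def)
  have 1: "cylinder H n t f (w, \<tau>) * cylinder H m s g (w, \<tau>) = \<Phi> (\<lambda>i. w (u i))" if "w \<in> space P" for w
    unfolding cylinder_def \<Phi>_def prod.case \<sigma>_def[symmetric] xf[of w, OF w0[OF that]] xg[of w, OF w0[OF that]] ..
  have 2: "cylinder_deriv H n t f h (w, \<tau>) * cylinder H m s g (w, \<tau>) + cylinder H n t f (w, \<tau>) * cylinder_deriv H m s g h (w, \<tau>) = D (\<lambda>i. w (u i))" if "w \<in> space P" for w
  proof -
    have "(\<Sum>i<n. h (u (2 * i)) * p i) = (\<Sum>i<n. h (t i * \<sigma>) * p i)" for p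
      by (intro sum.cong refl) (simp add: u_def)
    moreover have "(\<Sum>i<m. h (u (2 * i + 1)) * p i) = (\<Sum>i<m. h (s i * \<sigma>) * p i)" for p
      by (intro sum.cong refl) (simp add: u_def)
    ultimately show ?thesis
      unfolding cylinder_deriv_def cylinder_def D_def prod.case \<sigma>_def[symmetric] xf[of w, OF w0[OF that]] xg[of w, OF w0[OF that]]
      by (simp only:)
  qed
  have "(\<integral>w. wiener_map (\<lambda>r. CM_dot H h r * indicator {0..T * \<sigma>} r) w * (cylinder H n t f (w, \<tau>) * cylinder H m s g (w, \<tau>)) \<partial>P)
     = (\<integral>w. wiener_map (\<lambda>r. CM_dot H h r * indicator {0..T * \<sigma>} r) w * \<Phi> (\<lambda>i. w (u i)) \<partial>P)"
    by (intro Bochner_Integration.integral_cong refl) (simp add: 1)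
  also have "\<dots> = (\<integral>w. D (\<lambda>i. w (u i)) \<partial>P)" by (rule ibp)
  also have "\<dots> = (\<integral>w. cylinder_deriv H n t f h (w, \<tau>) * cylinder H m s g (w, \<tau>) + cylinder H n t f (w, \<tau>) * cylinder_deriv H m s g h (w, \<tau>) \<partial>P)"
    by (intro Bochner_Integration.integral_cong refl) (simp only: 2)
  finally show ?thesis unfolding \<sigma>_def .
qed

end

section \<open>Integration over the random time\<close>

lemma integrable_pair_linear_growth:
  fixes q :: "'a \<times> real \<Rightarrow> real"
  assumes P: "prob_space P" and N: "prob_space N" "space N = {0..}" "integrable N (\<lambda>\<tau>. \<tau>)"
    and q: "q \<in> borel_measurable (P \<Otimes>\<^sub>M N)"
    and bound: "\<And>w \<tau>. 0 \<le> \<tau> \<Longrightarrow> \<bar>q (w, \<tau>)\<bar> \<le> C * (1 + \<tau>)"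
  shows "integrable (P \<Otimes>\<^sub>M N) q"
proof (rule integrableI_bounded[OF q])
  interpret P: prob_space P by fact
  interpret N: prob_space N by fact
  interpret PN: pair_prob_space P N ..
  have i: "integrable N (\<lambda>\<tau>. C * (1 + \<tau>))" using N(3) by simp
  have m: "(\<lambda>x. ennreal (norm (q x))) \<in> borel_measurable (P \<Otimes>\<^sub>M N)" using q by measurable
  have "(\<integral>\<^sup>+x. ennreal (norm (q x)) \<partial>(P \<Otimes>\<^sub>M N)) = (\<integral>\<^sup>+\<tau>. \<integral>\<^sup>+w. ennreal (norm (q (w, \<tau>))) \<partial>P \<partial>N)"
    by (rule PN.nn_integral_snd[symmetric, OF m])
  also have "\<dots> \<le> (\<integral>\<^sup>+\<tau>. ennreal (norm (C * (1 + \<tau>))) \<partial>N)"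
  proof (rule nn_integral_mono)
    fix \<tau> assume "\<tau> \<in> space N"
    then have "0 \<le> \<tau>" by (simp add: N(2))
    have "(\<integral>\<^sup>+w. ennreal (norm (q (w, \<tau>))) \<partial>P) \<le> (\<integral>\<^sup>+w. ennreal (norm (C * (1 + \<tau>))) \<partial>P)"
      using bound[OF \<open>0 \<le> \<tau>\<close>] by (intro nn_integral_mono ennreal_leI) (simp add: order_trans[OF _ abs_ge_self])
    then show "(\<integral>\<^sup>+w. ennreal (norm (q (w, \<tau>))) \<partial>P) \<le> ennreal (norm (C * (1 + \<tau>)))"
      by (simp add: P.emeasure_space_1)
  qed
  also have "\<dots> < \<infinity>" using i unfolding integrable_iff_bounded by blast
  finally show "(\<integral>\<^sup>+x. ennreal (norm (q x)) \<partial>(P \<Otimes>\<^sub>M N)) < \<infinity>" .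
qed

context fbm_wiener
begin

text \<open>
  The bound does not depend on \<open>S\<close>, so it can be integrated over the random time.
\<close>

lemma stopped_wiener_first_moment:
  assumes f: "f \<in> L2_fun half_line" and Z: "Z \<in> borel_measurable P"
    and eq: "AE w in P. Z w = wiener_map (\<lambda>r. f r * indicator {0..S} r) w"
  shows "(\<integral>\<^sup>+w. ennreal \<bar>Z w\<bar> \<partial>P) \<le> ennreal (1 + (\<integral>r. (f r)\<^sup>2 \<partial>half_line))"
proof -
  define g where "g r = f r * indicator {0..S} r" for r
  have g: "g \<in> L2_fun half_line" unfolding g_def by (rule stopped_L2[OF f])
  note W = wiener_L2[OF g]
  have "(\<integral>\<^sup>+w. ennreal \<bar>Z w\<bar> \<partial>P) \<le> (\<integral>\<^sup>+w. ennreal (1 + (wiener_map g w)\<^sup>2) \<partial>P)"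
  proof (rule nn_integral_mono_AE)
    have *: "\<bar>x\<bar> \<le> 1 + x\<^sup>2" for x :: real
    proof -
      have "0 \<le> (\<bar>x\<bar> - 1)\<^sup>2" by simp
      then have "2 * \<bar>x\<bar> \<le> 1 + x\<^sup>2" by (simp add: power2_eq_square algebra_simps abs_mult_self_eq)
      then show ?thesis using abs_ge_zero[of x] by linarith
    qed
    show "AE w in P. ennreal \<bar>Z w\<bar> \<le> ennreal (1 + (wiener_map g w)\<^sup>2)"
      using eq unfolding g_def[abs_def, symmetric] by eventually_elim (simp only: ennreal_leI[OF *])
  qed
  also have "\<dots> = ennreal (\<integral>w. 1 + (wiener_map g w)\<^sup>2 \<partial>P)"
    using L2_funD(2)[OF W] by (intro nn_integral_eq_integral) auto
  also have "(\<integral>w. 1 + (wiener_map g w)\<^sup>2 \<partial>P) = 1 + (\<integral>r. (g r)\<^sup>2 \<partial>half_line)"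
    using L2_funD(2)[OF W] wiener_norm[OF g] by (simp add: prob_space)
  also have "(\<integral>r. (g r)\<^sup>2 \<partial>half_line) \<le> (\<integral>r. (f r)\<^sup>2 \<partial>half_line)"
    by (rule Bochner_Integration.integral_mono[OF L2_funD(2)[OF g] L2_funD(2)[OF f]])
       (simp add: g_def indicator_def)
  finally show ?thesis by (simp add: ennreal_leI)
qed

text \<open>
  All integrands are dominated by multiples of \<open>1 + \<tau>\<close> or of
  \<open>\<bar>Y\<bar>\<close>, so Fubini's theorem reduces the identity to
  \<open>cylinder_ibp\<close> at each fixed time.
\<close>

lemma integration_by_parts_product:
  assumes h: "h \<in> CM_space H" and T: "0 \<le> T"
    and f: "f \<in> Cb_smooth n" "\<And>i. i < n \<Longrightarrow> 0 \<le> t i \<and> t i \<le> T"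
    and g: "g \<in> Cb_smooth m" "\<And>i. i < m \<Longrightarrow> 0 \<le> s i \<and> s i \<le> T"
    and N: "prob_space N" "space N = {0..}" "integrable N (\<lambda>\<tau>. \<tau>)" "sets N = sets half_line"
    and Zc: "continuous_paths P Z"
    and Z: "\<And>S. 0 \<le> S \<Longrightarrow> AE w in P. Z S w = wiener_map (\<lambda>r. CM_dot H h r * indicator {0..S} r) w"
  defines "F \<equiv> cylinder H n t f" and "G \<equiv> cylinder H m s g"
    and "F' \<equiv> cylinder_deriv H n t f h" and "G' \<equiv> cylinder_deriv H m s g h"
    and "Y \<equiv> \<lambda>x. Z (T * time_H H (snd x)) (fst x)"
  shows "integrable (P \<Otimes>\<^sub>M N) (\<lambda>x. G x * F' x)"
    and "integrable (P \<Otimes>\<^sub>M N) (\<lambda>x. F x * (- G' x + G x * Y x))"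
    and "(\<integral>x. G x * F' x \<partial>(P \<Otimes>\<^sub>M N)) = (\<integral>x. F x * (- G' x + G x * Y x) \<partial>(P \<Otimes>\<^sub>M N))"
proof -
  interpret N: prob_space N by fact
  interpret PN: pair_prob_space P N ..
  have tp: "0 \<le> time_H H \<tau>" for \<tau> by (simp add: time_H_def)
  obtain Kf where "\<forall>x. \<bar>f x\<bar> \<le> Kf" using Cb_smooth_bounded[OF f(1)] ..
  then have Kf: "\<bar>F x\<bar> \<le> Kf" for x by (cases x) (simp add: F_def cylinder_def)
  obtain Kg where "\<forall>x. \<bar>g x\<bar> \<le> Kg" using Cb_smooth_bounded[OF g(1)] ..
  then have Kg: "\<bar>G x\<bar> \<le> Kg" for x by (cases x) (simp add: G_def cylinder_def)
  have K0: "0 \<le> Kf" "0 \<le> Kg" using order_trans[OF abs_ge_zero Kf] order_trans[OF abs_ge_zero Kg] by simp_all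
  obtain C where C: "0 \<le> C \<and> (\<forall>\<tau>\<ge>0. \<forall>s. 0 \<le> s \<and> s \<le> T \<longrightarrow> \<bar>h (s * time_H H \<tau>)\<bar> \<le> C * (1 + \<tau>))"
    using CM_growth[OF h] ..
  have growth: "\<exists>A. \<forall>w \<tau>. 0 \<le> \<tau> \<longrightarrow> \<bar>cylinder_deriv H k p e h (w, \<tau>)\<bar> \<le> A * (1 + \<tau>)"
    if e: "e \<in> Cb_smooth k" "\<And>i. i < k \<Longrightarrow> 0 \<le> p i \<and> p i \<le> T" for k p e
  proof -
    obtain L where L: "0 \<le> L \<and> (\<forall>i<k. \<forall>x. \<bar>partial_deriv i e x\<bar> \<le> L)"
      using Cb_smooth_partial_bounded[OF e(1)] ..
    have "\<bar>cylinder_deriv H k p e h (w, \<tau>)\<bar> \<le> (real k * (C * L)) * (1 + \<tau>)" if "0 \<le> \<tau>" for w \<tau>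
    proof -
      have "\<bar>cylinder_deriv H k p e h (w, \<tau>)\<bar> \<le> (\<Sum>i<k. \<bar>h (p i * time_H H \<tau>) * cylinder H k p (partial_deriv i e) (w, \<tau>)\<bar>)"
        unfolding cylinder_deriv_def prod.case by (rule sum_abs)
      also have "\<dots> \<le> (\<Sum>i<k. (C * (1 + \<tau>)) * L)"
        unfolding abs_mult
      proof (rule sum_mono, rule mult_mono)
        fix i assume "i \<in> {..<k}"
        then have i: "i < k" by simp
        show "\<bar>h (p i * time_H H \<tau>)\<bar> \<le> C * (1 + \<tau>)" using C that e(2)[OF i] by blast
        show "\<bar>cylinder H k p (partial_deriv i e) (w, \<tau>)\<bar> \<le> L" using L i by (simp add: cylinder_def)
        show "0 \<le> C * (1 + \<tau>)" using C that by simp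
      qed simp
      also have "\<dots> = (real k * (C * L)) * (1 + \<tau>)" by (simp add: mult_ac)
      finally show ?thesis .
    qed
    then show ?thesis by (intro exI[of _ "real k * (C * L)"]) simp
  qed
  obtain Cf where Cf: "\<forall>w \<tau>. 0 \<le> \<tau> \<longrightarrow> \<bar>F' (w, \<tau>)\<bar> \<le> Cf * (1 + \<tau>)"
    using growth[OF f] unfolding F'_def ..
  obtain Cg where Cg: "\<forall>w \<tau>. 0 \<le> \<tau> \<longrightarrow> \<bar>G' (w, \<tau>)\<bar> \<le> Cg * (1 + \<tau>)"
    using growth[OF g] unfolding G'_def ..
  have Fm[measurable]: "F \<in> borel_measurable (P \<Otimes>\<^sub>M N)" unfolding F_def
    by (rule cyl_measurable[OF Cb_smooth_continuous[OF f(1)] f(2)[THEN conjunct1] N(4)])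
  have Gm[measurable]: "G \<in> borel_measurable (P \<Otimes>\<^sub>M N)" unfolding G_def
    by (rule cyl_measurable[OF Cb_smooth_continuous[OF g(1)] g(2)[THEN conjunct1] N(4)])
  have F'm[measurable]: "F' \<in> borel_measurable (P \<Otimes>\<^sub>M N)" unfolding F'_def
    by (rule cyl_deriv_measurable[OF f(1) h f(2)[THEN conjunct1] N(4)])
  have G'm[measurable]: "G' \<in> borel_measurable (P \<Otimes>\<^sub>M N)" unfolding G'_def
    by (rule cyl_deriv_measurable[OF g(1) h g(2)[THEN conjunct1] N(4)])
  have Ym[measurable]: "Y \<in> borel_measurable (P \<Otimes>\<^sub>M N)" unfolding Y_def
    by (rule random_time_measurable[OF Zc scaled_time_measurable[OF N(4)]]) (use T tp in simp)
  have GF'_bound: "\<bar>G (w, \<tau>) * F' (w, \<tau>)\<bar> \<le> (Kg * Cf) * (1 + \<tau>)" if "0 \<le> \<tau>" for w \<tau>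
    unfolding abs_mult mult.assoc using Cf that by (intro mult_mono Kg K0) auto
  have FG'_bound: "\<bar>F (w, \<tau>) * G' (w, \<tau>)\<bar> \<le> (Kf * Cg) * (1 + \<tau>)" if "0 \<le> \<tau>" for w \<tau>
    unfolding abs_mult mult.assoc using Cg that by (intro mult_mono Kf K0) auto
  show i1: "integrable (P \<Otimes>\<^sub>M N) (\<lambda>x. G x * F' x)"
    by (rule integrable_pair_linear_growth[OF prob_space_axioms N(1-3) _ GF'_bound]) measurable
  have i2: "integrable (P \<Otimes>\<^sub>M N) (\<lambda>x. F x * G' x)"
    by (rule integrable_pair_linear_growth[OF prob_space_axioms N(1-3) _ FG'_bound]) measurable
  have Zm: "Z S \<in> borel_measurable P" if "0 \<le> S" for S
    using Zc that by (simp add: continuous_paths_def)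
  have iY: "integrable (P \<Otimes>\<^sub>M N) Y"
  proof (rule integrableI_bounded[OF Ym])
    let ?c = "1 + (\<integral>r. (CM_dot H h r)\<^sup>2 \<partial>half_line)"
    have "(\<integral>\<^sup>+x. ennreal (norm (Y x)) \<partial>(P \<Otimes>\<^sub>M N)) = (\<integral>\<^sup>+\<tau>. \<integral>\<^sup>+w. ennreal (norm (Y (w, \<tau>))) \<partial>P \<partial>N)"
      by (rule PN.nn_integral_snd[symmetric]) measurable
    also have "\<dots> \<le> (\<integral>\<^sup>+\<tau>. ennreal ?c \<partial>N)"
    proof (rule nn_integral_mono)
      fix \<tau>
      have S: "0 \<le> T * time_H H \<tau>" using T tp by simp
      show "(\<integral>\<^sup>+w. ennreal (norm (Y (w, \<tau>))) \<partial>P) \<le> ennreal ?c"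
        using stopped_wiener_first_moment[OF CM_dot_L2[OF h] Zm[OF S] Z[OF S]] by (simp add: Y_def)
    qed
    also have "\<dots> < \<infinity>" by (simp add: N.emeasure_space_1)
    finally show "(\<integral>\<^sup>+x. ennreal (norm (Y x)) \<partial>(P \<Otimes>\<^sub>M N)) < \<infinity>" .
  qed
  have FGY: "\<bar>F x * G x * Y x\<bar> \<le> \<bar>Kf * Kg * Y x\<bar>" for x
    unfolding abs_mult using K0 Kf[of x] Kg[of x] by (intro mult_right_mono mult_mono) auto
  have i3: "integrable (P \<Otimes>\<^sub>M N) (\<lambda>x. F x * G x * Y x)"
  proof (rule Bochner_Integration.integrable_bound)
    show "integrable (P \<Otimes>\<^sub>M N) (\<lambda>x. Kf * Kg * Y x)" using iY by simp
    show "AE x in P \<Otimes>\<^sub>M N. norm (F x * G x * Y x) \<le> norm (Kf * Kg * Y x)"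
      unfolding real_norm_def by (intro AE_I2 FGY)
  qed measurable
  have expand: "F x * (- G' x + G x * Y x) = F x * G x * Y x - F x * G' x" for x by (simp add: algebra_simps)
  show i4: "integrable (P \<Otimes>\<^sub>M N) (\<lambda>x. F x * (- G' x + G x * Y x))"
    unfolding expand by (rule Bochner_Integration.integrable_diff[OF i3 i2])
  have fixed: "(\<integral>w. G (w, \<tau>) * F' (w, \<tau>) \<partial>P) = (\<integral>w. F (w, \<tau>) * G (w, \<tau>) * Y (w, \<tau>) - F (w, \<tau>) * G' (w, \<tau>) \<partial>P)"
    if \<tau>: "\<tau> \<in> space N" for \<tau>
  proof -
    have \<tau>0: "0 \<le> \<tau>" using \<tau> by (simp add: N(2))
    define S where "S = T * time_H H \<tau>"
    have S: "0 \<le> S" using T tp by (simp add: S_def)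
    define W where "W = wiener_map (\<lambda>r. CM_dot H h r * indicator {0..S} r)"
    have WL: "W \<in> L2_fun P" unfolding W_def by (rule wiener_L2[OF stopped_L2[OF CM_dot_L2[OF h]]])
    have Wi: "integrable P W" by (rule L2_integrable[OF WL])
    note sec = measurable_Pair1[OF _ \<tau>]
    have [measurable]: "(\<lambda>w. F (w, \<tau>)) \<in> borel_measurable P" "(\<lambda>w. G (w, \<tau>)) \<in> borel_measurable P"
      "(\<lambda>w. F' (w, \<tau>)) \<in> borel_measurable P" "(\<lambda>w. G' (w, \<tau>)) \<in> borel_measurable P"
      "(\<lambda>w. Y (w, \<tau>)) \<in> borel_measurable P" "W \<in> borel_measurable P"
      using sec[OF Fm] sec[OF Gm] sec[OF F'm] sec[OF G'm] sec[OF Ym] L2_funD(1)[OF WL] by auto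
    have b1: "integrable P (\<lambda>w. G (w, \<tau>) * F' (w, \<tau>))"
      by (rule integrable_const_bound[of _ "(Kg * Cf) * (1 + \<tau>)"]) (use GF'_bound[OF \<tau>0] in auto)
    have b2: "integrable P (\<lambda>w. F (w, \<tau>) * G' (w, \<tau>))"
      by (rule integrable_const_bound[of _ "(Kf * Cg) * (1 + \<tau>)"]) (use FG'_bound[OF \<tau>0] in auto)
    have b3: "integrable P (\<lambda>w. W w * (F (w, \<tau>) * G (w, \<tau>)))"
    proof (rule Bochner_Integration.integrable_bound)
      show "integrable P (\<lambda>w. Kf * Kg * W w)" using Wi by simp
      have "\<bar>W w * (F (w, \<tau>) * G (w, \<tau>))\<bar> \<le> \<bar>Kf * Kg * W w\<bar>" for w
        unfolding abs_mult mult.commute[of "\<bar>W w\<bar>"]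
        using K0 Kf[of "(w, \<tau>)"] Kg[of "(w, \<tau>)"] by (intro mult_right_mono mult_mono) auto
      then show "AE w in P. norm (W w * (F (w, \<tau>) * G (w, \<tau>))) \<le> norm (Kf * Kg * W w)"
        unfolding real_norm_def by (intro AE_I2)
    qed measurable
    have "(\<integral>w. W w * (F (w, \<tau>) * G (w, \<tau>)) \<partial>P) = (\<integral>w. F' (w, \<tau>) * G (w, \<tau>) + F (w, \<tau>) * G' (w, \<tau>) \<partial>P)"
      unfolding W_def S_def F_def G_def F'_def G'_def by (rule cylinder_ibp[OF h \<tau>0 f g T])
    also have "\<dots> = (\<integral>w. G (w, \<tau>) * F' (w, \<tau>) \<partial>P) + (\<integral>w. F (w, \<tau>) * G' (w, \<tau>) \<partial>P)"
      using b1 b2 by (subst Bochner_Integration.integral_add[symmetric]) (auto simp: mult.commute)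
    finally have main: "(\<integral>w. G (w, \<tau>) * F' (w, \<tau>) \<partial>P) = (\<integral>w. W w * (F (w, \<tau>) * G (w, \<tau>)) \<partial>P) - (\<integral>w. F (w, \<tau>) * G' (w, \<tau>) \<partial>P)"
      by simp
    also have "\<dots> = (\<integral>w. W w * (F (w, \<tau>) * G (w, \<tau>)) - F (w, \<tau>) * G' (w, \<tau>) \<partial>P)"
      by (rule Bochner_Integration.integral_diff[symmetric, OF b3 b2])
    also have "\<dots> = (\<integral>w. F (w, \<tau>) * G (w, \<tau>) * Y (w, \<tau>) - F (w, \<tau>) * G' (w, \<tau>) \<partial>P)"
    proof (rule integral_cong_AE)
      show "AE w in P. W w * (F (w, \<tau>) * G (w, \<tau>)) - F (w, \<tau>) * G' (w, \<tau>) = F (w, \<tau>) * G (w, \<tau>) * Y (w, \<tau>) - F (w, \<tau>) * G' (w, \<tau>)"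
        using Z[OF S] by eventually_elim (simp add: W_def Y_def S_def)
    qed measurable
    finally show ?thesis .
  qed
  have "(\<integral>x. G x * F' x \<partial>(P \<Otimes>\<^sub>M N)) = (\<integral>\<tau>. (\<integral>w. G (w, \<tau>) * F' (w, \<tau>) \<partial>P) \<partial>N)"
    using PN.integral_snd[of "\<lambda>w \<tau>. G (w, \<tau>) * F' (w, \<tau>)"] i1 by (simp add: case_prod_beta')
  also have "\<dots> = (\<integral>\<tau>. (\<integral>w. F (w, \<tau>) * G (w, \<tau>) * Y (w, \<tau>) - F (w, \<tau>) * G' (w, \<tau>) \<partial>P) \<partial>N)"
    by (rule Bochner_Integration.integral_cong[OF refl fixed])
  also have "\<dots> = (\<integral>x. F x * G x * Y x - F x * G' x \<partial>(P \<Otimes>\<^sub>M N))"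
    using PN.integral_snd[of "\<lambda>w \<tau>. F (w, \<tau>) * G (w, \<tau>) * Y (w, \<tau>) - F (w, \<tau>) * G' (w, \<tau>)"]
      Bochner_Integration.integrable_diff[OF i3 i2] by (simp add: case_prod_beta')
  finally show "(\<integral>x. G x * F' x \<partial>(P \<Otimes>\<^sub>M N)) = (\<integral>x. F x * (- G' x + G x * Y x) \<partial>(P \<Otimes>\<^sub>M N))"
    unfolding expand .
qed

end

theorem theorem4p8:
  fixes \<beta> H T :: real
    and P :: "(real \<Rightarrow> real) measure"
    and M :: "real \<Rightarrow> real"
    and \<delta> :: "(real \<Rightarrow> real) \<Rightarrow> (real \<Rightarrow> real) \<Rightarrow> real"
    and B Z :: "real \<Rightarrow> (real \<Rightarrow> real) \<Rightarrow> real"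
    and h :: "real \<Rightarrow> real"
    and F G :: "(real \<Rightarrow> real) \<times> real \<Rightarrow> real"
  assumes "0 < \<beta>" "\<beta> < 1" "1/2 < H" "H < 1" "0 < T"
    and "fbm_law H P"
    and "M_density \<beta> M"
    and "CM_isometry H P \<delta>"
    and "continuous_version P (\<lambda>t. \<delta> (kernel_op H (indicator {0..t}))) B"
    and "h \<in> CM_space H"
    and "wiener_integral_process P B (CM_dot H h) Z"
    and "F \<in> cylinder_funs H T" "G \<in> cylinder_funs H T"
  shows "integrable (P \<Otimes>\<^sub>M time_law M) (\<lambda>x. G x * D1 h F x) \<and>
         integrable (P \<Otimes>\<^sub>M time_law M) (\<lambda>x. F x * D1_adj H T Z h G x) \<and>
         (\<integral>x. G x * D1 h F x \<partial>(P \<Otimes>\<^sub>M time_law M)) =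
         (\<integral>x. F x * D1_adj H T Z h G x \<partial>(P \<Otimes>\<^sub>M time_law M))"
proof -
  interpret fbm_wiener H P \<delta>
    using assms(3,4,6,8) by unfold_locales
  have cylinder: "\<exists>n t f. f \<in> Cb_smooth n \<and> (\<forall>i<n. 0 \<le> t i \<and> t i \<le> T) \<and> E = cylinder H n t f"
    if "E \<in> cylinder_funs H T" for E
  proof -
    from that obtain n t f where *: "f \<in> Cb_smooth n" "\<forall>i<n. 0 < t i \<and> t i \<le> T"
      "E = (\<lambda>(w, \<tau>). f (\<lambda>i. w (t i * time_H H \<tau>)))"
      unfolding cylinder_funs_def by blast
    then show ?thesis using cylinder_fun_eq_cyl[OF *(1), of t H]
      by (intro exI[of _ n] exI[of _ t] exI[of _ f]) (simp add: less_imp_le)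
  qed
  from cylinder[OF assms(12)] obtain n t f where f: "f \<in> Cb_smooth n" "\<forall>i<n. 0 \<le> t i \<and> t i \<le> T" and F: "F = cylinder H n t f"
    by blast
  from cylinder[OF assms(13)] obtain m s g where g: "g \<in> Cb_smooth m" "\<forall>i<m. 0 \<le> s i \<and> s i \<le> T" and G: "G = cylinder H m s g"
    by blast
  note law = time_law_moment[OF assms(1) assms(7)]
  have Zc: "continuous_paths P Z" using assms(11) by (simp add: wiener_integral_process_def)
  have Z: "AE w in P. Z S w = wiener_map (\<lambda>r. CM_dot H h r * indicator {0..S} r) w" if "0 \<le> S" for S
    using assms(11) that unfolding wiener_integral_process_def
    by (intro wiener_integral_eq_wiener[OF assms(9) stopped_L2[OF CM_dot_L2[OF assms(10)]]]) simp
  have adj: "D1_adj H T Z h G = (\<lambda>x. - cylinder_deriv H m s g h x + cylinder H m s g x * Z (T * time_H H (snd x)) (fst x))"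
    unfolding D1_adj_def G D1_cyl[OF g(1)] by (simp add: case_prod_beta')
  have F': "D1 h F = cylinder_deriv H n t f h" unfolding F by (rule D1_cyl[OF f(1)])
  show ?thesis
    unfolding adj F' unfolding F G
    using integration_by_parts_product[OF assms(10) less_imp_le[OF assms(5)] f(1) f(2)[rule_format] g(1) g(2)[rule_format]
        law(1,3,2,4) Zc Z] by simp
qed

end
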